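(* Assume that $U_0,V_1,\dots,V_d$ satisfy both (A) and (B) below. (A) There are constants $c_0,c_1,c_2,q,K,b_0>0$ and $b_1\ge0$ such that for all $x,y\in\mathbb R^N$: - $\sum_{k=1}^d|V_k(x)-V_k(y)|\le c_1|x-y|$ and $\sum_{k=1}^d|V_k(x)|^2\le K$; - $\langle U_0(x),x\rangle\le-b_0|x|^2+b_1$; - $\langle U_0(x)-U_0(y),x-y\rangle\le c_0|x-y|^2$; - $|U_0(x)-U_0(y)|^2\le c_2(1+|x|^{2q}+|y|^{2q})|x-y|^2$. (B) There are a constant $\beta\ge1$ and a function $\lambda:\mathbb R^N\to(0,\infty)$ with $\inf_x\lambda(x)>0$ such that $-\beta\lambda(x)|v|^2\le v^T\nabla U_0(x)v\le-\lambda(x)|v|^2$ for all $x,v\in\mathbb R^N$; there is $\alpha>0$ with $\sum_{i,j=1}^N|\partial_j\partial_iU_0(x)|\le\alpha\lambda(x)$ for all $x$; and there are $\rho\in(0,\tfrac15)$ and $\hat K>0$ such that for all $x\in\mathbb R^N$: $\sum_{k=1}^d\|\nabla V_k(x)\|^2\le\frac{\rho}{N\beta^2}\lambda(x)$, $\sup_k|V_k(x)|\le\hat K$, and $$\sum_{k=1}^d\left(\Big(\sum_{m,m'=1}^N|\partial_m\partial_{m'}V_k(x)|^2\Big)^{1/2}+\alpha\|\nabla V_k(x)\|\right)\le\frac{\rho}{\hat K\beta^2}\lambda(x).$$ Let $\{Y^\delta_{t_n}\}_{n\in\mathbb N}$ be the implicit Euler approximation of $x_t$. Then there exists a constant $C>0$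 (independent of $f$, $x$, $\delta$) such that $$\sup_{n\in\mathbb N}\left|\mathbb E_x[f(x_{t_n})]-\mathbb E_x[f(Y^\delta_{t_n})]\right|\le C\,\|f\|_{\mathcal C^2_b}\,\delta^{1/2}\left(1+|x|^{(2q+1)(q+1)}\right)$$ for every $x\in\mathbb R^N$, $f\in\mathcal C^2_b(\mathbb R^N)$ and every $\delta>0$ small enough (i.e. all $\delta\in(0,\delta_0)$ for some $\delta_0>0$).
   Context: Let $x_t\in\mathbb R^N$ solve the (It\^o) SDE $dx_t=U_0(x_t)\,dt+\sqrt2\sum_{k=1}^d V_k(x_t)\,dB^k_t$, $x_0=x$, where $U_0,V_1,\dots,V_d$ are smooth vector fields on $\mathbb R^N$ and $B^1,\dots,B^d$ are independent one-dimensional standard Brownian motions. The implicit Euler approximation with step $\delta>0$ is defined, with $t_n=n\delta$, by $Y^\delta_0=x$ and $$Y^\delta_{t_{n+1}}=Y^\delta_{t_n}+\delta\,U_0(Y^\delta_{t_{n+1}})+\sqrt2\sum_{k=1}^dV_k(Y^\delta_{t_n})\,(B^k_{t_{n+1}}-B^k_{t_n}).$$ For $\delta\in(0,\frac1{2c_0})$ the implicit equation for $Y^\delta_{t_{n+1}}$ has a unique solution. $\mathbb E_x$ is expectation conditional on the process at hand starting at $x$. $\mathcal C^2_b(\mathbb R^N)$ is the space of real-valued twice continuously differentiable functions with bounded first and second derivatives (not necessarily bounded themselves), with seminorm $\|f\|_{\mathcal C^2_b}:=\sup_x(|\nabla f(x)|+\|\nabla^2f(x)\|)$; $\|\cdot\|$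 is the Frobenius norm on matrices; $\nabla U_0,\nabla V_k$ are Jacobian matrices and $\partial_i\partial_jU_0$, $\partial_m\partial_{m'}V_k$ are componentwise second derivatives (vectors in $\mathbb R^N$). *)

theory Defs
  imports "HOL-Probability.Probability"
begin

section \<open>Differential calculus on \<open>real ^ 'n\<close>\<close>

definition partial :: "'n \<Rightarrow> (real ^ 'n \<Rightarrow> 'b) \<Rightarrow> real ^ 'n \<Rightarrow> 'b::real_normed_vector"
  where "partial i f x = frechet_derivative f (at x) (axis i 1)"

primrec Ck :: "nat \<Rightarrow> (real ^ 'n \<Rightarrow> 'b::real_normed_vector) \<Rightarrow> bool"
  where
    "Ck 0 f \<longleftrightarrow> continuous_on UNIV f"
  | "Ck (Suc k) f \<longleftrightarrow> (\<forall>x. f differentiable (at x)) \<and> (\<forall>i. Ck k (partial i f))"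

definition smooth :: "(real ^ 'n \<Rightarrow> 'b::real_normed_vector) \<Rightarrow> bool"
  where "smooth f \<longleftrightarrow> (\<forall>k. Ck k f)"

definition grad :: "(real ^ 'n \<Rightarrow> real) \<Rightarrow> real ^ 'n \<Rightarrow> real ^ 'n"
  where "grad f x = (\<chi> i. partial i f x)"

definition hess :: "(real ^ 'n \<Rightarrow> real) \<Rightarrow> real ^ 'n \<Rightarrow> real ^ 'n ^ 'n"
  where "hess f x = (\<chi> i j. partial i (partial j f) x)"

text \<open>The space of twice continuously differentiable functions with bounded first and second
  derivatives; the functions themselves may be unbounded. On matrices, \<^const>\<open>norm\<close> is the
  Frobenius norm.\<close>

definition C2b :: "(real ^ 'n \<Rightarrow> real) set"
  where "C2b = {f. Ck 2 f \<and> bounded (range (grad f)) \<and> bounded (range (hess f))}"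

definition C2b_seminorm :: "(real ^ 'n \<Rightarrow> real) \<Rightarrow> real"
  where "C2b_seminorm f = (SUP x. norm (grad f x) + norm (hess f x))"


section \<open>Brownian motion and the It\^o integral\<close>

text \<open>Time is \<open>[0, \<infinity>)\<close>. Filtrations and processes are indexed by \<^typ>\<open>real\<close>, but processes are
  constrained at nonnegative times only.\<close>

definition filtered_prob_space :: "'w measure \<Rightarrow> (real \<Rightarrow> 'w measure) \<Rightarrow> bool"
  where "filtered_prob_space M F \<longleftrightarrow>
    prob_space M \<and> filtration (space M) F \<and> (\<forall>t. subalgebra M (F t))"

definition adapted :: "(real \<Rightarrow> 'w measure) \<Rightarrow> (real \<Rightarrow> 'w \<Rightarrow> 'b::topological_space) \<Rightarrow> bool"
  where "adapted F X \<longleftrightarrow> (\<forall>t\<ge>0. X t \<in> borel_measurable (F t))"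

text \<open>A family of independent one-dimensional standard Brownian motions relative to the
  filtration \<open>F\<close>. Independence of the whole processes follows from independence of the components
  of each vector increment together with independence of that increment from the past.\<close>

definition brownian_family ::
    "'w measure \<Rightarrow> (real \<Rightarrow> 'w measure) \<Rightarrow> ('d::finite \<Rightarrow> real \<Rightarrow> 'w \<Rightarrow> real) \<Rightarrow> bool"
  where "brownian_family M F B \<longleftrightarrow>
    (\<forall>k. adapted F (B k)) \<and>
    (\<forall>k. \<forall>\<omega>\<in>space M. B k 0 \<omega> = 0 \<and> continuous_on {0..} (\<lambda>t. B k t \<omega>)) \<and>
    (\<forall>s t. 0 \<le> s \<longrightarrow> s < t \<longrightarrow>
      (\<forall>k. distributed M lborel (\<lambda>\<omega>. B k t \<omega> - B k s \<omega>) (normal_density 0 (sqrt (t - s)))) \<and>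
      prob_space.indep_vars M (\<lambda>_. borel) (\<lambda>k \<omega>. B k t \<omega> - B k s \<omega>) UNIV \<and>
      prob_space.indep_set M (sets (F s))
        {(\<lambda>\<omega>. (\<chi> k. B k t \<omega> - B k s \<omega>)) -` A \<inter> space M | A. A \<in> sets (borel :: (real ^ 'd) measure)})"

text \<open>A simple process on \<open>[0, t]\<close> is given by a grid \<open>\<tau> 0 \<le> \<dots> \<le> \<tau> m\<close> and bounded values
  \<open>\<xi> i\<close> on \<open>(\<tau> i, \<tau> (Suc i)]\<close> that are known at time \<open>\<tau> i\<close>.\<close>

definition simple_process :: "'w measure \<Rightarrow> (real \<Rightarrow> 'w measure) \<Rightarrow> real \<Rightarrow>
    nat \<Rightarrow> (nat \<Rightarrow> real) \<Rightarrow> (nat \<Rightarrow> 'w \<Rightarrow> 'b::euclidean_space) \<Rightarrow> bool"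
  where "simple_process M F t m \<tau> \<xi> \<longleftrightarrow>
    0 \<le> \<tau> 0 \<and> \<tau> m \<le> t \<and>
    (\<forall>i<m. \<tau> i \<le> \<tau> (Suc i) \<and> \<xi> i \<in> borel_measurable (F (\<tau> i)) \<and> bounded (\<xi> i ` space M))"

definition simple_value :: "nat \<Rightarrow> (nat \<Rightarrow> real) \<Rightarrow> (nat \<Rightarrow> 'w \<Rightarrow> 'b::euclidean_space) \<Rightarrow>
    real \<Rightarrow> 'w \<Rightarrow> 'b"
  where "simple_value m \<tau> \<xi> s \<omega> = (\<Sum>i<m. indicator {\<tau> i<..\<tau> (Suc i)} s *\<^sub>R \<xi> i \<omega>)"

definition simple_integral :: "(real \<Rightarrow> 'w \<Rightarrow> real) \<Rightarrow>
    nat \<Rightarrow> (nat \<Rightarrow> real) \<Rightarrow> (nat \<Rightarrow> 'w \<Rightarrow> 'b::euclidean_space) \<Rightarrow> 'w \<Rightarrow> 'b"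
  where "simple_integral W m \<tau> \<xi> \<omega> = (\<Sum>i<m. (W (\<tau> (Suc i)) \<omega> - W (\<tau> i) \<omega>) *\<^sub>R \<xi> i \<omega>)"

text \<open>\<open>I\<close> is (a version of) the It\^o integral of \<open>H\<close> against \<open>W\<close> over \<open>[0, t]\<close>, for measurable,
  adapted \<open>H\<close> that is square integrable on \<open>[0, t] \<times> \<Omega>\<close>: the mean-square limit of the
  integrals of simple processes that approximate \<open>H\<close> in mean square. Square integrability holds
  for all the integrands below, because the diffusion coefficients are bounded.\<close>

definition has_ito_integral :: "'w measure \<Rightarrow> (real \<Rightarrow> 'w measure) \<Rightarrow> (real \<Rightarrow> 'w \<Rightarrow> real) \<Rightarrow> real \<Rightarrow>
    (real \<Rightarrow> 'w \<Rightarrow> 'b::euclidean_space) \<Rightarrow> ('w \<Rightarrow> 'b) \<Rightarrow> bool"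
  where "has_ito_integral M F W t H I \<longleftrightarrow>
    (\<lambda>(s, \<omega>). H s \<omega>) \<in> borel_measurable (restrict_space borel {0..t} \<Otimes>\<^sub>M M) \<and>
    (\<forall>s\<in>{0..t}. H s \<in> borel_measurable (F s)) \<and>
    (\<integral>\<^sup>+ \<omega>. (\<integral>\<^sup>+ s\<in>{0..t}. ennreal ((norm (H s \<omega>))\<^sup>2) \<partial>lborel) \<partial>M) < \<infinity> \<and>
    I \<in> borel_measurable M \<and>
    (\<exists>m \<tau> \<xi>. (\<forall>j. simple_process M F t (m j) (\<tau> j) (\<xi> j)) \<and>
      (\<lambda>j. \<integral>\<^sup>+ \<omega>. (\<integral>\<^sup>+ s\<in>{0..t}.
         ennreal ((norm (H s \<omega> - simple_value (m j) (\<tau> j) (\<xi> j) s \<omega>))\<^sup>2) \<partial>lborel) \<partial>M) \<longlonglongrightarrow> 0 \<and>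
      (\<lambda>j. \<integral>\<^sup>+ \<omega>. ennreal ((norm (I \<omega> - simple_integral W (m j) (\<tau> j) (\<xi> j) \<omega>))\<^sup>2) \<partial>M) \<longlonglongrightarrow> 0)"


section \<open>The SDE and its implicit Euler approximation\<close>

definition sde_solution :: "'w measure \<Rightarrow> (real \<Rightarrow> 'w measure) \<Rightarrow> ('d::finite \<Rightarrow> real \<Rightarrow> 'w \<Rightarrow> real) \<Rightarrow>
    (real ^ 'n \<Rightarrow> real ^ 'n) \<Rightarrow> ('d \<Rightarrow> real ^ 'n \<Rightarrow> real ^ 'n) \<Rightarrow> real ^ 'n \<Rightarrow>
    (real \<Rightarrow> 'w \<Rightarrow> real ^ 'n) \<Rightarrow> bool"
  where "sde_solution M F B U0 V x X \<longleftrightarrow>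
    adapted F X \<and>
    (\<forall>\<omega>\<in>space M. continuous_on {0..} (\<lambda>t. X t \<omega>)) \<and>
    (AE \<omega> in M. X 0 \<omega> = x) \<and>
    (\<forall>t\<ge>0. \<exists>I.
      (\<forall>k. has_ito_integral M F (B k) t (\<lambda>s \<omega>. V k (X s \<omega>)) (I k)) \<and>
      (AE \<omega> in M. X t \<omega> =
         x + integral {0..t} (\<lambda>s. U0 (X s \<omega>)) + sqrt 2 *\<^sub>R (\<Sum>k\<in>UNIV. I k \<omega>)))"

text \<open>\<open>Y n\<close> is the approximation at time \<open>n * \<delta>\<close>. Under a one-sided Lipschitz bound with constant
  \<open>c0\<close> on \<open>U0\<close>, these relations determine \<open>Y\<close> on \<open>space M\<close> whenever \<open>0 < \<delta> < 1 / (2 * c0)\<close>.\<close>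

definition implicit_euler :: "'w measure \<Rightarrow> ('d::finite \<Rightarrow> real \<Rightarrow> 'w \<Rightarrow> real) \<Rightarrow>
    (real ^ 'n \<Rightarrow> real ^ 'n) \<Rightarrow> ('d \<Rightarrow> real ^ 'n \<Rightarrow> real ^ 'n) \<Rightarrow> real ^ 'n \<Rightarrow> real \<Rightarrow>
    (nat \<Rightarrow> 'w \<Rightarrow> real ^ 'n) \<Rightarrow> bool"
  where "implicit_euler M B U0 V x \<delta> Y \<longleftrightarrow>
    (\<forall>\<omega>\<in>space M. Y 0 \<omega> = x \<and>
      (\<forall>n. Y (Suc n) \<omega> = Y n \<omega> + \<delta> *\<^sub>R U0 (Y (Suc n) \<omega>) +
        sqrt 2 *\<^sub>R (\<Sum>k\<in>UNIV. (B k (real (Suc n) * \<delta>) \<omega> - B k (real n * \<delta>) \<omega>) *\<^sub>R V k (Y n \<omega>))))"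


section \<open>Assumptions on the coefficients\<close>

definition condition_A :: "(real ^ 'n \<Rightarrow> real ^ 'n) \<Rightarrow> ('d::finite \<Rightarrow> real ^ 'n \<Rightarrow> real ^ 'n) \<Rightarrow>
    real \<Rightarrow> real \<Rightarrow> real \<Rightarrow> real \<Rightarrow> real \<Rightarrow> real \<Rightarrow> real \<Rightarrow> bool"
  where "condition_A U0 V c0 c1 c2 q K b0 b1 \<longleftrightarrow>
    c0 > 0 \<and> c1 > 0 \<and> c2 > 0 \<and> q > 0 \<and> K > 0 \<and> b0 > 0 \<and> b1 \<ge> 0 \<and>
    (\<forall>x y. (\<Sum>k\<in>UNIV. norm (V k x - V k y)) \<le> c1 * norm (x - y)) \<and>
    (\<forall>x. (\<Sum>k\<in>UNIV. (norm (V k x))\<^sup>2) \<le> K) \<and>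
    (\<forall>x. U0 x \<bullet> x \<le> - b0 * (norm x)\<^sup>2 + b1) \<and>
    (\<forall>x y. (U0 x - U0 y) \<bullet> (x - y) \<le> c0 * (norm (x - y))\<^sup>2) \<and>
    (\<forall>x y. (norm (U0 x - U0 y))\<^sup>2 \<le>
      c2 * (1 + norm x powr (2 * q) + norm y powr (2 * q)) * (norm (x - y))\<^sup>2)"

definition condition_B :: "(real ^ 'n \<Rightarrow> real ^ 'n) \<Rightarrow> ('d::finite \<Rightarrow> real ^ 'n \<Rightarrow> real ^ 'n) \<Rightarrow>
    real \<Rightarrow> (real ^ 'n \<Rightarrow> real) \<Rightarrow> real \<Rightarrow> real \<Rightarrow> real \<Rightarrow> bool"
  where "condition_B U0 V \<beta> lam \<alpha> \<rho> Khat \<longleftrightarrow>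
    \<beta> \<ge> 1 \<and> (\<forall>x. lam x > 0) \<and> (INF x. lam x) > 0 \<and> \<alpha> > 0 \<and> 0 < \<rho> \<and> \<rho> < 1 / 5 \<and> Khat > 0 \<and>
    (\<forall>x v. - \<beta> * lam x * (norm v)\<^sup>2 \<le> v \<bullet> (jacobian U0 (at x) *v v) \<and>
           v \<bullet> (jacobian U0 (at x) *v v) \<le> - lam x * (norm v)\<^sup>2) \<and>
    (\<forall>x. (\<Sum>i\<in>UNIV. \<Sum>j\<in>UNIV. norm (partial j (partial i U0) x)) \<le> \<alpha> * lam x) \<and>
    (\<forall>x. (\<Sum>k\<in>UNIV. (norm (jacobian (V k) (at x)))\<^sup>2) \<le> \<rho> / (real CARD('n) * \<beta>\<^sup>2) * lam x) \<and>
    (\<forall>x. (SUP k. norm (V k x)) \<le> Khat) \<and>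
    (\<forall>x. (\<Sum>k\<in>UNIV.
            sqrt (\<Sum>m\<in>UNIV. \<Sum>m'\<in>UNIV. (norm (partial m (partial m' (V k)) x))\<^sup>2)
            + \<alpha> * norm (jacobian (V k) (at x)))
         \<le> \<rho> / (Khat * \<beta>\<^sup>2) * lam x)"

end

theory Submission
  imports Defs
begin

text \<open>
  Condition (B) is strong enough for a uniform-in-time strong error of order \<open>1/2\<close>, so no derivative
  estimates for the semigroup are needed. By the mean value theorem the bounds on the Jacobians give
  \<open>\<langle>U0 a - U0 b, a - b\<rangle> + 3 \<Sum>|V k a - V k b|\<^sup>2 \<le> - \<mu> |a - b|\<^sup>2\<close> for some \<open>\<mu> > 0\<close>. For the error \<open>e n\<close> at time
  \<open>n \<delta>\<close> and \<open>v n = \<Sum>|V k (X (n \<delta>)) - V k (Y n)|\<^sup>2\<close>, one implicit Euler step then yields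
  \<open>(1 + 2 \<mu> \<delta>) E|e (n+1)|\<^sup>2 + 6 \<delta> E v (n+1) \<le> (1 + \<mu> \<delta>) (E|e n|\<^sup>2 + 4 \<delta> E v n) + O(\<delta>\<^sup>2)\<close>, which contracts for small
  \<open>\<delta>\<close> and keeps \<open>E|e n|\<^sup>2\<close> of order \<open>\<delta>\<close> for all \<open>n\<close>.

  It\^o's formula is avoided throughout. By the isometry, the noise
  \<open>X t - X s - \<integral>\<^sub>s\<^sup>t U0 (X r) dr\<close> is a mean-square limit of Riemann sums, whose exponential moments
  and second moments are computed increment by increment and passed to the limit by Fatou's lemma.
  Uniform moments of \<open>X\<close> follow path by path: on a unit interval \<open>X\<close> minus its noise solves a
  dissipative ordinary differential equation.
\<close>

section \<open>Dissipative estimates\<close>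

text \<open>The scheme takes the drift at the right end of a step and the diffusion at the left end.
  Moving both implicit drifts to the left side of the error equation makes its square produce
  \<open>2 * \<delta>\<close> times the dissipative quantity, while the noise stays a centred
  increment given the past. What remains of the drift is the integral of
  \<open>U0 (X r) - U0 (X t)\<close> over one step. Its mean square is of order \<delta>^3, and
  Young's inequality with weight \<open>\<mu> * \<delta>\<close>, paid from the contraction, turns
  it into \<delta>^2. An error of order \<delta>^2 per step against a contraction of order \<delta>
  leaves a mean square error of order \<delta> for all \<open>n\<close>. The obstacle is the
  polynomial growth of \<open>U0\<close>: its local Lipschitz factor is random, so moments of
  \<open>X\<close> are needed uniformly in time and with explicit growth in \<open>x\<close>. The
  powers 2q of that factor and 2q+2 of |U0|^2 add up to 4q+2; the square root gives 2q+1, which is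
  at most (2q+1)(q+1).\<close>

lemma norm_matrix_vector_mult_le:
  fixes A :: "real ^ 'n ^ 'm"
  shows "norm (A *v v) \<le> norm A * norm v"
proof -
  have "norm (A *v v) = L2_set (\<lambda>i. norm ((A *v v) $ i)) UNIV"
    by (simp add: norm_vec_def)
  also have "\<dots> \<le> L2_set (\<lambda>i. norm (A $ i) * norm v) UNIV"
    by (intro L2_set_mono) (auto simp: matrix_vector_mul_component Cauchy_Schwarz_ineq2)
  also have "\<dots> = norm A * norm v"
    by (simp add: norm_vec_def[of A] L2_set_right_distrib L2_set_left_distrib)
  finally show ?thesis .
qed

text \<open>The factor 2 in front of \<open>c\<close> in \<open>\<phi>\<close> lets the mean value
  theorem absorb its own right side. At the intermediate point Young's inequality bounds twice the
  product of J v and \<open>w k\<close> by |J|^2 |v|^2 + |w k|^2, so half of the diffusion term in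
  \<open>\<phi> a - \<phi> b\<close> cancels and the other half is the one in the
  conclusion.\<close>

lemma jacobian_bound_mvt:
  fixes U :: "real ^ 'n \<Rightarrow> real ^ 'n" and V :: "'d::finite \<Rightarrow> real ^ 'n \<Rightarrow> real ^ 'n"
  assumes dU: "\<And>x. U differentiable (at x)" and dV: "\<And>k x. V k differentiable (at x)"
    and c: "c \<ge> 0"
    and U: "\<And>x v. v \<bullet> (jacobian U (at x) *v v) \<le> - lam x * (norm v)\<^sup>2"
    and V: "\<And>x. c * (\<Sum>k\<in>UNIV. (norm (jacobian (V k) (at x)))\<^sup>2) \<le> lam x - m"
  shows "(U a - U b) \<bullet> (a - b) + c * (\<Sum>k\<in>UNIV. (norm (V k a - V k b))\<^sup>2)
           \<le> - m * (norm (a - b))\<^sup>2"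
proof -
  define v w where "v = a - b" and "w k = V k a - V k b" for k
  \<comment> \<open>With \<open>w\<close> frozen, a single intermediate point serves the drift and all diffusion coefficients.\<close>
  define \<phi> where "\<phi> z = U z \<bullet> v + 2 * c * (\<Sum>k\<in>UNIV. V k z \<bullet> w k)" for z
  define \<phi>' where "\<phi>' z h = (jacobian U (at z) *v h) \<bullet> v
    + 2 * c * (\<Sum>k\<in>UNIV. (jacobian (V k) (at z) *v h) \<bullet> w k)" for z h
  have der: "(\<phi> has_derivative \<phi>' z) (at z)" for z
    unfolding \<phi>_def \<phi>'_def
    by (auto intro!: derivative_eq_intros jacobian_works[THEN iffD1] dU dV)
  have seg: "((\<lambda>t. \<phi> (b + t *\<^sub>R v)) has_derivative (\<lambda>h. \<phi>' (b + t *\<^sub>R v) (h *\<^sub>R v))) (at t within {0..1})" for t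
    by (rule has_derivative_compose[OF _ der, where f="\<lambda>t. b + t *\<^sub>R v"])
      (auto intro!: derivative_eq_intros)
  obtain t where "\<phi> a - \<phi> b = \<phi>' (b + t *\<^sub>R v) v"
    using mvt_very_simple[OF zero_le_one seg] by (auto simp: v_def)
  then obtain z where z: "\<phi> a - \<phi> b = \<phi>' z v"
    by blast
  have cs: "2 * ((jacobian (V k) (at z) *v v) \<bullet> w k)
      \<le> (norm (jacobian (V k) (at z)))\<^sup>2 * (norm v)\<^sup>2 + (norm (w k))\<^sup>2" for k
  proof -
    let ?J = "jacobian (V k) (at z)"
    have "2 * ((?J *v v) \<bullet> w k) \<le> 2 * (norm (?J *v v) * norm (w k))"
      using norm_cauchy_schwarz by (metis mult_le_cancel_left_pos zero_less_numeral)
    also have "\<dots> \<le> (norm (?J *v v))\<^sup>2 + (norm (w k))\<^sup>2"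
      using sum_squares_bound[of "norm (?J *v v)" "norm (w k)"] by (simp add: algebra_simps)
    also have "(norm (?J *v v))\<^sup>2 \<le> (norm ?J * norm v)\<^sup>2"
      by (intro power_mono norm_matrix_vector_mult_le) auto
    finally show ?thesis by (simp add: power_mult_distrib)
  qed
  have "2 * c * (\<Sum>k\<in>UNIV. (jacobian (V k) (at z) *v v) \<bullet> w k)
      = c * (\<Sum>k\<in>UNIV. 2 * ((jacobian (V k) (at z) *v v) \<bullet> w k))"
    by (simp add: sum_distrib_left mult_ac)
  also have "\<dots> \<le> c * (\<Sum>k\<in>UNIV. (norm (jacobian (V k) (at z)))\<^sup>2 * (norm v)\<^sup>2 + (norm (w k))\<^sup>2)"
    by (intro mult_left_mono sum_mono c cs)
  finally have "\<phi>' z v \<le> - lam z * (norm v)\<^sup>2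
      + c * (\<Sum>k\<in>UNIV. (norm (jacobian (V k) (at z)))\<^sup>2 * (norm v)\<^sup>2 + (norm (w k))\<^sup>2)"
    using U[of v z] unfolding \<phi>'_def by (simp add: inner_commute)
  also have "\<dots> = (c * (\<Sum>k\<in>UNIV. (norm (jacobian (V k) (at z)))\<^sup>2) - lam z) * (norm v)\<^sup>2
      + c * (\<Sum>k\<in>UNIV. (norm (w k))\<^sup>2)"
    by (simp add: sum.distrib sum_distrib_left sum_distrib_right algebra_simps)
  also have "\<dots> \<le> - m * (norm v)\<^sup>2 + c * (\<Sum>k\<in>UNIV. (norm (w k))\<^sup>2)"
    using V[of z] by (intro add_right_mono mult_right_mono) auto
  finally have 1: "\<phi>' z v \<le> - m * (norm v)\<^sup>2 + c * (\<Sum>k\<in>UNIV. (norm (w k))\<^sup>2)" .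
  have "\<phi> a - \<phi> b = (U a - U b) \<bullet> v + 2 * c * (\<Sum>k\<in>UNIV. (norm (w k))\<^sup>2)"
  proof -
    have "(norm (w k))\<^sup>2 = V k a \<bullet> w k - V k b \<bullet> w k" for k
      by (simp add: power2_norm_eq_inner inner_diff_left[symmetric] w_def[symmetric])
    then show ?thesis
      by (simp add: \<phi>_def inner_diff_left sum_subtractf right_diff_distrib)
  qed
  then show ?thesis
    using z 1 by (simp add: v_def w_def)
qed

text \<open>Path integrals enter later as limits of these left-point sums: measurability and moment
  bounds are checked on finite sums and passed to the limit, so continuity of each path takes the
  place of joint measurability in time and \<omega>.\<close>

lemma riemann_sums:
  fixes h :: "real \<Rightarrow> 'a::euclidean_space"
  assumes ab: "a \<le> b" and cont: "continuous_on {a..b} h"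
  shows "(\<lambda>n. \<Sum>i<n. ((b - a) / real n) *\<^sub>R h (a + (b - a) * (real i / real n))) \<longlonglongrightarrow> integral {a..b} h"
proof (rule LIMSEQ_I)
  fix e :: real assume "e > 0"
  \<comment> \<open>The \<open>+ 1\<close> keeps the quotient defined for \<open>a = b\<close> and
    makes the final bound \<open>e' * (b - a) < e\<close> strict.\<close>
  define e' where "e' = e / (b - a + 1)"
  have e': "e' > 0" using \<open>e > 0\<close> ab by (simp add: e'_def)
  have "uniformly_continuous_on {a..b} h"
    by (rule compact_uniformly_continuous[OF cont]) auto
  then obtain d where d: "d > 0" "\<And>x y. x \<in> {a..b} \<Longrightarrow> y \<in> {a..b} \<Longrightarrow> dist y x < d \<Longrightarrow> dist (h y) (h x) < e'"
    unfolding uniformly_continuous_on_def using e' by metis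
  obtain n0 :: nat where n0: "(b - a) / d < n0"
    using reals_Archimedean2 by blast
  have "norm ((\<Sum>i<n. ((b - a) / real n) *\<^sub>R h (a + (b - a) * (real i / real n))) - integral {a..b} h) < e"
    if n: "n \<ge> Suc n0" for n
  proof -
    define r where "r i = a + (b - a) * (real i / n)" for i
    have npos: "real n > 0" using n by simp
    have rle: "r i \<le> r (Suc i)" and rge: "a \<le> r i" for i
      using ab npos by (auto simp: r_def mult_left_mono divide_right_mono)
    have rb: "r i \<le> b" if "i \<le> n" for i
      using that ab npos mult_left_le[of "real i / n" "b - a"] by (simp add: r_def)
    have rd: "r (Suc i) - r i = (b - a) / n" for i
      using npos by (simp add: r_def field_simps)
    have step: "(b - a) / n < d"
    proof -
      have "b - a < d * n0" using n0 d(1) by (simp add: field_simps)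
      also have "\<dots> \<le> d * n" using n d(1) by simp
      finally show ?thesis using npos by (simp add: field_simps)
    qed
    \<comment> \<open>The error is claimed proportional to the elapsed length
      \<open>r j - a\<close>, so each cell adds its own share and the induction over cells
      closes.\<close>
    have "norm ((\<Sum>i<j. ((b - a) / n) *\<^sub>R h (r i)) - integral {a..r j} h) \<le> e' * (r j - a)" if "j \<le> n" for j
      using that
    proof (induction j)
      case 0
      then show ?case by (simp add: r_def)
    next
      case (Suc j)
      have sub: "{r j..r (Suc j)} \<subseteq> {a..b}" "{a..r (Suc j)} \<subseteq> {a..b}"
        using rge[of j] rb[OF Suc.prems] by auto
      have "integral {a..r (Suc j)} h = integral {a..r j} h + integral {r j..r (Suc j)} h"
        by (rule Henstock_Kurzweil_Integration.integral_combine[symmetric])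
          (use rge rle continuous_on_subset[OF cont sub(2)] in \<open>auto intro: integrable_continuous_real\<close>)
      moreover have "((b - a) / n) *\<^sub>R h (r j) = integral {r j..r (Suc j)} (\<lambda>_. h (r j))"
        using rle[of j] rd[of j] by simp
      moreover have "norm (integral {r j..r (Suc j)} (\<lambda>_. h (r j)) - integral {r j..r (Suc j)} h) \<le> e' * (r (Suc j) - r j)"
      proof -
        have io: "h integrable_on {r j..r (Suc j)}"
          using continuous_on_subset[OF cont sub(1)] by (intro integrable_continuous_real)
        have "integral {r j..r (Suc j)} (\<lambda>_. h (r j)) - integral {r j..r (Suc j)} h
            = integral {r j..r (Suc j)} (\<lambda>s. h (r j) - h s)"
          by (rule Henstock_Kurzweil_Integration.integral_diff[symmetric]) (use io in auto)
        also have "norm \<dots> \<le> e' * (r (Suc j) - r j)"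
        proof (rule integral_bound)
          show "norm (h (r j) - h s) \<le> e'" if "s \<in> {r j..r (Suc j)}" for s
          proof -
            have "dist (r j) s < d" using that rd[of j] step by (auto simp: dist_real_def)
            then have "dist (h (r j)) (h s) < e'"
              using that sub rle[of j] by (intro d(2)) auto
            then show ?thesis by (simp add: dist_norm)
          qed
        qed (use rle continuous_on_subset[OF cont sub(1)] in \<open>auto intro!: continuous_intros\<close>)
        finally show ?thesis .
      qed
      ultimately show ?case
        using Suc.IH Suc.prems norm_triangle_ineq[of "(\<Sum>i<j. ((b - a) / n) *\<^sub>R h (r i)) - integral {a..r j} h"
          "integral {r j..r (Suc j)} (\<lambda>_. h (r j)) - integral {r j..r (Suc j)} h"]
        by (simp add: algebra_simps del: integral_const integral_const_real)
    qed
    from this[of n] have "norm ((\<Sum>i<n. ((b - a) / n) *\<^sub>R h (r i)) - integral {a..b} h) \<le> e' * (b - a)"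
      using npos by (simp add: r_def)
    also have "\<dots> < e"
      using \<open>e > 0\<close> ab by (simp add: e'_def field_simps)
    finally show ?thesis by (simp add: r_def)
  qed
  then show "\<exists>no. \<forall>n\<ge>no. norm ((\<Sum>i<n. ((b - a) / real n) *\<^sub>R h (a + (b - a) * (real i / real n))) - integral {a..b} h) < e"
    by blast
qed

lemma norm_diff_squared_le:
  fixes x y :: "'b::real_normed_vector"
  shows "(norm (x - y))\<^sup>2 \<le> 2 * (norm x)\<^sup>2 + 2 * (norm y)\<^sup>2"
proof -
  have "(norm (x - y))\<^sup>2 \<le> (norm x + norm y)\<^sup>2"
    by (intro power_mono norm_triangle_ineq4) simp
  also have "\<dots> \<le> 2 * (norm x)\<^sup>2 + 2 * (norm y)\<^sup>2"
    using sum_squares_bound[of "norm x" "norm y"] by (simp add: power2_sum)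
  finally show ?thesis .
qed

text \<open>Gronwall's inequality in a crude form, with the forcing integrated without its decay
  factor. After multiplication by the integrating factor the derivative still has a sign: what is
  left over is \<open>- c\<close> times the integral of \<open>g\<close>, and \<open>g\<close> is
  nonnegative.\<close>

lemma linear_decay_bound:
  fixes y g :: "real \<Rightarrow> real"
  assumes st: "s \<le> t" and c: "c \<ge> 0"
    and y: "\<And>r. r \<in> {s..t} \<Longrightarrow> (y has_real_derivative y' r) (at r within {s..t})"
    and y': "\<And>r. r \<in> {s..t} \<Longrightarrow> y' r \<le> - c * y r + g r"
    and g: "continuous_on {s..t} g" "\<And>r. r \<in> {s..t} \<Longrightarrow> g r \<ge> 0"
  shows "y t \<le> exp (- c * (t - s)) * y s + integral {s..t} g"
proof -
  define \<Psi> where "\<Psi> r = exp (c * (r - s)) * (y r - integral {s..r} g)" for r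
  define \<Psi>' where "\<Psi>' r = exp (c * (r - s)) * (c * (y r - integral {s..r} g) + (y' r - g r))" for r
  have "(\<Psi> has_real_derivative \<Psi>' r) (at r within {s..t})" if "r \<in> {s..t}" for r
  proof -
    have "((\<lambda>r. integral {s..r} g) has_real_derivative g r) (at r within {s..t})"
      using integral_has_vector_derivative[OF g(1) that]
      by (simp add: has_real_derivative_iff_has_vector_derivative)
    then show ?thesis
      unfolding \<Psi>_def \<Psi>'_def
      by (auto intro!: derivative_eq_intros y that simp: algebra_simps)
  qed
  moreover have "\<Psi>' r \<le> 0" if "r \<in> {s..t}" for r
  proof -
    have "g integrable_on {s..r}"
      using that by (intro integrable_continuous_real continuous_on_subset[OF g(1)]) auto
    then have "0 \<le> integral {s..r} g"
      using that g(2) by (intro Henstock_Kurzweil_Integration.integral_nonneg) auto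
    then have "0 \<le> c * integral {s..r} g" using c by simp
    then show ?thesis
      using y'[OF that] unfolding \<Psi>'_def
      by (intro mult_nonneg_nonpos) (auto simp: algebra_simps)
  qed
  ultimately have "\<Psi> t \<le> \<Psi> s"
  proof -
    assume der: "\<And>r. r \<in> {s..t} \<Longrightarrow> (\<Psi> has_real_derivative \<Psi>' r) (at r within {s..t})"
      and le: "\<And>r. r \<in> {s..t} \<Longrightarrow> \<Psi>' r \<le> 0"
    obtain r where r: "r \<in> {s..t}" "\<Psi> t - \<Psi> s = \<Psi>' r * (t - s)"
      using mvt_very_simple[OF st, of \<Psi> "\<lambda>r h. \<Psi>' r * h"] der
      unfolding has_field_derivative_def by (metis atLeastAtMost_iff)
    have "\<Psi>' r * (t - s) \<le> 0" using le[OF r(1)] st by (simp add: mult_nonpos_nonneg)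
    then show ?thesis using r(2) by simp
  qed
  then have "exp (c * (t - s)) * (y t - integral {s..t} g) \<le> y s"
    by (simp add: \<Psi>_def)
  then have "exp (- c * (t - s)) * (exp (c * (t - s)) * (y t - integral {s..t} g)) \<le> exp (- c * (t - s)) * y s"
    by (intro mult_left_mono) auto
  then show ?thesis
    by (simp add: mult.assoc[symmetric] exp_add[symmetric] del: mult_minus_left)
qed

text \<open>Young's inequality by comparison instead of conjugate exponents: either \<open>G\<close>
  is at most \<open>\<mu> / 2 * y\<close> and the product is absorbed by \<open>y ^ p\<close>, or
  \<open>y\<close> is at most \<open>2 / \<mu> * G\<close> and the product is dominated by
  \<open>G ^ p\<close>.\<close>

lemma young_power:
  fixes y G \<mu> :: real
  assumes "y \<ge> 0" "G \<ge> 0" "\<mu> > 0" "p \<ge> 1"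
  shows "y ^ (p - 1) * G \<le> \<mu> / 2 * y ^ p + (2 / \<mu>) ^ (p - 1) * G ^ p"
proof (cases "G \<le> \<mu> / 2 * y")
  case True
  have p: "y ^ p = y ^ (p - 1) * y" "G ^ p = G ^ (p - 1) * G"
    using assms(4) by (metis One_nat_def Suc_le_eq power_minus_mult)+
  have "y ^ (p - 1) * G \<le> y ^ (p - 1) * (\<mu> / 2 * y)"
    using True assms by (intro mult_left_mono) auto
  then show ?thesis
    using assms zero_le_power[OF assms(2), of p] by (simp add: p add_increasing2 mult_ac)
next
  case False
  have p: "y ^ p = y ^ (p - 1) * y" "G ^ p = G ^ (p - 1) * G"
    using assms(4) by (metis One_nat_def Suc_le_eq power_minus_mult)+
  have "y \<le> 2 / \<mu> * G" using False assms by (simp add: field_simps)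
  then have "y ^ (p - 1) * G \<le> (2 / \<mu> * G) ^ (p - 1) * G"
    using assms by (intro mult_right_mono power_mono) auto
  also have "\<dots> = (2 / \<mu>) ^ (p - 1) * G ^ p"
    by (simp only: p power_mult_distrib mult.assoc)
  finally show ?thesis using assms by (simp add: add_increasing)
qed

text \<open>The noise \<open>N\<close> is merely continuous, but \<open>X - N\<close> is
  differentiable with derivative \<open>U (X r)\<close>. Comparing \<open>U\<close> at
  \<open>X r\<close> and at \<open>N r\<close>, whose difference is exactly
  \<open>X r - N r\<close>, lets dissipativity act on that difference and leaves
  \<open>U (N r)\<close> as the forcing.\<close>

lemma dissipative_path_bound:
  fixes X :: "real \<Rightarrow> 'a::euclidean_space" and U :: "'a \<Rightarrow> 'a"
  assumes st: "s \<le> t" and X: "continuous_on {s..t} X" and U: "continuous_on UNIV U"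
    and \<mu>: "\<mu> > 0" and p: "p \<ge> 1"
    and diss: "\<And>a b. (U a - U b) \<bullet> (a - b) \<le> - \<mu> * (norm (a - b))\<^sup>2"
  defines "N \<equiv> \<lambda>r. X r - X s - integral {s..r} (\<lambda>u. U (X u))"
  shows "norm (X t - N t) ^ (2 * p) \<le> exp (- (\<mu> / 2) * (t - s)) * norm (X s) ^ (2 * p)
     + p * (2 / \<mu>) ^ (p - 1) / \<mu> ^ p * integral {s..t} (\<lambda>u. norm (U (N u)) ^ (2 * p))"
proof -
  define D where "D r = X s + integral {s..r} (\<lambda>u. U (X u))" for r
  have DN: "X r = D r + N r" for r by (simp add: D_def N_def)
  have UX: "continuous_on {s..t} (\<lambda>u. U (X u))"
    by (rule continuous_on_compose2[OF U X]) auto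
  have contint: "continuous_on {s..t} (\<lambda>r. integral {s..r} (\<lambda>u. U (X u)))"
    by (rule indefinite_integral_continuous_1[OF integrable_continuous_real[OF UX]])
  have contN: "continuous_on {s..t} N"
    unfolding N_def by (intro continuous_intros X contint)
  have D': "(D has_vector_derivative U (X r)) (at r within {s..t})" if "r \<in> {s..t}" for r
    unfolding D_def using integral_has_vector_derivative[OF UX that]
    by (auto intro!: derivative_eq_intros)
  define y y' where "y r = D r \<bullet> D r" and "y' r = 2 * (D r \<bullet> U (X r))" for r
  have yder: "(y has_real_derivative y' r) (at r within {s..t})" if "r \<in> {s..t}" for r
    unfolding y_def y'_def has_field_derivative_def
    using D'[OF that] unfolding has_vector_derivative_def
    by (auto intro!: derivative_eq_intros simp: inner_commute algebra_simps)
  have y0: "y r \<ge> 0" for r by (simp add: y_def)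
  define G where "G r = (norm (U (N r)))\<^sup>2 / \<mu>" for r
  have G0: "G r \<ge> 0" for r using \<mu> by (simp add: G_def)
  have y'le: "y' r \<le> - \<mu> * y r + G r" for r
  proof -
    have "y' r = 2 * ((U (D r + N r) - U (N r)) \<bullet> (D r + N r - N r)) + 2 * (D r \<bullet> U (N r))"
      by (simp add: y'_def DN[of r] inner_commute algebra_simps)
    also have "\<dots> \<le> 2 * (- \<mu> * (norm (D r))\<^sup>2) + 2 * (norm (D r) * norm (U (N r)))"
      using diss[of "D r + N r" "N r"] norm_cauchy_schwarz[of "D r" "U (N r)"] by simp
    also have "2 * (norm (D r) * norm (U (N r))) \<le> \<mu> * (norm (D r))\<^sup>2 + G r"
      using sum_squares_bound[of "sqrt \<mu> * norm (D r)" "norm (U (N r)) / sqrt \<mu>"] \<mu>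
      by (simp add: G_def power_mult_distrib power_divide)
    finally show ?thesis by (simp add: y_def power2_norm_eq_inner)
  qed
  \<comment> \<open>Factor of the forcing after \<open>young_power\<close>, where \<open>G\<close>
    is the squared norm of \<open>U (N r)\<close> over \<open>\<mu>\<close>; the leading
    \<open>p\<close> is the chain rule factor of \<open>y ^ p\<close>.\<close>
  define C where "C = p * (2 / \<mu>) ^ (p - 1) / \<mu> ^ p"
  have C0: "C \<ge> 0" using \<mu> by (simp add: C_def)
  have zder: "((\<lambda>r. y r ^ p) has_real_derivative p * (y r ^ (p - 1) * y' r)) (at r within {s..t})" if "r \<in> {s..t}" for r
    using p by (auto intro!: derivative_eq_intros yder that)
  have zle: "p * (y r ^ (p - 1) * y' r) \<le> - (\<mu> / 2) * y r ^ p + C * norm (U (N r)) ^ (2 * p)" for r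
  proof -
    have "y r ^ (p - 1) * y' r \<le> y r ^ (p - 1) * (- \<mu> * y r + G r)"
      by (intro mult_left_mono y'le) (simp add: y0)
    also have "\<dots> = - \<mu> * y r ^ p + y r ^ (p - 1) * G r"
      using p by (simp add: algebra_simps power_eq_if)
    also have "\<dots> \<le> - \<mu> * y r ^ p + (\<mu> / 2 * y r ^ p + (2 / \<mu>) ^ (p - 1) * G r ^ p)"
      by (intro add_left_mono young_power y0 G0 \<mu> p)
    finally have *: "y r ^ (p - 1) * y' r \<le> - (\<mu> / 2) * y r ^ p + (2 / \<mu>) ^ (p - 1) * G r ^ p"
      by (simp add: algebra_simps)
    have "p * (y r ^ (p - 1) * y' r) \<le> p * (- (\<mu> / 2) * y r ^ p + (2 / \<mu>) ^ (p - 1) * G r ^ p)"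
      by (intro mult_left_mono *) simp
    also have "\<dots> = p * (- (\<mu> / 2) * y r ^ p) + C * norm (U (N r)) ^ (2 * p)"
      by (simp add: algebra_simps C_def G_def power_divide flip: power_mult)
    \<comment> \<open>The decay rate \<open>p * \<mu> / 2\<close> is lowered to
      \<open>\<mu> / 2\<close>, so that the contraction is the same for every moment order.\<close>
    also have "p * (- (\<mu> / 2) * y r ^ p) \<le> 1 * (- (\<mu> / 2) * y r ^ p)"
      using p \<mu> y0[of r] by (intro mult_right_mono_neg) auto
    finally show ?thesis by simp
  qed
  have contg: "continuous_on {s..t} (\<lambda>u. norm (U (N u)) ^ (2 * p))"
    by (intro continuous_intros continuous_on_compose2[OF U contN]) auto
  have "y t ^ p \<le> exp (- (\<mu> / 2) * (t - s)) * y s ^ p + integral {s..t} (\<lambda>u. C * norm (U (N u)) ^ (2 * p))"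
    by (rule linear_decay_bound[where y'="\<lambda>r. p * (y r ^ (p - 1) * y' r)"])
      (use st \<mu> zder zle C0 contg in \<open>auto intro!: continuous_intros\<close>)
  moreover have "y r ^ p = norm (D r) ^ (2 * p)" for r
    unfolding y_def power2_norm_eq_inner[symmetric] by (rule power_mult[symmetric])
  moreover have "D t = X t - N t" "D s = X s"
    by (simp_all add: N_def D_def)
  ultimately show ?thesis by (simp add: C_def)
qed

text \<open>The constant in front of \<open>a ^ p\<close> can be taken arbitrarily close to 1, which
  keeps a contraction a contraction after noise is added. The number \<open>\<eta>\<close> with
  \<open>(1 + \<eta>) ^ p = 1 + \<epsilon>\<close> is the threshold: \<open>b\<close> below
  \<open>\<eta> * a\<close> is absorbed by \<open>a\<close>, and otherwise \<open>a\<close> is below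
  \<open>b / \<eta>\<close>.\<close>

lemma power_sum_epsilon_bound:
  fixes \<epsilon> :: real
  assumes "\<epsilon> > 0" "p \<ge> 1"
  obtains C where "C \<ge> 0" "\<And>a b. a \<ge> 0 \<Longrightarrow> b \<ge> 0 \<Longrightarrow> (a + b) ^ p \<le> (1 + \<epsilon>) * a ^ p + C * b ^ p"
proof
  define \<eta> where "\<eta> = root p (1 + \<epsilon>) - 1"
  have \<eta>: "\<eta> > 0" "(1 + \<eta>) ^ p = 1 + \<epsilon>"
    using assms by (simp_all add: \<eta>_def)
  show "(1 + 1 / \<eta>) ^ p \<ge> 0" using \<eta> by simp
  fix a b :: real assume ab: "a \<ge> 0" "b \<ge> 0"
  show "(a + b) ^ p \<le> (1 + \<epsilon>) * a ^ p + (1 + 1 / \<eta>) ^ p * b ^ p"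
  proof (cases "b \<le> \<eta> * a")
    case True
    then have "(a + b) ^ p \<le> ((1 + \<eta>) * a) ^ p"
      using ab by (intro power_mono) (auto simp: algebra_simps)
    also have "\<dots> = (1 + \<epsilon>) * a ^ p" by (simp add: power_mult_distrib \<eta>)
    finally show ?thesis using ab \<eta> by (simp add: add_increasing2)
  next
    case False
    then have "a \<le> b / \<eta>" using \<eta> by (simp add: field_simps)
    then have "(a + b) ^ p \<le> ((1 + 1 / \<eta>) * b) ^ p"
      using ab by (intro power_mono) (auto simp: algebra_simps)
    then show ?thesis using ab assms by (simp add: power_mult_distrib add_increasing)
  qed
qed

section \<open>Bounds on means\<close>

text \<open>Integrability is part of the notion because the Bochner integral of a nonintegrable
  function is 0, so that a bound on the integral alone would say nothing.\<close>

definition mean_le :: "'w measure \<Rightarrow> ('w \<Rightarrow> real) \<Rightarrow> real \<Rightarrow> bool"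
  where "mean_le M g C \<longleftrightarrow> integrable M g \<and> integral\<^sup>L M g \<le> C"

text \<open>Valued in \<open>ennreal\<close>, hence meaningful before square integrability is
  known.\<close>

abbreviation L2sq :: "'w measure \<Rightarrow> ('w \<Rightarrow> 'b::real_normed_vector) \<Rightarrow> ennreal"
  where "L2sq M f \<equiv> \<integral>\<^sup>+ \<omega>. ennreal ((norm (f \<omega>))\<^sup>2) \<partial>M"

lemma mean_le_nn_integralI:
  assumes "g \<in> borel_measurable M" "AE \<omega> in M. 0 \<le> g \<omega>" "0 \<le> C"
    and "(\<integral>\<^sup>+ \<omega>. ennreal (g \<omega>) \<partial>M) \<le> ennreal C"
  shows "mean_le M g C"
proof -
  have "integrable M g"
    by (rule integrableI_nonneg) (use assms le_less_trans[OF assms(4)] in auto)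
  moreover have "integral\<^sup>L M g \<le> C"
    by (subst integral_eq_nn_integral) (use assms in \<open>auto intro!: enn2real_leI\<close>)
  ultimately show ?thesis by (simp add: mean_le_def)
qed

lemma mean_le_nn_integralD:
  assumes "mean_le M g C" "AE \<omega> in M. 0 \<le> g \<omega>"
  shows "(\<integral>\<^sup>+ \<omega>. ennreal (g \<omega>) \<partial>M) \<le> ennreal C"
  using assms by (auto simp: mean_le_def nn_integral_eq_integral intro!: ennreal_leI)

lemma mean_le_nonneg:
  assumes "mean_le M g C" "\<And>\<omega>. \<omega> \<in> space M \<Longrightarrow> 0 \<le> g \<omega>"
  shows "0 \<le> C"
  using assms(1) Bochner_Integration.integral_nonneg[of M g, OF assms(2)] unfolding mean_le_def by linarith

lemma mean_le_mono:
  assumes "mean_le M h C" "g \<in> borel_measurable M"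
    and "AE \<omega> in M. 0 \<le> g \<omega>" "AE \<omega> in M. g \<omega> \<le> h \<omega>" "C \<le> C'"
  shows "mean_le M g C'"
proof -
  have h: "integrable M h" "integral\<^sup>L M h \<le> C" using assms by (auto simp: mean_le_def)
  have "integrable M g"
    by (rule Bochner_Integration.integrable_bound[OF h(1)]) (use assms in auto)
  moreover have "integral\<^sup>L M g \<le> integral\<^sup>L M h"
    by (rule integral_mono_AE) (use calculation h assms in auto)
  ultimately show ?thesis using h assms by (simp add: mean_le_def)
qed

lemma mean_le_add: "mean_le M g C \<Longrightarrow> mean_le M h D \<Longrightarrow> mean_le M (\<lambda>\<omega>. g \<omega> + h \<omega>) (C + D)"
  by (simp add: mean_le_def)

lemma mean_le_cmult: "mean_le M g C \<Longrightarrow> 0 \<le> c \<Longrightarrow> mean_le M (\<lambda>\<omega>. c * g \<omega>) (c * C)"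
  by (simp add: mean_le_def mult_left_mono)

lemma mean_le_sum:
  "(\<And>i. i \<in> I \<Longrightarrow> mean_le M (g i) (C i)) \<Longrightarrow> mean_le M (\<lambda>\<omega>. \<Sum>i\<in>I. g i \<omega>) (\<Sum>i\<in>I. C i)"
  by (simp add: mean_le_def Bochner_Integration.integral_sum sum_mono)

lemma (in prob_space) mean_le_const: "c \<le> C \<Longrightarrow> mean_le M (\<lambda>_. c) C"
  by (simp add: mean_le_def prob_space)

lemma mean_le_weaken: "mean_le M g C \<Longrightarrow> C \<le> D \<Longrightarrow> mean_le M g D"
  by (simp add: mean_le_def)

text \<open>Fatou's lemma delivers integrability of the limit along with the bound, so all later
  limits are taken without a dominating function.\<close>

lemma mean_le_Fatou:
  assumes [measurable]: "\<And>n. g n \<in> borel_measurable M" "f \<in> borel_measurable M"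
    and pos: "\<And>n \<omega>. \<omega> \<in> space M \<Longrightarrow> 0 \<le> g n \<omega>"
    and lim: "AE \<omega> in M. (\<lambda>n. g n \<omega>) \<longlonglongrightarrow> f \<omega>"
    and bound: "\<And>n. mean_le M (g n) (C n)" and C: "C \<longlonglongrightarrow> C0"
  shows "mean_le M f C0"
proof (rule mean_le_nn_integralI)
  have C0: "0 \<le> C n" for n
    using mean_le_nonneg[OF bound[of n] pos] .
  then show "0 \<le> C0" using C by (intro LIMSEQ_le_const) auto
  have "AE \<omega> in M. ennreal (f \<omega>) = liminf (\<lambda>n. ennreal (g n \<omega>))"
    using lim by eventually_elim (simp add: lim_imp_Liminf[OF sequentially_bot tendsto_ennrealI])
  then have "(\<integral>\<^sup>+ \<omega>. ennreal (f \<omega>) \<partial>M) = (\<integral>\<^sup>+ \<omega>. liminf (\<lambda>n. ennreal (g n \<omega>)) \<partial>M)"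
    by (rule nn_integral_cong_AE)
  also have "\<dots> \<le> liminf (\<lambda>n. \<integral>\<^sup>+ \<omega>. ennreal (g n \<omega>) \<partial>M)"
    by (rule nn_integral_liminf) auto
  also have "\<dots> \<le> liminf (\<lambda>n. ennreal (C n))"
    using mean_le_nn_integralD[OF bound] pos by (intro Liminf_mono always_eventually) auto
  also have "\<dots> = ennreal C0"
    using C by (intro lim_imp_Liminf tendsto_ennrealI) auto
  finally show "(\<integral>\<^sup>+ \<omega>. ennreal (f \<omega>) \<partial>M) \<le> ennreal C0" .
  show "AE \<omega> in M. 0 \<le> f \<omega>"
    using lim AE_space by eventually_elim (use pos in \<open>auto intro: LIMSEQ_le_const\<close>)
qed simp_all

lemma nn_integral_tendsto_0_AE_subseq:
  fixes D :: "nat \<Rightarrow> 'w \<Rightarrow> 'b::euclidean_space"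
  assumes [measurable]: "\<And>n. D n \<in> borel_measurable M" "W \<in> borel_measurable M"
    and lim: "(\<lambda>n. L2sq M (\<lambda>\<omega>. D n \<omega> - W \<omega>)) \<longlonglongrightarrow> 0"
  obtains r :: "nat \<Rightarrow> nat" where "strict_mono r" "AE \<omega> in M. (\<lambda>n. D (r n) \<omega>) \<longlonglongrightarrow> W \<omega>"
proof -
  define u where "u n \<omega> = (norm (D n \<omega> - W \<omega>))\<^sup>2" for n \<omega>
  have [measurable]: "u n \<in> borel_measurable M" for n unfolding u_def by measurable
  \<comment> \<open>Finitely many of the mean squares may be infinite. From \<open>n0\<close> on
    they are below 1, hence integrable, as the subsequence theorem for mean convergence demands of
    every term.\<close>
  have "\<forall>\<^sub>F n in sequentially. (\<integral>\<^sup>+ \<omega>. ennreal (u n \<omega>) \<partial>M) < 1"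
    using lim unfolding u_def by (rule order_tendstoD) simp
  then obtain n0 where n0: "\<And>n. n \<ge> n0 \<Longrightarrow> (\<integral>\<^sup>+ \<omega>. ennreal (u n \<omega>) \<partial>M) < 1"
    by (auto simp: eventually_sequentially)
  have int: "integrable M (u (n + n0))" for n
    by (rule integrableI_nonneg)
      (use n0[of "n + n0"] less_trans[of _ 1 "top::ennreal"] in \<open>auto simp: u_def\<close>)
  have eq: "(\<integral>\<^sup>+ \<omega>. ennreal (u (n + n0) \<omega>) \<partial>M) = ennreal (\<integral>\<omega>. norm (u (n + n0) \<omega>) \<partial>M)" for n
    by (subst nn_integral_eq_integral[OF int]) (auto simp: u_def[abs_def])
  have "(\<lambda>n. ennreal (\<integral>\<omega>. norm (u (n + n0) \<omega>) \<partial>M)) \<longlonglongrightarrow> ennreal 0"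
    using LIMSEQ_ignore_initial_segment[OF lim, of n0] unfolding eq[symmetric] by (simp add: u_def)
  then have L1: "(\<lambda>n. \<integral>\<omega>. norm (u (n + n0) \<omega>) \<partial>M) \<longlonglongrightarrow> 0"
    by (subst (asm) tendsto_ennreal_iff) auto
  obtain r where r: "strict_mono r" "AE \<omega> in M. (\<lambda>n. u (r n + n0) \<omega>) \<longlonglongrightarrow> 0"
    using tendsto_L1_AE_subseq[OF int L1] by blast
  show thesis
  proof
    show "strict_mono (\<lambda>n. r n + n0)" using r(1) by (simp add: strict_mono_def)
    show "AE \<omega> in M. (\<lambda>n. D (r n + n0) \<omega>) \<longlonglongrightarrow> W \<omega>"
      using r(2)
    proof eventually_elim
      case (elim \<omega>)
      then have "(\<lambda>n. sqrt (u (r n + n0) \<omega>)) \<longlonglongrightarrow> sqrt 0" by (rule tendsto_real_sqrt)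
      then have "(\<lambda>n. norm (D (r n + n0) \<omega> - W \<omega>)) \<longlonglongrightarrow> 0" by (simp add: u_def)
      then show ?case by (simp add: tendsto_norm_zero_iff LIM_zero_iff)
    qed
  qed
qed

text \<open>A mean-square limit is an almost sure limit along a subsequence, and then Fatou's lemma
  applies to any nonnegative \<open>\<Phi>\<close> continuous in its second argument.
  \<open>\<Phi>\<close> may depend on \<omega>, so that other random vectors can stand beside the
  converging one.\<close>

lemma mean_le_L2_limit:
  fixes D :: "nat \<Rightarrow> 'w \<Rightarrow> 'b::euclidean_space"
  assumes [measurable]: "\<And>n. D n \<in> borel_measurable M" "W \<in> borel_measurable M"
    and lim: "(\<lambda>n. L2sq M (\<lambda>\<omega>. D n \<omega> - W \<omega>)) \<longlonglongrightarrow> 0"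
    and meas: "\<And>n. (\<lambda>\<omega>. \<Phi> \<omega> (D n \<omega>)) \<in> borel_measurable M" "(\<lambda>\<omega>. \<Phi> \<omega> (W \<omega>)) \<in> borel_measurable M"
    and pos: "\<And>\<omega> x. \<omega> \<in> space M \<Longrightarrow> 0 \<le> \<Phi> \<omega> x"
    and cont: "\<And>\<omega>. \<omega> \<in> space M \<Longrightarrow> continuous_on UNIV (\<Phi> \<omega>)"
    and bound: "\<And>n. n \<ge> 1 \<Longrightarrow> mean_le M (\<lambda>\<omega>. \<Phi> \<omega> (D n \<omega>)) (C n)" and C: "C \<longlonglongrightarrow> C0"
  shows "mean_le M (\<lambda>\<omega>. \<Phi> \<omega> (W \<omega>)) C0"
proof -
  obtain r where r: "strict_mono r" "AE \<omega> in M. (\<lambda>n. D (r n) \<omega>) \<longlonglongrightarrow> W \<omega>"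
    using nn_integral_tendsto_0_AE_subseq[OF assms(1,2) lim] by blast
  \<comment> \<open>The bound is assumed from index 1 on, since in the applications index 0 is a
    grid without cells; \<open>r (Suc n)\<close> is at least 1 because \<open>r\<close> is strictly
    increasing.\<close>
  define r' where "r' n = r (Suc n)" for n
  have sm: "strict_mono r'" using r(1) by (auto simp: r'_def strict_mono_def)
  have r1: "r' n \<ge> 1" for n
    using seq_suble[OF r(1), of "Suc n"] by (simp add: r'_def)
  show ?thesis
  proof (rule mean_le_Fatou[where g="\<lambda>n \<omega>. \<Phi> \<omega> (D (r' n) \<omega>)" and C="\<lambda>n. C (r' n)"])
    show "AE \<omega> in M. (\<lambda>n. \<Phi> \<omega> (D (r' n) \<omega>)) \<longlonglongrightarrow> \<Phi> \<omega> (W \<omega>)"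
      using r(2) AE_space
    proof eventually_elim
      case (elim \<omega>)
      have "(\<lambda>n. D (r' n) \<omega>) \<longlonglongrightarrow> W \<omega>"
        unfolding r'_def using elim(1) by (rule LIMSEQ_Suc)
      then show ?case
        using continuous_on_tendsto_compose[OF cont[OF elim(2)], of "\<lambda>n. D (r' n) \<omega>" "W \<omega>" sequentially]
        by auto
    qed
    show "(\<lambda>n. C (r' n)) \<longlonglongrightarrow> C0"
      using LIMSEQ_subseq_LIMSEQ[OF C sm] by (simp add: o_def)
  qed (use meas pos bound r1 in auto)
qed

lemma grid_point_mem:
  assumes "a \<le> (b::real)" "i \<le> n" "0 < n"
  shows "a + (b - a) * (real i / real n) \<in> {a..b}"
  using assms mult_left_le[of "real i / n" "b - a"] by simp

text \<open>\<open>N\<close> is arbitrary so that it can be \<open>F t\<close>, which yields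
  adaptedness of path integrals.\<close>

lemma measurable_integral_paths:
  fixes h :: "real \<Rightarrow> 'w \<Rightarrow> 'a::euclidean_space"
  assumes "a \<le> b" and cont: "\<And>\<omega>. \<omega> \<in> space N \<Longrightarrow> continuous_on {a..b} (\<lambda>r. h r \<omega>)"
    and meas: "\<And>r. r \<in> {a..b} \<Longrightarrow> h r \<in> borel_measurable N"
  shows "(\<lambda>\<omega>. integral {a..b} (\<lambda>r. h r \<omega>)) \<in> borel_measurable N"
proof (rule borel_measurable_LIMSEQ_metric)
  show "(\<lambda>n. \<Sum>i<n. ((b - a) / real n) *\<^sub>R h (a + (b - a) * (real i / real n)) \<omega>)
      \<longlonglongrightarrow> integral {a..b} (\<lambda>r. h r \<omega>)" if "\<omega> \<in> space N" for \<omega>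
    by (rule riemann_sums[OF assms(1) cont[OF that]])
  show "(\<lambda>\<omega>. \<Sum>i<n. ((b - a) / real n) *\<^sub>R h (a + (b - a) * (real i / real n)) \<omega>) \<in> borel_measurable N" for n
    using assms(1) by (intro borel_measurable_sum borel_measurable_scaleR borel_measurable_const meas grid_point_mem) auto
qed

lemma norm_sum_squared_le:
  fixes f :: "'i \<Rightarrow> 'a::real_normed_vector"
  shows "(norm (\<Sum>i\<in>I. f i))\<^sup>2 \<le> card I * (\<Sum>i\<in>I. (norm (f i))\<^sup>2)"
proof -
  have "(norm (\<Sum>i\<in>I. f i))\<^sup>2 \<le> (\<Sum>i\<in>I. norm (f i))\<^sup>2"
    by (intro power_mono norm_sum) simp
  also have "\<dots> \<le> card I * (\<Sum>i\<in>I. (norm (f i))\<^sup>2)"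
    using sum_squared_le_sum_of_squares[of "\<lambda>i. norm (f i)" I] by (simp add: mult.commute)
  finally show ?thesis .
qed

text \<open>Fubini's theorem for continuous paths, obtained from Riemann sums and Fatou's
  lemma.\<close>

lemma (in prob_space) mean_le_integral_paths:
  fixes h :: "real \<Rightarrow> 'a \<Rightarrow> real"
  assumes ab: "a \<le> b" and cont: "\<And>\<omega>. \<omega> \<in> space M \<Longrightarrow> continuous_on {a..b} (\<lambda>r. h r \<omega>)"
    and meas: "\<And>r. r \<in> {a..b} \<Longrightarrow> h r \<in> borel_measurable M"
    and pos: "\<And>r \<omega>. r \<in> {a..b} \<Longrightarrow> \<omega> \<in> space M \<Longrightarrow> 0 \<le> h r \<omega>"
    and bound: "\<And>r. r \<in> {a..b} \<Longrightarrow> mean_le M (h r) C"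
  shows "mean_le M (\<lambda>\<omega>. integral {a..b} (\<lambda>r. h r \<omega>)) ((b - a) * C)"
proof -
  let ?p = "\<lambda>n i. a + (b - a) * (real i / real n)"
  have p: "?p n i \<in> {a..b}" if "i < n" for i n
    by (rule grid_point_mem) (use that ab in auto)
  have C0: "0 \<le> C" using mean_le_nonneg[OF bound[of a]] pos ab by auto
  show ?thesis
  proof (rule mean_le_Fatou[where g="\<lambda>n \<omega>. \<Sum>i<n. ((b - a) / real n) *\<^sub>R h (?p n i) \<omega>" and C="\<lambda>_. (b - a) * C"])
    show "mean_le M (\<lambda>\<omega>. \<Sum>i<n. ((b - a) / real n) *\<^sub>R h (?p n i) \<omega>) ((b - a) * C)" for n
    proof -
      have "mean_le M (\<lambda>\<omega>. \<Sum>i<n. (b - a) / real n * h (?p n i) \<omega>) (\<Sum>i<n. (b - a) / real n * C)"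
        using ab by (intro mean_le_sum mean_le_cmult bound p) auto
      then show ?thesis
        by (rule mean_le_mono) (use ab C0 p pos meas in \<open>auto intro!: borel_measurable_sum borel_measurable_times AE_I2 sum_nonneg mult_nonneg_nonneg\<close>)
    qed
    show "AE \<omega> in M. (\<lambda>n. \<Sum>i<n. ((b - a) / real n) *\<^sub>R h (?p n i) \<omega>) \<longlonglongrightarrow> integral {a..b} (\<lambda>r. h r \<omega>)"
      by (intro AE_I2 riemann_sums ab cont)
    show "0 \<le> (\<Sum>i<n. ((b - a) / real n) *\<^sub>R h (?p n i) \<omega>)" if "\<omega> \<in> space M" for n \<omega>
      using ab p pos that by (intro sum_nonneg) auto
  qed (use ab p meas cont in \<open>auto intro!: borel_measurable_sum borel_measurable_times measurable_integral_paths\<close>)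
qed

text \<open>The squared length comes from Cauchy-Schwarz over the \<open>n\<close> cells:
  \<open>n\<close> times the sum of \<open>n\<close> squared weights
  \<open>(b - a) / n\<close>.\<close>

lemma (in prob_space) mean_le_norm2_integral_paths:
  fixes h :: "real \<Rightarrow> 'a \<Rightarrow> 'b::euclidean_space"
  assumes ab: "a \<le> b" and cont: "\<And>\<omega>. \<omega> \<in> space M \<Longrightarrow> continuous_on {a..b} (\<lambda>r. h r \<omega>)"
    and meas: "\<And>r. r \<in> {a..b} \<Longrightarrow> h r \<in> borel_measurable M"
    and bound: "\<And>r. r \<in> {a..b} \<Longrightarrow> mean_le M (\<lambda>\<omega>. (norm (h r \<omega>))\<^sup>2) C"
  shows "mean_le M (\<lambda>\<omega>. (norm (integral {a..b} (\<lambda>r. h r \<omega>)))\<^sup>2) ((b - a)\<^sup>2 * C)"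
proof -
  let ?p = "\<lambda>n i. a + (b - a) * (real i / real n)"
  have p: "?p n i \<in> {a..b}" if "i < n" for i n
    by (rule grid_point_mem) (use that ab in auto)
  have C0: "0 \<le> C" using mean_le_nonneg[OF bound[of a]] ab by auto
  have m: "(\<lambda>\<omega>. \<Sum>i<n. ((b - a) / real n) *\<^sub>R h (?p n i) \<omega>) \<in> borel_measurable M" for n
    using p meas by (intro borel_measurable_sum borel_measurable_scaleR) auto
  show ?thesis
  proof (rule mean_le_Fatou[where g="\<lambda>n \<omega>. (norm (\<Sum>i<n. ((b - a) / real n) *\<^sub>R h (?p n i) \<omega>))\<^sup>2" and C="\<lambda>_. (b - a)\<^sup>2 * C"])
    show "mean_le M (\<lambda>\<omega>. (norm (\<Sum>i<n. ((b - a) / real n) *\<^sub>R h (?p n i) \<omega>))\<^sup>2) ((b - a)\<^sup>2 * C)" for n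
    proof (cases "n = 0")
      case True
      then show ?thesis using C0 by (simp add: mean_le_const)
    next
      case False
      have "mean_le M (\<lambda>\<omega>. real n * (\<Sum>i<n. ((b - a) / real n)\<^sup>2 * (norm (h (?p n i) \<omega>))\<^sup>2))
          (real n * (\<Sum>i<n. ((b - a) / real n)\<^sup>2 * C))"
        by (intro mean_le_sum mean_le_cmult bound p) auto
      then show ?thesis
      proof (rule mean_le_mono)
        show "AE \<omega> in M. (norm (\<Sum>i<n. ((b - a) / real n) *\<^sub>R h (?p n i) \<omega>))\<^sup>2
            \<le> real n * (\<Sum>i<n. ((b - a) / real n)\<^sup>2 * (norm (h (?p n i) \<omega>))\<^sup>2)" (is "AE \<omega> in M. ?P \<omega>")
        proof (rule AE_I2)
          fix \<omega>
          show "?P \<omega>"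
            using norm_sum_squared_le[of "\<lambda>i. ((b - a) / real n) *\<^sub>R h (?p n i) \<omega>" "{..<n}"]
            by (simp add: power_mult_distrib power_divide)
        qed
        show "real n * (\<Sum>i<n. ((b - a) / real n)\<^sup>2 * C) \<le> (b - a)\<^sup>2 * C"
          using False by (simp add: power2_eq_square field_simps)
      qed (use m in auto)
    qed
    show "AE \<omega> in M. (\<lambda>n. (norm (\<Sum>i<n. ((b - a) / real n) *\<^sub>R h (?p n i) \<omega>))\<^sup>2)
        \<longlonglongrightarrow> (norm (integral {a..b} (\<lambda>r. h r \<omega>)))\<^sup>2"
      by (intro AE_I2 tendsto_intros riemann_sums ab cont)
    show "(\<lambda>\<omega>. (norm (integral {a..b} (\<lambda>r. h r \<omega>)))\<^sup>2) \<in> borel_measurable M"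
      by (rule borel_measurable_power, rule measurable_compose[OF _ borel_measurable_norm])
        (intro measurable_integral_paths ab cont meas)
  qed (use m in auto)
qed

section \<open>Brownian increments\<close>

text \<open>Length of the intersection of two half-open intervals, that is, the covariance of the
  increments of one Brownian motion over them.\<close>

definition overlap :: "real \<Rightarrow> real \<Rightarrow> real \<Rightarrow> real \<Rightarrow> real"
  where "overlap a b c d = max 0 (min b d - max a c)"

lemma overlap_sym: "overlap a b c d = overlap c d a b"
  by (simp add: overlap_def min.commute max.commute)

lemma integral_indicator_overlap:
  assumes "a \<le> b" "c \<le> d"
  shows "integrable lborel (\<lambda>s. indicator {a<..b} s * indicator {c<..d} s :: real)"
    and "(\<integral>s. indicator {a<..b} s * indicator {c<..d} s \<partial>lborel) = overlap a b c d"
proof -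
  have eq: "indicator {a<..b} s * indicator {c<..d} s = (indicator {max a c<..min b d} s :: real)" for s
    by (auto simp: indicator_def)
  show "integrable lborel (\<lambda>s. indicator {a<..b} s * indicator {c<..d} s :: real)"
    unfolding eq by (cases "max a c \<le> min b d") (auto simp: integrable_indicator_iff)
  show "(\<integral>s. indicator {a<..b} s * indicator {c<..d} s \<partial>lborel) = overlap a b c d"
    unfolding eq by (cases "max a c \<le> min b d") (auto simp: overlap_def)
qed

text \<open>Completing the square: the exponential tilt turns the centred density into the one with
  mean \<open>c * \<sigma>\<^sup>2\<close>.\<close>

lemma normal_exp_moment:
  assumes "\<sigma> > 0"
  shows "(\<integral>\<^sup>+ x. ennreal (normal_density 0 \<sigma> x) * ennreal (exp (c * x)) \<partial>lborel) = ennreal (exp (c\<^sup>2 * \<sigma>\<^sup>2 / 2))"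
proof -
  have "normal_density 0 \<sigma> x * exp (c * x) = exp (c\<^sup>2 * \<sigma>\<^sup>2 / 2) * normal_density (c * \<sigma>\<^sup>2) \<sigma> x" for x
  proof -
    have "- x\<^sup>2 / (2 * \<sigma>\<^sup>2) + c * x = c\<^sup>2 * \<sigma>\<^sup>2 / 2 + - (x - c * \<sigma>\<^sup>2)\<^sup>2 / (2 * \<sigma>\<^sup>2)"
      using assms by (simp add: field_simps power2_eq_square)
    then have "exp (- x\<^sup>2 / (2 * \<sigma>\<^sup>2)) * exp (c * x) = exp (c\<^sup>2 * \<sigma>\<^sup>2 / 2) * exp (- (x - c * \<sigma>\<^sup>2)\<^sup>2 / (2 * \<sigma>\<^sup>2))"
      by (metis exp_add)
    then show ?thesis by (simp add: normal_density_def)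
  qed
  then have "(\<integral>\<^sup>+ x. ennreal (normal_density 0 \<sigma> x) * ennreal (exp (c * x)) \<partial>lborel)
      = (\<integral>\<^sup>+ x. ennreal (exp (c\<^sup>2 * \<sigma>\<^sup>2 / 2)) * ennreal (normal_density (c * \<sigma>\<^sup>2) \<sigma> x) \<partial>lborel)"
    by (simp add: ennreal_mult'[symmetric])
  also have "\<dots> = ennreal (exp (c\<^sup>2 * \<sigma>\<^sup>2 / 2)) * (\<integral>\<^sup>+ x. ennreal (normal_density (c * \<sigma>\<^sup>2) \<sigma> x) \<partial>lborel)"
    by (rule nn_integral_cmult) simp
  also have "(\<integral>\<^sup>+ x. ennreal (normal_density (c * \<sigma>\<^sup>2) \<sigma> x) \<partial>lborel) = 1"
    by (subst nn_integral_eq_integral) (use assms in auto)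
  finally show ?thesis by simp
qed

section \<open>Brownian increments given the past\<close>

locale brownian =
  fixes M :: "'w measure" and F :: "real \<Rightarrow> 'w measure" and B :: "'d::finite \<Rightarrow> real \<Rightarrow> 'w \<Rightarrow> real"
  assumes filt: "filtered_prob_space M F" and BM: "brownian_family M F B"
begin

sublocale prob_space M
  using filt by (simp add: filtered_prob_space_def)

lemma space_F [simp]: "space (F t) = space M"
  using filt by (simp add: filtered_prob_space_def subalgebra_def)

lemma sets_F: "sets (F t) \<subseteq> sets M"
  using filt by (simp add: filtered_prob_space_def subalgebra_def)

lemma measurable_F_M: "f \<in> measurable (F t) N \<Longrightarrow> f \<in> measurable M N"
  using filt measurable_from_subalg[of M "F t" f N] by (simp add: filtered_prob_space_def)

lemma measurable_F_mono: "f \<in> measurable (F s) N \<Longrightarrow> s \<le> t \<Longrightarrow> f \<in> measurable (F t) N"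
  using filt measurable_from_subalg[of "F t" "F s" f N]
  by (simp add: filtered_prob_space_def filtration_def subalgebra_def)

lemma measurable_B: "0 \<le> s \<Longrightarrow> s \<le> t \<Longrightarrow> B k s \<in> borel_measurable (F t)"
  using BM by (auto simp: brownian_family_def adapted_def intro: measurable_F_mono[of "B k s" s borel t])

lemma measurable_B_M: "0 \<le> s \<Longrightarrow> B k s \<in> borel_measurable M"
  using measurable_B[of s s k] measurable_F_M by blast

text \<open>Kept as one random vector, since \<open>brownian_family\<close> states independence from
  the past jointly for all components.\<close>

definition dB :: "real \<Rightarrow> real \<Rightarrow> 'w \<Rightarrow> real ^ 'd"
  where "dB s t \<omega> = (\<chi> k. B k t \<omega> - B k s \<omega>)"

lemma dB_nth [simp]: "dB s t \<omega> $ k = B k t \<omega> - B k s \<omega>"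
  by (simp add: dB_def)

lemma measurable_dB: "0 \<le> s \<Longrightarrow> s \<le> t \<Longrightarrow> dB s t \<in> borel_measurable (F t)"
  by (subst borel_measurable_euclidean_space)
    (auto simp: Basis_vec_def inner_axis intro!: borel_measurable_diff measurable_B)


lemma measurable_dB_M: "0 \<le> s \<Longrightarrow> s \<le> t \<Longrightarrow> dB s t \<in> borel_measurable M"
  by (rule measurable_F_M[OF measurable_dB])

lemma measurable_case_prod_fst_F:
  "f \<in> measurable (F r) N \<Longrightarrow> (\<lambda>p. f (fst p)) \<in> measurable (F r \<Otimes>\<^sub>M L) N"
  by (rule measurable_compose[OF measurable_fst])

text \<open>The substitute for conditional expectation given \<open>F r\<close>: what is known at time \<open>r\<close> is frozen,
  and the later increment is integrated out first.\<close>

lemma nn_integral_freeze: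
  fixes g :: "'w \<times> (real ^ 'd) \<Rightarrow> ennreal"
  assumes ru: "0 \<le> r" "r < u" and g: "g \<in> borel_measurable (F r \<Otimes>\<^sub>M borel)"
  shows "(\<integral>\<^sup>+ \<omega>. g (\<omega>, dB r u \<omega>) \<partial>M) = (\<integral>\<^sup>+ \<omega>. (\<integral>\<^sup>+ \<omega>'. g (\<omega>, dB r u \<omega>') \<partial>M) \<partial>M)"
proof -
  \<comment> \<open>The identity, read as a map from \<open>M\<close> into \<open>F r\<close>, is
    the random variable that carries everything known at time \<open>r\<close>.\<close>
  have id: "(\<lambda>\<omega>. \<omega>) \<in> measurable M (F r)"
    using sets_F by (auto simp: measurable_def)
  have D: "dB r u \<in> borel_measurable M"
    using ru by (intro measurable_dB_M) auto
  have "indep_set (sets (F r)) {dB r u -` A \<inter> space M | A. A \<in> sets borel}"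
    using BM ru unfolding brownian_family_def dB_def by blast
  then have ind: "prob (A \<inter> (dB r u -` A' \<inter> space M)) = prob A * prob (dB r u -` A' \<inter> space M)"
    if "A \<in> sets (F r)" "A' \<in> sets borel" for A A'
    using that by (intro indep_setD) auto
  interpret P: prob_space "distr M borel (dB r u)"
    by (rule prob_space_distr[OF D])
  interpret Q: prob_space "distr M (F r) (\<lambda>\<omega>. \<omega>)"
    by (rule prob_space_distr[OF id])
  \<comment> \<open>Independence as a product law, checked on rectangles; Tonelli's theorem then
    separates the two variables.\<close>
  have dist: "distr M (F r) (\<lambda>\<omega>. \<omega>) \<Otimes>\<^sub>M distr M borel (dB r u)
      = distr M (F r \<Otimes>\<^sub>M borel) (\<lambda>\<omega>. (\<omega>, dB r u \<omega>))"
  proof (rule pair_measure_eqI)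
    show "sigma_finite_measure (distr M (F r) (\<lambda>\<omega>. \<omega>))" "sigma_finite_measure (distr M borel (dB r u))" ..
    show "sets (distr M (F r) (\<lambda>\<omega>. \<omega>) \<Otimes>\<^sub>M distr M borel (dB r u))
        = sets (distr M (F r \<Otimes>\<^sub>M borel) (\<lambda>\<omega>. (\<omega>, dB r u \<omega>)))"
      by (simp cong: sets_pair_measure_cong)
    fix A A' assume "A \<in> sets (distr M (F r) (\<lambda>\<omega>. \<omega>))" "A' \<in> sets (distr M borel (dB r u))"
    then have A: "A \<in> sets (F r)" "A \<in> sets M" "A' \<in> sets borel" using sets_F by auto
    have "(\<lambda>\<omega>. (\<omega>, dB r u \<omega>)) -` (A \<times> A') \<inter> space M = A \<inter> (dB r u -` A' \<inter> space M)"
      "(\<lambda>\<omega>. \<omega>) -` A \<inter> space M = A"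
      using sets.sets_into_space[OF A(2)] by auto
    moreover have "dB r u -` A' \<inter> space M \<in> sets M" using D A(3) by (rule measurable_sets)
    ultimately show "emeasure (distr M (F r) (\<lambda>\<omega>. \<omega>)) A * emeasure (distr M borel (dB r u)) A'
        = emeasure (distr M (F r \<Otimes>\<^sub>M borel) (\<lambda>\<omega>. (\<omega>, dB r u \<omega>))) (A \<times> A')"
      using A id D ind[OF A(1,3)]
      by (simp add: emeasure_distr measurable_Pair pair_measureI emeasure_eq_measure ennreal_mult)
  qed
  have sets_eq: "sets (distr M (F r) (\<lambda>\<omega>. \<omega>) \<Otimes>\<^sub>M distr M borel (dB r u)) = sets (F r \<Otimes>\<^sub>M borel)"
    by (intro sets_pair_measure_cong) simp_all
  have "(\<integral>\<^sup>+ \<omega>. g (\<omega>, dB r u \<omega>) \<partial>M) = (\<integral>\<^sup>+ z. g z \<partial>distr M (F r \<Otimes>\<^sub>M borel) (\<lambda>\<omega>. (\<omega>, dB r u \<omega>)))"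
    by (subst nn_integral_distr) (use g id D in auto)
  also have "\<dots> = (\<integral>\<^sup>+ \<omega>. (\<integral>\<^sup>+ d. g (\<omega>, d) \<partial>distr M borel (dB r u)) \<partial>distr M (F r) (\<lambda>\<omega>. \<omega>))"
    using P.nn_integral_fst[of g "distr M (F r) (\<lambda>\<omega>. \<omega>)"] g
    by (simp add: dist measurable_cong_sets[OF sets_eq refl])
  also have "\<dots> = (\<integral>\<^sup>+ \<omega>. (\<integral>\<^sup>+ d. g (\<omega>, d) \<partial>distr M borel (dB r u)) \<partial>M)"
  proof -
    have "(\<lambda>\<omega>. \<integral>\<^sup>+ d. g (\<omega>, d) \<partial>distr M borel (dB r u)) \<in> borel_measurable (F r)"
      using P.borel_measurable_nn_integral_fst[of g "F r"] g
      by (simp add: measurable_cong_sets[OF sets_pair_measure_cong[OF refl sets_distr] refl])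
    then show ?thesis
      using id by (subst nn_integral_distr) auto
  qed
  also have "\<dots> = (\<integral>\<^sup>+ \<omega>. (\<integral>\<^sup>+ \<omega>'. g (\<omega>, dB r u \<omega>') \<partial>M) \<partial>M)"
  proof (rule nn_integral_cong)
    fix \<omega> assume "\<omega> \<in> space M"
    then have "(\<lambda>d. g (\<omega>, d)) \<in> borel_measurable borel"
      by (intro measurable_Pair2[OF g]) simp
    then show "(\<integral>\<^sup>+ d. g (\<omega>, d) \<partial>distr M borel (dB r u)) = (\<integral>\<^sup>+ \<omega>'. g (\<omega>, dB r u \<omega>') \<partial>M)"
      using D by (subst nn_integral_distr) auto
  qed
  finally show ?thesis .
qed

lemma increment_distributed:
  "0 \<le> r \<Longrightarrow> r < u \<Longrightarrow> distributed M lborel (\<lambda>\<omega>. dB r u \<omega> $ k) (normal_density 0 (sqrt (u - r)))"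
  using BM by (simp add: brownian_family_def)

lemma increment_indep:
  "0 \<le> r \<Longrightarrow> r < u \<Longrightarrow> indep_vars (\<lambda>_. borel) (\<lambda>k \<omega>. dB r u \<omega> $ k) UNIV"
  using BM by (simp add: brownian_family_def)

lemma measurable_dB_nth: "0 \<le> r \<Longrightarrow> r < u \<Longrightarrow> (\<lambda>\<omega>. dB r u \<omega> $ k) \<in> borel_measurable M"
  by (simp add: borel_measurable_diff measurable_B_M)

lemma increment_moments:
  assumes "0 \<le> r" "r < u"
  shows "integrable M (\<lambda>\<omega>. dB r u \<omega> $ k)" "expectation (\<lambda>\<omega>. dB r u \<omega> $ k) = 0"
    and "integrable M (\<lambda>\<omega>. (dB r u \<omega> $ k)\<^sup>2)" "expectation (\<lambda>\<omega>. (dB r u \<omega> $ k)\<^sup>2) = u - r"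
proof -
  note dist = increment_distributed[OF assms, of k]
  have \<sigma>: "0 < sqrt (u - r)" using assms by simp
  show "integrable M (\<lambda>\<omega>. dB r u \<omega> $ k)"
    using distributed_integrable[OF dist, of "\<lambda>x. x"] integrable_normal_moment_nz_1[OF \<sigma>, of 0] by simp
  show "expectation (\<lambda>\<omega>. dB r u \<omega> $ k) = 0"
    using distributed_integral[OF dist, of "\<lambda>x. x"] integral_normal_moment_nz_1[OF \<sigma>, of 0] by simp
  show "integrable M (\<lambda>\<omega>. (dB r u \<omega> $ k)\<^sup>2)"
    using distributed_integrable[OF dist, of "\<lambda>x. x\<^sup>2"] integrable_normal_moment[OF \<sigma>, of 0 2] by simp
  show "expectation (\<lambda>\<omega>. (dB r u \<omega> $ k)\<^sup>2) = u - r"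
    using distributed_integral[OF dist, of "\<lambda>x. x\<^sup>2"] integral_normal_moment_even[OF \<sigma>, of 0 1] assms
    by (simp add: fact_numeral)
qed

lemma increment_covariance:
  assumes "0 \<le> r" "r < u"
  shows "integrable M (\<lambda>\<omega>. dB r u \<omega> $ k * dB r u \<omega> $ l)"
    and "expectation (\<lambda>\<omega>. dB r u \<omega> $ k * dB r u \<omega> $ l) = (if k = l then u - r else 0)"
proof -
  have "integrable M (\<lambda>\<omega>. dB r u \<omega> $ k * dB r u \<omega> $ l) \<and>
    expectation (\<lambda>\<omega>. dB r u \<omega> $ k * dB r u \<omega> $ l) = (if k = l then u - r else 0)"
  proof (cases "k = l")
    case True
    then show ?thesis
      using increment_moments(3,4)[OF assms, of l] by (simp add: power2_eq_square del: dB_nth)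
  next
    case False
    have ind: "indep_vars (\<lambda>_. borel) (\<lambda>k \<omega>. dB r u \<omega> $ k) {k, l}"
      by (rule indep_vars_subset[OF increment_indep[OF assms]]) simp
    show ?thesis
      using indep_vars_lebesgue_integral[OF _ ind] indep_vars_integrable[OF _ ind]
        increment_moments[OF assms] False by (simp del: dB_nth)
  qed
  then show "integrable M (\<lambda>\<omega>. dB r u \<omega> $ k * dB r u \<omega> $ l)"
    and "expectation (\<lambda>\<omega>. dB r u \<omega> $ k * dB r u \<omega> $ l) = (if k = l then u - r else 0)" by auto
qed

text \<open>The mixed terms drop out because each component is centred and different components are
  uncorrelated. The constants \<open>a\<close> and \<open>v\<close> stand for values frozen at time
  \<open>r\<close>.\<close>

lemma increment_second_moment:
  fixes a :: "'b::euclidean_space" and v :: "'d \<Rightarrow> 'b"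
  assumes ru: "0 \<le> r" "r < u"
  shows "L2sq M (\<lambda>\<omega>. a + (\<Sum>k\<in>UNIV. dB r u \<omega> $ k *\<^sub>R v k))
    = ennreal ((norm a)\<^sup>2 + (u - r) * (\<Sum>k\<in>UNIV. (norm (v k))\<^sup>2))"
proof -
  note [simp del] = dB_nth
  have expand: "(norm (a + (\<Sum>k\<in>UNIV. dB r u \<omega> $ k *\<^sub>R v k)))\<^sup>2
    = a \<bullet> a + (\<Sum>k\<in>UNIV. dB r u \<omega> $ k * (2 * (a \<bullet> v k)))
      + (\<Sum>k\<in>UNIV. \<Sum>l\<in>UNIV. (dB r u \<omega> $ k * dB r u \<omega> $ l) * (v k \<bullet> v l))" for \<omega>
  proof -
    have "a \<bullet> (\<Sum>k\<in>UNIV. dB r u \<omega> $ k *\<^sub>R v k) = (\<Sum>k\<in>UNIV. dB r u \<omega> $ k * (a \<bullet> v k))"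
      by (simp add: inner_sum_right)
    moreover have "(\<Sum>k\<in>UNIV. dB r u \<omega> $ k *\<^sub>R v k) \<bullet> (\<Sum>k\<in>UNIV. dB r u \<omega> $ k *\<^sub>R v k)
        = (\<Sum>k\<in>UNIV. \<Sum>l\<in>UNIV. (dB r u \<omega> $ k * dB r u \<omega> $ l) * (v k \<bullet> v l))"
      by (simp add: inner_sum_left inner_sum_right sum_distrib_left mult_ac inner_commute)
    moreover have "(\<Sum>k\<in>UNIV. dB r u \<omega> $ k * (2 * (a \<bullet> v k))) = 2 * (\<Sum>k\<in>UNIV. dB r u \<omega> $ k * (a \<bullet> v k))"
      by (simp add: sum_distrib_left mult_ac)
    ultimately show ?thesis
      by (simp add: power2_norm_eq_inner inner_add_left inner_add_right inner_commute)
  qed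
  have int: "integrable M (\<lambda>\<omega>. (norm (a + (\<Sum>k\<in>UNIV. dB r u \<omega> $ k *\<^sub>R v k)))\<^sup>2)"
    unfolding expand using increment_moments(1)[OF ru] increment_covariance(1)[OF ru]
    by (intro Bochner_Integration.integrable_add Bochner_Integration.integrable_sum
        integrable_const integrable_mult_left) auto
  have "expectation (\<lambda>\<omega>. (norm (a + (\<Sum>k\<in>UNIV. dB r u \<omega> $ k *\<^sub>R v k)))\<^sup>2)
      = a \<bullet> a + (\<Sum>k\<in>UNIV. 0 * (2 * (a \<bullet> v k)))
        + (\<Sum>k\<in>UNIV. \<Sum>l\<in>UNIV. (if k = l then u - r else 0) * (v k \<bullet> v l))"
    unfolding expand
    using increment_moments(1,2)[OF ru] increment_covariance[OF ru]
    by (simp add: Bochner_Integration.integral_add Bochner_Integration.integral_sum prob_space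
        Bochner_Integration.integrable_add Bochner_Integration.integrable_sum)
  also have "\<dots> = (norm a)\<^sup>2 + (u - r) * (\<Sum>k\<in>UNIV. (norm (v k))\<^sup>2)"
    by (simp add: power2_norm_eq_inner if_distrib[where f="\<lambda>x. x * _"] sum_distrib_left cong: if_cong)
  finally show ?thesis
    by (subst nn_integral_eq_integral[OF int]) auto
qed

lemma increment_exp_moment:
  assumes ru: "0 \<le> r" "r < u"
  shows "(\<integral>\<^sup>+ \<omega>. ennreal (exp (a + (\<Sum>k\<in>UNIV. dB r u \<omega> $ k * c k))) \<partial>M)
    = ennreal (exp (a + (u - r) / 2 * (\<Sum>k\<in>UNIV. (c k)\<^sup>2)))"
proof -
  note [simp del] = dB_nth
  have [measurable]: "(\<lambda>\<omega>. dB r u \<omega> $ k) \<in> borel_measurable M" for k by (rule measurable_dB_nth[OF ru])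
  have one: "(\<integral>\<^sup>+ \<omega>. ennreal (exp (dB r u \<omega> $ k * c k)) \<partial>M) = ennreal (exp ((u - r) / 2 * (c k)\<^sup>2))" for k
    using distributed_nn_integral[OF increment_distributed[OF ru, of k], of "\<lambda>x. ennreal (exp (c k * x))"]
      normal_exp_moment[of "sqrt (u - r)" "c k"] ru
    by (simp add: mult.commute)
  have ind: "indep_vars (\<lambda>_. borel) (\<lambda>k \<omega>. ennreal (exp (dB r u \<omega> $ k * c k))) UNIV"
    by (rule indep_vars_compose2[OF increment_indep[OF ru], where Y="\<lambda>k x. ennreal (exp (x * c k))"]) simp
  have "(\<integral>\<^sup>+ \<omega>. ennreal (exp (a + (\<Sum>k\<in>UNIV. dB r u \<omega> $ k * c k))) \<partial>M)
      = (\<integral>\<^sup>+ \<omega>. ennreal (exp a) * (\<Prod>k\<in>UNIV. ennreal (exp (dB r u \<omega> $ k * c k))) \<partial>M)"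
    by (simp add: exp_add exp_sum ennreal_mult prod_ennreal prod_nonneg)
  also have "\<dots> = ennreal (exp a) * (\<integral>\<^sup>+ \<omega>. (\<Prod>k\<in>UNIV. ennreal (exp (dB r u \<omega> $ k * c k))) \<partial>M)"
    by (rule nn_integral_cmult) measurable
  also have "\<dots> = ennreal (exp a) * (\<Prod>k\<in>UNIV. ennreal (exp ((u - r) / 2 * (c k)\<^sup>2)))"
    by (subst indep_vars_nn_integral[OF _ ind]) (auto simp: one)
  also have "\<dots> = ennreal (exp (a + (u - r) / 2 * (\<Sum>k\<in>UNIV. (c k)\<^sup>2)))"
    by (simp add: exp_add exp_sum ennreal_mult prod_ennreal prod_nonneg sum_distrib_left)
  finally show ?thesis .
qed

text \<open>One step of the isometry: with \<open>a\<close> and \<open>v\<close> frozen at time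
  \<open>r\<close>, the formula for constants applies inside. Iteration over a grid gives second
  moments of left-point sums.\<close>

lemma nn_integral_increment_norm2:
  fixes a :: "'w \<Rightarrow> 'b::euclidean_space" and v :: "'d \<Rightarrow> 'w \<Rightarrow> 'b"
  assumes ru: "0 \<le> r" "r < u" and a: "a \<in> borel_measurable (F r)" and v: "\<And>k. v k \<in> borel_measurable (F r)"
  shows "L2sq M (\<lambda>\<omega>. a \<omega> + (\<Sum>k\<in>UNIV. dB r u \<omega> $ k *\<^sub>R v k \<omega>))
    = (\<integral>\<^sup>+ \<omega>. ennreal ((norm (a \<omega>))\<^sup>2 + (u - r) * (\<Sum>k\<in>UNIV. (norm (v k \<omega>))\<^sup>2)) \<partial>M)"
proof -
  note [simp del] = dB_nth
  have [measurable]: "(\<lambda>p. a (fst p)) \<in> borel_measurable (F r \<Otimes>\<^sub>M (borel :: (real ^ 'd) measure))"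
      "(\<lambda>p. v k (fst p)) \<in> borel_measurable (F r \<Otimes>\<^sub>M (borel :: (real ^ 'd) measure))" for k
    by (auto intro!: measurable_case_prod_fst_F a v)
  have nth [measurable]: "(\<lambda>x :: real ^ 'd. x $ k) \<in> borel_measurable borel" for k
    by (intro borel_measurable_continuous_onI continuous_intros)
  have "(\<lambda>p. ennreal ((norm (a (fst p) + (\<Sum>k\<in>UNIV. snd p $ k *\<^sub>R v k (fst p))))\<^sup>2))
      \<in> borel_measurable (F r \<Otimes>\<^sub>M (borel :: (real ^ 'd) measure))"
    by measurable
  from nn_integral_freeze[OF ru this] show ?thesis
    by (simp add: increment_second_moment[OF ru])
qed

text \<open>The exponential counterpart, one step of the estimate behind exponential
  martingales.\<close>

lemma nn_integral_increment_exp: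
  assumes ru: "0 \<le> r" "r < u" and a: "a \<in> borel_measurable (F r)" and c: "\<And>k. c k \<in> borel_measurable (F r)"
  shows "(\<integral>\<^sup>+ \<omega>. ennreal (exp (a \<omega> + (\<Sum>k\<in>UNIV. dB r u \<omega> $ k * c k \<omega>))) \<partial>M)
    = (\<integral>\<^sup>+ \<omega>. ennreal (exp (a \<omega> + (u - r) / 2 * (\<Sum>k\<in>UNIV. (c k \<omega>)\<^sup>2))) \<partial>M)"
proof -
  note [simp del] = dB_nth
  have [measurable]: "(\<lambda>p. a (fst p)) \<in> borel_measurable (F r \<Otimes>\<^sub>M (borel :: (real ^ 'd) measure))"
      "(\<lambda>p. c k (fst p)) \<in> borel_measurable (F r \<Otimes>\<^sub>M (borel :: (real ^ 'd) measure))" for k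
    by (auto intro!: measurable_case_prod_fst_F a c)
  have nth [measurable]: "(\<lambda>x :: real ^ 'd. x $ k) \<in> borel_measurable borel" for k
    by (intro borel_measurable_continuous_onI continuous_intros)
  have "(\<lambda>p. ennreal (exp (a (fst p) + (\<Sum>k\<in>UNIV. snd p $ k * c k (fst p)))))
      \<in> borel_measurable (F r \<Otimes>\<^sub>M (borel :: (real ^ 'd) measure))"
    by measurable
  from nn_integral_freeze[OF ru this] show ?thesis
    by (simp add: increment_exp_moment[OF ru])
qed

section \<open>Ito isometry for finite sums of simple terms\<close>

lemma indep_var_past:
  fixes f :: "'w \<Rightarrow> real" and h :: "real ^ 'd \<Rightarrow> real"
  assumes ru: "0 \<le> r" "r < u" and f: "f \<in> borel_measurable (F r)" and h: "h \<in> borel_measurable borel"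
  shows "indep_var borel f borel (\<lambda>\<omega>. h (dB r u \<omega>))"
proof -
  have D: "dB r u \<in> borel_measurable M"
    using ru by (intro measurable_dB_M) auto
  have hD: "(\<lambda>\<omega>. h (dB r u \<omega>)) \<in> borel_measurable M"
    by (rule measurable_compose[OF D h])
  have "indep_set (sets (F r)) {dB r u -` A \<inter> space M | A. A \<in> sets borel}"
    using BM ru unfolding brownian_family_def dB_def by blast
  then have ind: "indep_set {f -` A \<inter> space M | A. A \<in> sets borel}
      {(\<lambda>\<omega>. h (dB r u \<omega>)) -` A \<inter> space M | A. A \<in> sets borel}"
    unfolding indep_set_def
  proof (rule indep_sets_mono_sets)
    have 1: "{f -` A \<inter> space M | A. A \<in> sets borel} \<subseteq> sets (F r)"
      using measurable_sets[OF f] by auto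
    have 2: "{(\<lambda>\<omega>. h (dB r u \<omega>)) -` A \<inter> space M | A. A \<in> sets borel}
        \<subseteq> {dB r u -` A \<inter> space M | A. A \<in> sets borel}"
    proof safe
      fix A :: "real set" assume "A \<in> sets borel"
      then have "h -` A \<in> sets borel" using measurable_sets[OF h, of A] by simp
      then show "\<exists>A'. (\<lambda>\<omega>. h (dB r u \<omega>)) -` A \<inter> space M = dB r u -` A' \<inter> space M \<and> A' \<in> sets borel"
        by (intro exI[of _ "h -` A"]) auto
    qed
    show "case_bool {f -` A \<inter> space M |A. A \<in> sets borel}
          {(\<lambda>\<omega>. h (dB r u \<omega>)) -` A \<inter> space M |A. A \<in> sets borel} i
         \<subseteq> case_bool (sets (F r)) {dB r u -` A \<inter> space M |A. A \<in> sets borel} i" for i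
      using 1 2 by (cases i) auto
  qed
  have stable: "Int_stable {g -` A \<inter> space M | A. A \<in> sets borel}" for g :: "'w \<Rightarrow> real"
  proof (rule Int_stableI, clarify)
    fix A A' :: "real set" assume "A \<in> sets borel" "A' \<in> sets borel"
    then show "\<exists>C. g -` A \<inter> space M \<inter> (g -` A' \<inter> space M) = g -` C \<inter> space M \<and> C \<in> sets borel"
      by (intro exI[of _ "A \<inter> A'"]) auto
  qed
  show ?thesis
    unfolding indep_var_eq
    using measurable_F_M[OF f] hD indep_set_sigma_sets[OF ind stable stable] by simp
qed

lemma past_times_increment:
  assumes "0 \<le> c" "c \<le> d" and f: "f \<in> borel_measurable (F c)" and int: "integrable M f"
  shows "has_bochner_integral M (\<lambda>\<omega>. f \<omega> * (B k d \<omega> - B k c \<omega>)) 0"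
\<comment> \<open>Equal endpoints are split off because the law of an increment is given for
  \<open>s < t\<close>, whereas a simple process may repeat grid points.\<close>
proof (cases "c = d")
  case False
  then have cd: "0 \<le> c" "c < d" using assms by auto
  have "indep_var borel f borel (\<lambda>\<omega>. dB c d \<omega> $ k)"
    by (rule indep_var_past[OF cd f]) (intro borel_measurable_continuous_onI continuous_intros)
  then show ?thesis
    using indep_var_lebesgue_integral[of f "\<lambda>\<omega>. dB c d \<omega> $ k"] indep_var_integrable[of f "\<lambda>\<omega>. dB c d \<omega> $ k"]
      increment_moments(1,2)[OF cd, of k] int by (simp add: has_bochner_integral_iff)
qed (simp add: has_bochner_integral_iff)

lemma past_times_increment_squared:
  assumes "0 \<le> c" "c \<le> d" and f: "f \<in> borel_measurable (F c)" and int: "integrable M f"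
  shows "has_bochner_integral M (\<lambda>\<omega>. f \<omega> * (B k d \<omega> - B k c \<omega>)\<^sup>2) ((d - c) * expectation f)"
proof (cases "c = d")
  case False
  then have cd: "0 \<le> c" "c < d" using assms by auto
  have "indep_var borel f borel (\<lambda>\<omega>. (dB c d \<omega> $ k)\<^sup>2)"
    by (rule indep_var_past[OF cd f]) (intro borel_measurable_continuous_onI continuous_intros)
  then show ?thesis
    using indep_var_lebesgue_integral[of f "\<lambda>\<omega>. (dB c d \<omega> $ k)\<^sup>2"] indep_var_integrable[of f "\<lambda>\<omega>. (dB c d \<omega> $ k)\<^sup>2"]
      increment_moments(3,4)[OF cd, of k] int by (simp add: has_bochner_integral_iff mult.commute)
qed (simp add: has_bochner_integral_iff)

text \<open>The factor \<open>\<beta>\<close> may be known as late as \<open>c\<close>: together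
  with the earlier increment it is a quantity known at \<open>c\<close>, which multiplies a centred
  increment independent of it. Boundedness of \<open>\<beta>\<close> provides the
  integrability.\<close>

lemma increment_products:
  assumes "0 \<le> a" "a \<le> b" "b \<le> c" "c \<le> d" and \<beta>: "\<beta> \<in> borel_measurable (F c)"
    and bd: "\<And>\<omega>. \<omega> \<in> space M \<Longrightarrow> \<bar>\<beta> \<omega>\<bar> \<le> K"
  shows "has_bochner_integral M (\<lambda>\<omega>. (B k b \<omega> - B k a \<omega>) * (B k d \<omega> - B k c \<omega>) * \<beta> \<omega>) 0"
proof -
  have m: "\<beta> \<in> borel_measurable M" by (rule measurable_F_M[OF \<beta>])
  have one: "(\<lambda>_. 1::real) \<in> borel_measurable (F a)" by simp
  have "integrable M (\<lambda>\<omega>. B k b \<omega> - B k a \<omega>)"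
    using past_times_increment[OF assms(1,2) one, of k] by (simp add: has_bochner_integral_iff)
  then have "integrable M (\<lambda>\<omega>. K * (B k b \<omega> - B k a \<omega>))"
    by simp
  then have "integrable M (\<lambda>\<omega>. \<beta> \<omega> * (B k b \<omega> - B k a \<omega>))"
  proof (rule Bochner_Integration.integrable_bound)
    show "AE \<omega> in M. norm (\<beta> \<omega> * (B k b \<omega> - B k a \<omega>)) \<le> norm (K * (B k b \<omega> - B k a \<omega>))"
      using bd by (intro AE_I2) (auto simp: abs_mult intro!: mult_right_mono intro: order_trans[OF _ abs_ge_self])
    show "(\<lambda>\<omega>. \<beta> \<omega> * (B k b \<omega> - B k a \<omega>)) \<in> borel_measurable M"
      using assms by (intro borel_measurable_times borel_measurable_diff measurable_B_M m) auto
  qed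
  moreover have "(\<lambda>\<omega>. \<beta> \<omega> * (B k b \<omega> - B k a \<omega>)) \<in> borel_measurable (F c)"
    using assms by (intro borel_measurable_times borel_measurable_diff measurable_B \<beta>) auto
  ultimately show ?thesis
    using past_times_increment[of c d "\<lambda>\<omega>. \<beta> \<omega> * (B k b \<omega> - B k a \<omega>)" k] assms
    by (simp add: mult_ac)
qed

text \<open>Only the common stretch contributes. Both increments are cut at \<open>c\<close> and at
  \<open>f = min b d\<close>, the start and the end of the overlap; products of different pieces
  have mean 0, and the squared increment over the overlap remains.\<close>

lemma increment_overlap_ordered:
  assumes ab: "0 \<le> a" "a \<le> b" and cd: "c \<le> d" and ac: "a \<le> c" and \<beta>: "\<beta> \<in> borel_measurable (F c)"
    and bd: "\<And>\<omega>. \<omega> \<in> space M \<Longrightarrow> \<bar>\<beta> \<omega>\<bar> \<le> K"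
  shows "has_bochner_integral M (\<lambda>\<omega>. (B k b \<omega> - B k a \<omega>) * (B k d \<omega> - B k c \<omega>) * \<beta> \<omega>) (overlap a b c d * expectation \<beta>)"
proof (cases "b \<le> c")
  case True
  then show ?thesis
    using increment_products[OF ab True cd \<beta> bd, of k] by (simp add: overlap_def)
next
  case False
  have int: "integrable M \<beta>"
    by (rule integrable_const_bound[of _ K]) (use bd measurable_F_M[OF \<beta>] in auto)
  define f where "f = min b d"
  have f: "c \<le> f" "f \<le> b" "f \<le> d" using False cd by (auto simp: f_def)
  have ov: "overlap a b c d = f - c" using False f ac by (simp add: overlap_def f_def)
  have \<beta>f: "\<beta> \<in> borel_measurable (F f)" by (rule measurable_F_mono[OF \<beta> f(1)])
  have 1: "has_bochner_integral M (\<lambda>\<omega>. (B k c \<omega> - B k a \<omega>) * (B k d \<omega> - B k c \<omega>) * \<beta> \<omega>) 0"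
    using ab cd ac \<beta> bd by (intro increment_products) auto
  have 2: "has_bochner_integral M (\<lambda>\<omega>. (B k f \<omega> - B k c \<omega>) * (B k d \<omega> - B k f \<omega>) * \<beta> \<omega>) 0"
    using ab ac f \<beta>f bd by (intro increment_products) auto
  have 3: "has_bochner_integral M (\<lambda>\<omega>. (B k f \<omega> - B k c \<omega>) * (B k b \<omega> - B k f \<omega>) * \<beta> \<omega>) 0"
    using ab ac f \<beta>f bd by (intro increment_products) auto
  have 4: "has_bochner_integral M (\<lambda>\<omega>. \<beta> \<omega> * (B k f \<omega> - B k c \<omega>)\<^sup>2) ((f - c) * expectation \<beta>)"
    using ab ac f \<beta> int by (intro past_times_increment_squared) auto
  have eq: "(B k b \<omega> - B k a \<omega>) * (B k d \<omega> - B k c \<omega>) * \<beta> \<omega>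
      = (B k c \<omega> - B k a \<omega>) * (B k d \<omega> - B k c \<omega>) * \<beta> \<omega>
        + ((B k f \<omega> - B k c \<omega>) * (B k d \<omega> - B k f \<omega>) * \<beta> \<omega>
        + ((B k f \<omega> - B k c \<omega>) * (B k b \<omega> - B k f \<omega>) * \<beta> \<omega> + \<beta> \<omega> * (B k f \<omega> - B k c \<omega>)\<^sup>2))" for \<omega>
  proof -
    \<comment> \<open>\<open>f\<close> is \<open>b\<close> or \<open>d\<close>, so one factor is 0
      and the product of the two tails disappears.\<close>
    have "(B k b \<omega> - B k f \<omega>) * (B k d \<omega> - B k f \<omega>) = 0"
      by (auto simp: f_def min_def)
    then show ?thesis by algebra
  qed
  show ?thesis
    unfolding eq ov using 1 2 3 4 by (simp add: has_bochner_integral_iff)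
qed

lemma increment_overlap:
  fixes \<xi> \<eta> :: "'w \<Rightarrow> 'b::euclidean_space"
  assumes "0 \<le> a" "a \<le> b" "0 \<le> c" "c \<le> d"
    and \<xi>: "\<xi> \<in> borel_measurable (F a)" "bounded (\<xi> ` space M)"
    and \<eta>: "\<eta> \<in> borel_measurable (F c)" "bounded (\<eta> ` space M)"
  shows "has_bochner_integral M (\<lambda>\<omega>. (B k b \<omega> - B k a \<omega>) * (B k d \<omega> - B k c \<omega>) * (\<xi> \<omega> \<bullet> \<eta> \<omega>)) (overlap a b c d * expectation (\<lambda>\<omega>. \<xi> \<omega> \<bullet> \<eta> \<omega>))"
proof -
  obtain K1 K2 where K: "\<And>\<omega>. \<omega> \<in> space M \<Longrightarrow> norm (\<xi> \<omega>) \<le> K1" "\<And>\<omega>. \<omega> \<in> space M \<Longrightarrow> norm (\<eta> \<omega>) \<le> K2"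
    using \<xi>(2) \<eta>(2) by (auto simp: bounded_iff)
  have bd: "\<bar>\<xi> \<omega> \<bullet> \<eta> \<omega>\<bar> \<le> K1 * K2" if "\<omega> \<in> space M" for \<omega>
    using Cauchy_Schwarz_ineq2[of "\<xi> \<omega>" "\<eta> \<omega>"] mult_mono[OF K[OF that]] order_trans[OF norm_ge_zero K(1)[OF that]]
    by (auto intro: order_trans)
  have m: "(\<lambda>\<omega>. \<xi> \<omega> \<bullet> \<eta> \<omega>) \<in> borel_measurable (F e)" if "a \<le> e" "c \<le> e" for e
    using measurable_F_mono[OF \<xi>(1) that(1)] measurable_F_mono[OF \<eta>(1) that(2)] by (rule borel_measurable_inner)
  show ?thesis
  proof (cases "a \<le> c")
    case True
    show ?thesis
      by (rule increment_overlap_ordered[OF _ _ _ True m bd]) (use assms True in auto)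
  next
    case False
    have "has_bochner_integral M (\<lambda>\<omega>. (B k d \<omega> - B k c \<omega>) * (B k b \<omega> - B k a \<omega>) * (\<xi> \<omega> \<bullet> \<eta> \<omega>)) (overlap c d a b * expectation (\<lambda>\<omega>. \<xi> \<omega> \<bullet> \<eta> \<omega>))"
      by (rule increment_overlap_ordered[OF _ _ _ _ m bd]) (use assms False in auto)
    then show ?thesis
      by (simp add: mult.commute[of "B k d _ - B k c _"] overlap_sym[of a b])
  qed
qed

text \<open>The intervals form an arbitrary finite family and need not be a partition, so
  differences of simple integrals over unrelated grids are covered without a common refinement. Both
  sides reduce to the same double sum over pairs with \<open>overlap\<close> as weight.\<close>

lemma simple_family_isometry:
  fixes \<xi> :: "'i \<Rightarrow> 'w \<Rightarrow> 'b::euclidean_space"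
  assumes "finite I" and ab: "\<And>i. i \<in> I \<Longrightarrow> 0 \<le> a i \<and> a i \<le> b i \<and> b i \<le> T"
    and \<xi>: "\<And>i. i \<in> I \<Longrightarrow> \<xi> i \<in> borel_measurable (F (a i))" "\<And>i. i \<in> I \<Longrightarrow> bounded (\<xi> i ` space M)"
  shows "L2sq M (\<lambda>\<omega>. \<Sum>i\<in>I. (B k (b i) \<omega> - B k (a i) \<omega>) *\<^sub>R \<xi> i \<omega>)
    = (\<integral>\<^sup>+ \<omega>. (\<integral>\<^sup>+ s\<in>{0..T}. ennreal ((norm (\<Sum>i\<in>I. indicator {a i<..b i} s *\<^sub>R \<xi> i \<omega>))\<^sup>2) \<partial>lborel) \<partial>M)"
proof -
  let ?S = "\<lambda>s \<omega>. \<Sum>i\<in>I. indicator {a i<..b i} s *\<^sub>R \<xi> i \<omega>"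
  let ?D = "\<lambda>\<omega>. \<Sum>i\<in>I. (B k (b i) \<omega> - B k (a i) \<omega>) *\<^sub>R \<xi> i \<omega>"
  define Q where "Q \<omega> = (\<Sum>i\<in>I. \<Sum>j\<in>I. overlap (a i) (b i) (a j) (b j) * (\<xi> i \<omega> \<bullet> \<xi> j \<omega>))" for \<omega>
  have L: "(norm (\<Sum>i\<in>I. c i *\<^sub>R x i))\<^sup>2 = (\<Sum>i\<in>I. \<Sum>j\<in>I. c i * c j * (x i \<bullet> x j))" for c :: "'i \<Rightarrow> real" and x :: "'i \<Rightarrow> 'b"
    by (simp add: power2_norm_eq_inner inner_sum_left inner_sum_right sum_distrib_left mult_ac inner_commute)
  have Q: "Q \<omega> = (\<integral>s. (norm (?S s \<omega>))\<^sup>2 \<partial>lborel)" for \<omega>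
    unfolding Q_def L using ab integral_indicator_overlap
    by (simp add: Bochner_Integration.integral_sum Bochner_Integration.integrable_sum)
  have ovl: "has_bochner_integral M (\<lambda>\<omega>. (B k (b i) \<omega> - B k (a i) \<omega>) * (B k (b j) \<omega> - B k (a j) \<omega>) * (\<xi> i \<omega> \<bullet> \<xi> j \<omega>)) (overlap (a i) (b i) (a j) (b j) * expectation (\<lambda>\<omega>. \<xi> i \<omega> \<bullet> \<xi> j \<omega>))" if "i \<in> I" "j \<in> I" for i j
    using ab[OF that(1)] ab[OF that(2)] \<xi> that by (intro increment_overlap) auto
  have int\<xi>: "integrable M (\<lambda>\<omega>. \<xi> i \<omega> \<bullet> \<xi> j \<omega>)" if ij: "i \<in> I" "j \<in> I" for i j
  proof -
    obtain K1 K2 where K: "\<And>\<omega>. \<omega> \<in> space M \<Longrightarrow> norm (\<xi> i \<omega>) \<le> K1" "\<And>\<omega>. \<omega> \<in> space M \<Longrightarrow> norm (\<xi> j \<omega>) \<le> K2"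
      using \<xi>(2)[OF ij(1)] \<xi>(2)[OF ij(2)] by (auto simp: bounded_iff)
    have bd: "norm (\<xi> i \<omega> \<bullet> \<xi> j \<omega>) \<le> K1 * K2" if "\<omega> \<in> space M" for \<omega>
      using Cauchy_Schwarz_ineq2[of "\<xi> i \<omega>" "\<xi> j \<omega>"] mult_mono[OF K[OF that]] order_trans[OF norm_ge_zero K(1)[OF that]]
      by (auto intro: order_trans)
    show ?thesis
      by (rule integrable_const_bound[of _ "K1 * K2"])
        (use bd measurable_F_M[OF \<xi>(1)[OF ij(1)]] measurable_F_M[OF \<xi>(1)[OF ij(2)]] in \<open>auto intro!: AE_I2\<close>)
  qed
  have "L2sq M (\<lambda>\<omega>. \<Sum>i\<in>I. (B k (b i) \<omega> - B k (a i) \<omega>) *\<^sub>R \<xi> i \<omega>)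
      = ennreal (expectation (\<lambda>\<omega>. (norm (?D \<omega>))\<^sup>2))"
  proof (rule nn_integral_eq_integral)
    show "integrable M (\<lambda>\<omega>. (norm (?D \<omega>))\<^sup>2)"
      unfolding L using ovl by (auto simp: has_bochner_integral_iff intro!: Bochner_Integration.integrable_sum)
  qed simp
  also have "expectation (\<lambda>\<omega>. (norm (?D \<omega>))\<^sup>2)
      = (\<Sum>i\<in>I. \<Sum>j\<in>I. overlap (a i) (b i) (a j) (b j) * expectation (\<lambda>\<omega>. \<xi> i \<omega> \<bullet> \<xi> j \<omega>))"
    unfolding L using ovl by (simp add: has_bochner_integral_iff Bochner_Integration.integral_sum Bochner_Integration.integrable_sum)
  also have "\<dots> = expectation Q"
    unfolding Q_def using int\<xi> by (simp add: Bochner_Integration.integral_sum Bochner_Integration.integrable_sum)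
  also have "ennreal (expectation Q) = (\<integral>\<^sup>+ \<omega>. ennreal (Q \<omega>) \<partial>M)"
  proof (rule nn_integral_eq_integral[symmetric])
    show "integrable M Q" unfolding Q_def using int\<xi> by (auto intro!: Bochner_Integration.integrable_sum)
    show "AE \<omega> in M. 0 \<le> Q \<omega>" by (simp add: Q)
  qed
  also have "\<dots> = (\<integral>\<^sup>+ \<omega>. (\<integral>\<^sup>+ s\<in>{0..T}. ennreal ((norm (?S s \<omega>))\<^sup>2) \<partial>lborel) \<partial>M)"
  proof (rule nn_integral_cong)
    fix \<omega>
    have int: "integrable lborel (\<lambda>s. (norm (?S s \<omega>))\<^sup>2)"
      unfolding L using ab integral_indicator_overlap by (auto intro!: Bochner_Integration.integrable_sum)
    have "ennreal (Q \<omega>) = (\<integral>\<^sup>+ s. ennreal ((norm (?S s \<omega>))\<^sup>2) \<partial>lborel)"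
      using nn_integral_eq_integral[OF int] by (simp add: Q)
    also have "\<dots> = (\<integral>\<^sup>+ s\<in>{0..T}. ennreal ((norm (?S s \<omega>))\<^sup>2) \<partial>lborel)"
    proof (rule nn_integral_cong)
      fix s
      have "?S s \<omega> = 0" if "s \<notin> {0..T}"
        using ab that by (intro sum.neutral) (force simp: indicator_def)
      then show "ennreal ((norm (?S s \<omega>))\<^sup>2)
          = ennreal ((norm (?S s \<omega>))\<^sup>2) * indicator {0..T} s"
        by (auto simp: indicator_def)
    qed
    finally show "ennreal (Q \<omega>) = (\<integral>\<^sup>+ s\<in>{0..T}. ennreal ((norm (?S s \<omega>))\<^sup>2) \<partial>lborel)" .
  qed
  finally show ?thesis .
qed

end

section \<open>It\^o integrals as limits of Riemann sums\<close>

lemma grid_cell_unique: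
  fixes s t :: real
  assumes "s < t" "s < r" "r \<le> t" "0 < n"
  defines "p \<equiv> \<lambda>i. s + (t - s) * (real i / real n)"
  obtains i where "i < n" "r \<in> {p i<..p (Suc i)}" "\<And>j. j \<noteq> i \<Longrightarrow> r \<notin> {p j<..p (Suc j)}"
proof -
  have mono: "p i \<le> p j" if "i \<le> j" for i j
    using that assms by (auto simp: p_def divide_right_mono)
  have "r \<le> p m \<Longrightarrow> \<exists>i<m. r \<in> {p i<..p (Suc i)}" for m
  proof (induction m)
    case 0
    then show ?case using assms by (simp add: p_def)
  next
    case (Suc m)
    show ?case
    proof (cases "r \<le> p m")
      case True
      then show ?thesis using Suc.IH less_SucI by blast
    next
      case False
      then show ?thesis using Suc.prems by (intro exI[of _ m]) auto
    qed
  qed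
  moreover have "r \<le> p n" using assms by (simp add: p_def)
  ultimately obtain i where i: "i < n" "r \<in> {p i<..p (Suc i)}" by blast
  have "r \<notin> {p j<..p (Suc j)}" if "j \<noteq> i" for j
    using that i(2) mono[of "Suc j" i] mono[of "Suc i" j] by (cases "j < i") auto
  with i show ?thesis by (rule that)
qed

text \<open>Because the cells are half-open, one summand of \<open>simple_value\<close> at most is
  nonzero; its index depends neither on \<open>\<xi>\<close> nor on \<omega>.\<close>

lemma simple_value_grid:
  assumes st: "s < t" and r: "s < r" "r \<le> t" and "0 < n"
  obtains i where "i < n" "r \<in> {s + (t - s) * (real i / real n)<..s + (t - s) * (real (Suc i) / real n)}"
    "\<And>\<xi> \<omega>. simple_value n (\<lambda>i. s + (t - s) * (real i / real n)) \<xi> r \<omega> = (\<xi> i \<omega> :: 'b::euclidean_space)"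
proof -
  let ?p = "\<lambda>i. s + (t - s) * (real i / real n)"
  obtain i where i: "i < n" "r \<in> {?p i<..?p (Suc i)}" "\<And>j. j \<noteq> i \<Longrightarrow> r \<notin> {?p j<..?p (Suc j)}"
    using grid_cell_unique[OF assms] by blast
  have "simple_value n ?p \<xi> r \<omega> = (\<xi> i \<omega> :: 'b)" for \<xi> \<omega>
  proof -
    have "simple_value n ?p \<xi> r \<omega> = (\<Sum>j<n. if j = i then \<xi> i \<omega> else 0)"
      unfolding simple_value_def
      by (rule sum.cong[OF refl]) (use i in \<open>auto simp del: of_nat_Suc\<close>)
    then show ?thesis using i(1) by simp
  qed
  with i show ?thesis by (intro that) auto
qed

text \<open>The simple value at \<open>r\<close> is \<open>h\<close> at the left end of the cell
  containing \<open>r\<close>, so uniform continuity with cells shorter than \<open>d\<close> gives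
  the limit. The point \<open>s\<close> itself lies in no cell.\<close>

lemma grid_simple_value_tendsto:
  fixes h :: "real \<Rightarrow> 'b::euclidean_space"
  assumes st: "s < t" and cont: "continuous_on {s..t} h" and r: "s < r" "r \<le> t"
  shows "(\<lambda>n. simple_value n (\<lambda>i. s + (t - s) * (real i / real n)) (\<lambda>i _. h (s + (t - s) * (real i / real n))) r \<omega>) \<longlonglongrightarrow> h r"
proof (rule LIMSEQ_I)
  fix e :: real assume "e > 0"
  have "uniformly_continuous_on {s..t} h"
    by (rule compact_uniformly_continuous[OF cont]) auto
  then obtain d where d: "d > 0" "\<And>x y. x \<in> {s..t} \<Longrightarrow> y \<in> {s..t} \<Longrightarrow> dist y x < d \<Longrightarrow> dist (h y) (h x) < e"
    unfolding uniformly_continuous_on_def using \<open>e > 0\<close> by metis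
  obtain n0 :: nat where n0: "(t - s) / d < n0"
    using reals_Archimedean2 by blast
  have "norm (simple_value n (\<lambda>i. s + (t - s) * (real i / real n)) (\<lambda>i _. h (s + (t - s) * (real i / real n))) r \<omega> - h r) < e"
    if n: "n \<ge> Suc n0" for n
  proof -
    let ?p = "\<lambda>i. s + (t - s) * (real i / real n)"
    have npos: "0 < n" using n by simp
    obtain i where i: "i < n" "r \<in> {?p i<..?p (Suc i)}"
      and eq: "simple_value n ?p (\<lambda>i _. h (?p i)) r \<omega> = h (?p i)"
      using simple_value_grid[OF st r npos, where 'b='b] by metis
    have "?p (Suc i) - ?p i = (t - s) / n" using npos by (simp add: field_simps)
    also have "\<dots> < d"
    proof -
      have "t - s < d * n0" using n0 d(1) by (simp add: field_simps)
      also have "\<dots> \<le> d * n" using n d(1) by simp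
      finally show ?thesis using npos by (simp add: field_simps)
    qed
    finally have "dist (?p i) r < d" using i(2) by (auto simp: dist_real_def)
    moreover have "?p i \<in> {s..t}" using st i by (intro grid_point_mem) auto
    ultimately have "dist (h (?p i)) (h r) < e" using r by (intro d(2)) auto
    then show ?thesis unfolding eq by (simp add: dist_norm)
  qed
  then show "\<exists>no. \<forall>n\<ge>no. norm (simple_value n (\<lambda>i. s + (t - s) * (real i / real n)) (\<lambda>i _. h (s + (t - s) * (real i / real n))) r \<omega> - h r) < e"
    by blast
qed

lemma simple_process_mono:
  assumes "simple_process M F t m \<tau> \<xi>" "i \<le> j" "j \<le> m"
  shows "\<tau> i \<le> \<tau> j"
  using assms(2,3)
proof (induction j rule: dec_induct)
  case (step j)
  then have "\<tau> j \<le> \<tau> (Suc j)" using assms(1) by (auto simp: simple_process_def)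
  then show ?case using step by auto
qed simp

lemma simple_process_range:
  assumes "simple_process M F t m \<tau> \<xi>" "i \<le> m"
  shows "\<tau> 0 \<le> \<tau> i" "\<tau> i \<le> \<tau> m" "0 \<le> \<tau> i" "\<tau> i \<le> t"
proof -
  show 1: "\<tau> 0 \<le> \<tau> i" "\<tau> i \<le> \<tau> m"
    using simple_process_mono[OF assms(1)] assms(2) by auto
  show "0 \<le> \<tau> i" "\<tau> i \<le> t" using 1 assms(1) by (auto simp: simple_process_def)
qed

text \<open>Allows processes living before and after a time \<open>s\<close> to be estimated
  separately.\<close>

lemma simple_value_support:
  assumes "simple_process M F t m \<tau> \<xi>"
  shows "r \<le> \<tau> 0 \<Longrightarrow> simple_value m \<tau> \<xi> r \<omega> = 0" "\<tau> m < r \<Longrightarrow> simple_value m \<tau> \<xi> r \<omega> = 0"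
proof -
  show "simple_value m \<tau> \<xi> r \<omega> = 0" if "r \<le> \<tau> 0"
    unfolding simple_value_def
  proof (rule sum.neutral, rule ballI)
    fix i assume "i \<in> {..<m}"
    then have "\<tau> 0 \<le> \<tau> i" using simple_process_range(1)[OF assms, of i] by simp
    then show "indicat_real {\<tau> i<..\<tau> (Suc i)} r *\<^sub>R \<xi> i \<omega> = 0" using that by auto
  qed
  show "simple_value m \<tau> \<xi> r \<omega> = 0" if "\<tau> m < r"
    unfolding simple_value_def
  proof (rule sum.neutral, rule ballI)
    fix i assume "i \<in> {..<m}"
    then have "\<tau> (Suc i) \<le> \<tau> m" using simple_process_range(2)[OF assms, of "Suc i"] by simp
    then show "indicat_real {\<tau> i<..\<tau> (Suc i)} r *\<^sub>R \<xi> i \<omega> = 0" using that by auto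
  qed
qed

context brownian
begin

lemma simple_process_measurable:
  assumes "simple_process M F t m \<tau> \<xi>" "i < m"
  shows "\<xi> i \<in> borel_measurable M"
proof (rule measurable_F_M)
  show "\<xi> i \<in> borel_measurable (F (\<tau> i))" using assms by (simp add: simple_process_def)
qed

lemma simple_value_measurable:
  fixes \<xi> :: "nat \<Rightarrow> 'w \<Rightarrow> 'b::euclidean_space"
  assumes "simple_process M F t m \<tau> \<xi>"
  shows "(\<lambda>p. simple_value m \<tau> \<xi> (snd p) (fst p)) \<in> borel_measurable (M \<Otimes>\<^sub>M lborel)"
  unfolding simple_value_def
proof (rule borel_measurable_sum)
  fix i assume "i \<in> {..<m}"
  then have [measurable]: "\<xi> i \<in> borel_measurable M"
    using simple_process_measurable[OF assms] by simp
  show "(\<lambda>p. indicat_real {\<tau> i<..\<tau> (Suc i)} (snd p) *\<^sub>R \<xi> i (fst p)) \<in> borel_measurable (M \<Otimes>\<^sub>M lborel)"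
    by measurable
qed

lemma simple_integral_measurable:
  fixes \<xi> :: "nat \<Rightarrow> 'w \<Rightarrow> 'b::euclidean_space"
  assumes "simple_process M F t m \<tau> \<xi>"
  shows "simple_integral (B k) m \<tau> \<xi> \<in> borel_measurable M"
  unfolding simple_integral_def[abs_def]
proof (rule borel_measurable_sum)
  fix i assume "i \<in> {..<m}"
  then have "\<xi> i \<in> borel_measurable M" "0 \<le> \<tau> i" "0 \<le> \<tau> (Suc i)"
    using simple_process_measurable[OF assms] simple_process_range(3)[OF assms] by auto
  then show "(\<lambda>\<omega>. (B k (\<tau> (Suc i)) \<omega> - B k (\<tau> i) \<omega>) *\<^sub>R \<xi> i \<omega>) \<in> borel_measurable M"
    by (intro borel_measurable_scaleR borel_measurable_diff measurable_B_M)
qed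

text \<open>The three processes become one family indexed by a disjoint sum, with the minus signs
  moved into the values. Three of them occur below: an approximation of the integral up to
  \<open>t\<close>, one up to \<open>s\<close>, and one on the interval in between.\<close>

lemma simple_integral_diff_isometry:
  fixes \<xi>1 \<xi>2 \<xi>3 :: "nat \<Rightarrow> 'w \<Rightarrow> 'b::euclidean_space"
  assumes 1: "simple_process M F t m1 \<tau>1 \<xi>1" and 2: "simple_process M F t m2 \<tau>2 \<xi>2"
    and 3: "simple_process M F t m3 \<tau>3 \<xi>3"
  shows "L2sq M (\<lambda>\<omega>. simple_integral (B k) m1 \<tau>1 \<xi>1 \<omega> - simple_integral (B k) m2 \<tau>2 \<xi>2 \<omega>
        - simple_integral (B k) m3 \<tau>3 \<xi>3 \<omega>)
    = (\<integral>\<^sup>+ \<omega>. (\<integral>\<^sup>+ s\<in>{0..t}. ennreal ((norm (simple_value m1 \<tau>1 \<xi>1 s \<omega> - simple_value m2 \<tau>2 \<xi>2 s \<omega>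
        - simple_value m3 \<tau>3 \<xi>3 s \<omega>))\<^sup>2) \<partial>lborel) \<partial>M)"
proof -
  define I where "I = ({..<m1} <+> {..<m2}) <+> {..<m3}"
  define a where "a = case_sum (case_sum \<tau>1 \<tau>2) \<tau>3"
  define b where "b = case_sum (case_sum (\<lambda>i. \<tau>1 (Suc i)) (\<lambda>i. \<tau>2 (Suc i))) (\<lambda>i. \<tau>3 (Suc i))"
  define \<xi> where "\<xi> = case_sum (case_sum \<xi>1 (\<lambda>i \<omega>. - \<xi>2 i \<omega>)) (\<lambda>i \<omega>. - \<xi>3 i \<omega>)"
  have ab: "0 \<le> a i \<and> a i \<le> b i \<and> b i \<le> t" if "i \<in> I" for i
    using that simple_process_range[OF 1] simple_process_range[OF 2] simple_process_range[OF 3] 1 2 3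
    by (auto simp: I_def a_def b_def simple_process_def)
  have \<xi>: "\<xi> i \<in> borel_measurable (F (a i))" "bounded (\<xi> i ` space M)" if "i \<in> I" for i
    using that 1 2 3 by (auto simp: I_def \<xi>_def a_def simple_process_def bounded_iff)
  have eqI: "(\<Sum>i\<in>I. (B k (b i) \<omega> - B k (a i) \<omega>) *\<^sub>R \<xi> i \<omega>) = simple_integral (B k) m1 \<tau>1 \<xi>1 \<omega>
      - simple_integral (B k) m2 \<tau>2 \<xi>2 \<omega> - simple_integral (B k) m3 \<tau>3 \<xi>3 \<omega>" for \<omega>
    by (simp add: I_def sum.Plus a_def b_def \<xi>_def simple_integral_def sum_negf)
  have eqV: "(\<Sum>i\<in>I. indicator {a i<..b i} s *\<^sub>R \<xi> i \<omega>) = simple_value m1 \<tau>1 \<xi>1 s \<omega>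
      - simple_value m2 \<tau>2 \<xi>2 s \<omega> - simple_value m3 \<tau>3 \<xi>3 s \<omega>" for s \<omega>
    by (simp only: I_def sum.Plus finite_Plus finite_lessThan a_def b_def \<xi>_def simple_value_def
        o_def sum.case scaleR_minus_right sum_negf diff_conv_add_uminus)
  have "finite I" by (simp add: I_def)
  from simple_family_isometry[of I a b t \<xi> k, OF this ab \<xi>] show ?thesis
    unfolding eqI eqV .
qed

text \<open>The integrand is only known to be jointly measurable on \<open>[0, t]\<close>, hence the clamped time.\<close>

lemma ito_integrand_measurable:
  fixes H :: "real \<Rightarrow> 'w \<Rightarrow> 'b::euclidean_space"
  assumes "has_ito_integral M F W t H I" "0 \<le> t"
  shows "(\<lambda>p. H (max 0 (min (snd p) t)) (fst p)) \<in> borel_measurable (M \<Otimes>\<^sub>M lborel)"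
proof -
  have "(\<lambda>r. max 0 (min r t)) \<in> measurable borel (restrict_space borel {0..t})"
    using assms(2) by (intro measurable_restrict_space2) auto
  then have "(\<lambda>p. (max 0 (min (snd p) t), fst p)) \<in> measurable (M \<Otimes>\<^sub>M lborel) (restrict_space borel {0..t} \<Otimes>\<^sub>M M)"
    by (intro measurable_Pair measurable_fst measurable_compose[OF measurable_snd]) simp_all
  moreover have "(\<lambda>(s, \<omega>). H s \<omega>) \<in> borel_measurable (restrict_space borel {0..t} \<Otimes>\<^sub>M M)"
    using assms(1) by (auto simp: has_ito_integral_def)
  ultimately show ?thesis using measurable_compose by fastforce
qed

text \<open>The definition of the integral supplies unrelated approximating sequences up to
  \<open>t\<close> and up to \<open>s\<close>, so additivity in time has to be derived. Both are
  compared with a simple process starting at \<open>s\<close>: up to \<open>s\<close> this process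
  vanishes and both approximants follow \<open>H\<close>; after \<open>s\<close> the second
  approximant vanishes. The constant 6 is 3, from splitting a square into three terms, times 2, from
  a pointwise splitting into two.\<close>

lemma ito_increment_simple_error:
  fixes H :: "real \<Rightarrow> 'w \<Rightarrow> 'b::euclidean_space"
  assumes I: "has_ito_integral M F (B k) t H I" and J: "has_ito_integral M F (B k) s H J"
    and st: "0 \<le> s" "s < t"
    and D: "simple_process M F t m \<tau> \<xi>" "s \<le> \<tau> 0"
  shows "L2sq M (\<lambda>\<omega>. I \<omega> - J \<omega> - simple_integral (B k) m \<tau> \<xi> \<omega>)
    \<le> 6 * (\<integral>\<^sup>+ \<omega>. (\<integral>\<^sup>+ r\<in>{s<..t}. ennreal ((norm (H r \<omega> - simple_value m \<tau> \<xi> r \<omega>))\<^sup>2) \<partial>lborel) \<partial>M)"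
proof -
  let ?E = "\<lambda>e :: 'w \<times> real \<Rightarrow> ennreal. \<integral>\<^sup>+ \<omega>. (\<integral>\<^sup>+ r. e (\<omega>, r) \<partial>lborel) \<partial>M"
  obtain m1 \<tau>1 \<xi>1 where S1: "\<And>j. simple_process M F t (m1 j) (\<tau>1 j) (\<xi>1 j)"
    and L1: "(\<lambda>j. \<integral>\<^sup>+ \<omega>. (\<integral>\<^sup>+ s\<in>{0..t}.
         ennreal ((norm (H s \<omega> - simple_value (m1 j) (\<tau>1 j) (\<xi>1 j) s \<omega>))\<^sup>2) \<partial>lborel) \<partial>M) \<longlonglongrightarrow> 0"
    and I1: "(\<lambda>j. L2sq M (\<lambda>\<omega>. I \<omega> - simple_integral (B k) (m1 j) (\<tau>1 j) (\<xi>1 j) \<omega>)) \<longlonglongrightarrow> 0"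
    using I unfolding has_ito_integral_def by blast
  obtain m2 \<tau>2 \<xi>2 where S2: "\<And>j. simple_process M F s (m2 j) (\<tau>2 j) (\<xi>2 j)"
    and L2: "(\<lambda>j. \<integral>\<^sup>+ \<omega>. (\<integral>\<^sup>+ r\<in>{0..s}.
         ennreal ((norm (H r \<omega> - simple_value (m2 j) (\<tau>2 j) (\<xi>2 j) r \<omega>))\<^sup>2) \<partial>lborel) \<partial>M) \<longlonglongrightarrow> 0"
    and I2: "(\<lambda>j. L2sq M (\<lambda>\<omega>. J \<omega> - simple_integral (B k) (m2 j) (\<tau>2 j) (\<xi>2 j) \<omega>)) \<longlonglongrightarrow> 0"
    using J unfolding has_ito_integral_def by blast
  have S2t: "simple_process M F t (m2 j) (\<tau>2 j) (\<xi>2 j)" for j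
    using S2[of j] st by (auto simp: simple_process_def)
  have [measurable]: "I \<in> borel_measurable M" "J \<in> borel_measurable M"
    using I J by (auto simp: has_ito_integral_def)
  have [measurable]: "simple_integral (B k) (m1 j) (\<tau>1 j) (\<xi>1 j) \<in> borel_measurable M"
    "simple_integral (B k) (m2 j) (\<tau>2 j) (\<xi>2 j) \<in> borel_measurable M"
    "simple_integral (B k) m \<tau> \<xi> \<in> borel_measurable M" for j
    by (rule simple_integral_measurable[OF S1], rule simple_integral_measurable[OF S2], rule simple_integral_measurable[OF D(1)])
  have [measurable]: "(\<lambda>p. simple_value (m1 j) (\<tau>1 j) (\<xi>1 j) (snd p) (fst p)) \<in> borel_measurable (M \<Otimes>\<^sub>M lborel)"
    "(\<lambda>p. simple_value (m2 j) (\<tau>2 j) (\<xi>2 j) (snd p) (fst p)) \<in> borel_measurable (M \<Otimes>\<^sub>M lborel)"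
    "(\<lambda>p. simple_value m \<tau> \<xi> (snd p) (fst p)) \<in> borel_measurable (M \<Otimes>\<^sub>M lborel)" for j
    by (rule simple_value_measurable[OF S1], rule simple_value_measurable[OF S2], rule simple_value_measurable[OF D(1)])
  define cl where "cl r = max 0 (min r t)" for r
  have [measurable]: "(\<lambda>p. H (cl (snd p)) (fst p)) \<in> borel_measurable (M \<Otimes>\<^sub>M lborel)"
    unfolding cl_def using st by (intro ito_integrand_measurable[OF I]) auto
  define e1 where "e1 j p = ennreal ((norm (H (cl (snd p)) (fst p) - simple_value (m1 j) (\<tau>1 j) (\<xi>1 j) (snd p) (fst p)))\<^sup>2) * indicator {0..t} (snd p)" for j p
  define e2 where "e2 j p = ennreal ((norm (H (cl (snd p)) (fst p) - simple_value (m2 j) (\<tau>2 j) (\<xi>2 j) (snd p) (fst p)))\<^sup>2) * indicator {0..s} (snd p)" for j p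
  define e3 where "e3 p = ennreal ((norm (H (cl (snd p)) (fst p) - simple_value m \<tau> \<xi> (snd p) (fst p)))\<^sup>2) * indicator {s<..t} (snd p)" for p
  have em [measurable]: "e1 j \<in> borel_measurable (M \<Otimes>\<^sub>M lborel)" "e2 j \<in> borel_measurable (M \<Otimes>\<^sub>M lborel)"
    "e3 \<in> borel_measurable (M \<Otimes>\<^sub>M lborel)" for j
    unfolding e1_def[abs_def] e2_def[abs_def] e3_def[abs_def] by measurable
  have E1: "?E (e1 j)
      = (\<integral>\<^sup>+ \<omega>. (\<integral>\<^sup>+ s\<in>{0..t}. ennreal ((norm (H s \<omega> - simple_value (m1 j) (\<tau>1 j) (\<xi>1 j) s \<omega>))\<^sup>2) \<partial>lborel) \<partial>M)" for j
    unfolding e1_def by (intro nn_integral_cong) (auto simp: cl_def indicator_def)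
  have E2: "?E (e2 j)
      = (\<integral>\<^sup>+ \<omega>. (\<integral>\<^sup>+ r\<in>{0..s}. ennreal ((norm (H r \<omega> - simple_value (m2 j) (\<tau>2 j) (\<xi>2 j) r \<omega>))\<^sup>2) \<partial>lborel) \<partial>M)" for j
    unfolding e2_def using st by (intro nn_integral_cong) (auto simp: cl_def indicator_def)
  have E3: "?E e3
      = (\<integral>\<^sup>+ \<omega>. (\<integral>\<^sup>+ r\<in>{s<..t}. ennreal ((norm (H r \<omega> - simple_value m \<tau> \<xi> r \<omega>))\<^sup>2) \<partial>lborel) \<partial>M)"
    unfolding e3_def using st by (intro nn_integral_cong) (auto simp: cl_def indicator_def)
  have pw: "ennreal ((norm (simple_value (m1 j) (\<tau>1 j) (\<xi>1 j) r \<omega> - simple_value (m2 j) (\<tau>2 j) (\<xi>2 j) r \<omega>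
        - simple_value m \<tau> \<xi> r \<omega>))\<^sup>2) * indicator {0..t} r \<le> 2 * e1 j (\<omega>, r) + 2 * e2 j (\<omega>, r) + 2 * e3 (\<omega>, r)" for j r \<omega>
  proof -
    let ?S1 = "simple_value (m1 j) (\<tau>1 j) (\<xi>1 j) r \<omega>" and ?S2 = "simple_value (m2 j) (\<tau>2 j) (\<xi>2 j) r \<omega>"
      and ?S3 = "simple_value m \<tau> \<xi> r \<omega>" and ?h = "H (cl r) \<omega>"
    consider "r \<in> {0..s}" | "r \<in> {s<..t}" | "r \<notin> {0..t}" by fastforce
    then show ?thesis
    proof cases
      case 1
      then have "?S3 = 0" using simple_value_support(1)[OF D(1), of r \<omega>] D(2) by simp
      moreover have "ennreal ((norm (?S1 - ?S2))\<^sup>2) \<le> ennreal (2 * (norm (?h - ?S1))\<^sup>2 + 2 * (norm (?h - ?S2))\<^sup>2)"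
        using norm_diff_squared_le[of "?h - ?S2" "?h - ?S1"] by (intro ennreal_leI) (simp add: algebra_simps)
      ultimately show ?thesis using 1 st
        by (simp add: e1_def e2_def e3_def ennreal_mult)
    next
      case 2
      then have "?S2 = 0" using simple_value_support(2)[OF S2, of j r \<omega>] S2[of j] by (auto simp: simple_process_def)
      moreover have "ennreal ((norm (?S1 - ?S3))\<^sup>2) \<le> ennreal (2 * (norm (?h - ?S1))\<^sup>2 + 2 * (norm (?h - ?S3))\<^sup>2)"
        using norm_diff_squared_le[of "?h - ?S3" "?h - ?S1"] by (intro ennreal_leI) (simp add: algebra_simps)
      ultimately show ?thesis using 2 st
        by (simp add: e1_def e2_def e3_def ennreal_mult)
    qed simp
  qed
  have step: "L2sq M (\<lambda>\<omega>. I \<omega> - J \<omega> - simple_integral (B k) m \<tau> \<xi> \<omega>)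
      \<le> 3 * L2sq M (\<lambda>\<omega>. I \<omega> - simple_integral (B k) (m1 j) (\<tau>1 j) (\<xi>1 j) \<omega>)
       + 3 * L2sq M (\<lambda>\<omega>. J \<omega> - simple_integral (B k) (m2 j) (\<tau>2 j) (\<xi>2 j) \<omega>)
       + 3 * (2 * ?E (e1 j) + 2 * ?E (e2 j) + 2 * ?E e3)" for j
  proof -
    let ?I1 = "simple_integral (B k) (m1 j) (\<tau>1 j) (\<xi>1 j)" and ?I2 = "simple_integral (B k) (m2 j) (\<tau>2 j) (\<xi>2 j)"
      and ?I3 = "simple_integral (B k) m \<tau> \<xi>"
    have tri: "ennreal ((norm (I \<omega> - J \<omega> - ?I3 \<omega>))\<^sup>2) \<le> 3 * ennreal ((norm (I \<omega> - ?I1 \<omega>))\<^sup>2)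
        + 3 * ennreal ((norm (J \<omega> - ?I2 \<omega>))\<^sup>2) + 3 * ennreal ((norm (?I1 \<omega> - ?I2 \<omega> - ?I3 \<omega>))\<^sup>2)" for \<omega>
    proof -
      let ?f = "\<lambda>i::nat. if i = 0 then I \<omega> - ?I1 \<omega> else if i = 1 then - (J \<omega> - ?I2 \<omega>) else ?I1 \<omega> - ?I2 \<omega> - ?I3 \<omega>"
      have "(norm (I \<omega> - J \<omega> - ?I3 \<omega>))\<^sup>2 \<le> 3 * (norm (I \<omega> - ?I1 \<omega>))\<^sup>2
        + 3 * (norm (J \<omega> - ?I2 \<omega>))\<^sup>2 + 3 * (norm (?I1 \<omega> - ?I2 \<omega> - ?I3 \<omega>))\<^sup>2"
        using norm_sum_squared_le[of ?f "{..<3}"]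
        by (simp add: numeral_3_eq_3 lessThan_Suc algebra_simps norm_minus_commute[of "J \<omega>"])
      then show ?thesis
        by (simp add: ennreal_mult[symmetric] ennreal_plus[symmetric] ennreal_leI del: ennreal_plus flip: ennreal_numeral)
    qed
    have "L2sq M (\<lambda>\<omega>. ?I1 \<omega> - ?I2 \<omega> - ?I3 \<omega>)
        \<le> (\<integral>\<^sup>+ \<omega>. (\<integral>\<^sup>+ r. 2 * e1 j (\<omega>, r) + 2 * e2 j (\<omega>, r) + 2 * e3 (\<omega>, r) \<partial>lborel) \<partial>M)"
      unfolding simple_integral_diff_isometry[OF S1 S2t D(1)] by (intro nn_integral_mono pw)
    also have "\<dots> = 2 * ?E (e1 j) + 2 * ?E (e2 j) + 2 * ?E e3"
    proof -
      have "(\<integral>\<^sup>+ \<omega>. (\<integral>\<^sup>+ r. 2 * e1 j (\<omega>, r) + 2 * e2 j (\<omega>, r) + 2 * e3 (\<omega>, r) \<partial>lborel) \<partial>M)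
        = (\<integral>\<^sup>+ \<omega>. 2 * (\<integral>\<^sup>+ r. e1 j (\<omega>, r) \<partial>lborel) + 2 * (\<integral>\<^sup>+ r. e2 j (\<omega>, r) \<partial>lborel)
            + 2 * (\<integral>\<^sup>+ r. e3 (\<omega>, r) \<partial>lborel) \<partial>M)"
      proof (rule nn_integral_cong)
        fix \<omega> assume \<omega>: "\<omega> \<in> space M"
        have [measurable]: "(\<lambda>r. e1 j (\<omega>, r)) \<in> borel_measurable lborel"
          "(\<lambda>r. e2 j (\<omega>, r)) \<in> borel_measurable lborel" "(\<lambda>r. e3 (\<omega>, r)) \<in> borel_measurable lborel"
          by (rule measurable_Pair2[OF em(1) \<omega>], rule measurable_Pair2[OF em(2) \<omega>], rule measurable_Pair2[OF em(3) \<omega>])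
        show "(\<integral>\<^sup>+ r. 2 * e1 j (\<omega>, r) + 2 * e2 j (\<omega>, r) + 2 * e3 (\<omega>, r) \<partial>lborel)
          = 2 * (\<integral>\<^sup>+ r. e1 j (\<omega>, r) \<partial>lborel) + 2 * (\<integral>\<^sup>+ r. e2 j (\<omega>, r) \<partial>lborel)
            + 2 * (\<integral>\<^sup>+ r. e3 (\<omega>, r) \<partial>lborel)"
          by (simp add: nn_integral_add nn_integral_cmult)
      qed
      also have "\<dots> = 2 * ?E (e1 j) + 2 * ?E (e2 j) + 2 * ?E e3"
      proof -
        have [measurable]: "(\<lambda>\<omega>. \<integral>\<^sup>+ r. e1 j (\<omega>, r) \<partial>lborel) \<in> borel_measurable M"
          "(\<lambda>\<omega>. \<integral>\<^sup>+ r. e2 j (\<omega>, r) \<partial>lborel) \<in> borel_measurable M"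
          "(\<lambda>\<omega>. \<integral>\<^sup>+ r. e3 (\<omega>, r) \<partial>lborel) \<in> borel_measurable M"
          by (rule lborel.borel_measurable_nn_integral_fst[OF em(1)], rule lborel.borel_measurable_nn_integral_fst[OF em(2)],
              rule lborel.borel_measurable_nn_integral_fst[OF em(3)])
        show ?thesis by (simp add: nn_integral_add nn_integral_cmult)
      qed
      finally show ?thesis .
    qed
    finally have iso: "L2sq M (\<lambda>\<omega>. ?I1 \<omega> - ?I2 \<omega> - ?I3 \<omega>) \<le> \<dots>" .
    have "L2sq M (\<lambda>\<omega>. I \<omega> - J \<omega> - ?I3 \<omega>)
      \<le> (\<integral>\<^sup>+ \<omega>. 3 * ennreal ((norm (I \<omega> - ?I1 \<omega>))\<^sup>2)
        + 3 * ennreal ((norm (J \<omega> - ?I2 \<omega>))\<^sup>2) + 3 * ennreal ((norm (?I1 \<omega> - ?I2 \<omega> - ?I3 \<omega>))\<^sup>2) \<partial>M)"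
      by (intro nn_integral_mono tri)
    also have "\<dots> = 3 * L2sq M (\<lambda>\<omega>. I \<omega> - ?I1 \<omega>)
        + 3 * L2sq M (\<lambda>\<omega>. J \<omega> - ?I2 \<omega>) + 3 * L2sq M (\<lambda>\<omega>. ?I1 \<omega> - ?I2 \<omega> - ?I3 \<omega>)"
      by (simp add: nn_integral_add nn_integral_cmult)
    also have "\<dots> \<le> 3 * L2sq M (\<lambda>\<omega>. I \<omega> - ?I1 \<omega>)
        + 3 * L2sq M (\<lambda>\<omega>. J \<omega> - ?I2 \<omega>)
        + 3 * (2 * ?E (e1 j) + 2 * ?E (e2 j) + 2 * ?E e3)"
      by (intro add_left_mono mult_left_mono iso) simp
    finally show ?thesis .
  qed
  \<comment> \<open>As \<open>j\<close> grows, the errors of both approximating sequences vanish and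
    only the error \<open>e3\<close> of the given simple process survives.\<close>
  have "(\<lambda>j. 3 * L2sq M (\<lambda>\<omega>. I \<omega> - simple_integral (B k) (m1 j) (\<tau>1 j) (\<xi>1 j) \<omega>)
       + 3 * L2sq M (\<lambda>\<omega>. J \<omega> - simple_integral (B k) (m2 j) (\<tau>2 j) (\<xi>2 j) \<omega>)
       + 3 * (2 * ?E (e1 j) + 2 * ?E (e2 j)
         + 2 * ?E e3)) \<longlonglongrightarrow> 3 * 0 + 3 * 0 + 3 * (2 * 0 + 2 * 0 + 2 * ?E e3)"
    unfolding E1 E2 by (intro tendsto_add ennreal_tendsto_cmult tendsto_const I1 I2 L1 L2) (simp_all)
  then have "L2sq M (\<lambda>\<omega>. I \<omega> - J \<omega> - simple_integral (B k) m \<tau> \<xi> \<omega>)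
      \<le> 3 * 0 + 3 * 0 + 3 * (2 * 0 + 2 * 0 + 2 * ?E e3)"
    by (rule LIMSEQ_le_const) (use step in blast)
  also have "\<dots> = 6 * ?E e3" by (simp add: mult.assoc[symmetric])
  finally show ?thesis unfolding E3 .
qed


text \<open>For a bounded integrand with continuous paths the left-point values on an equidistant
  grid are themselves admissible simple processes. This replaces the unspecified sequence in the
  definition of the integral by a concrete one. Dominated convergence is applied twice, in time and
  in \<omega>.\<close>

lemma ito_increment_riemann:
  fixes H :: "real \<Rightarrow> 'w \<Rightarrow> 'b::euclidean_space"
  assumes I: "has_ito_integral M F (B k) t H I" and J: "has_ito_integral M F (B k) s H J"
    and st: "0 \<le> s" "s < t"
    and cont: "\<And>\<omega>. \<omega> \<in> space M \<Longrightarrow> continuous_on {0..} (\<lambda>r. H r \<omega>)"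
    and bd: "\<And>r \<omega>. 0 \<le> r \<Longrightarrow> \<omega> \<in> space M \<Longrightarrow> norm (H r \<omega>) \<le> K"
  defines "p \<equiv> \<lambda>n i. s + (t - s) * (real i / real n)"
  shows "(\<lambda>n. L2sq M (\<lambda>\<omega>. (\<Sum>i<n. (B k (p n (Suc i)) \<omega> - B k (p n i) \<omega>) *\<^sub>R H (p n i) \<omega>) - (I \<omega> - J \<omega>))) \<longlonglongrightarrow> 0"
proof -
  let ?E = "\<lambda>e :: 'w \<times> real \<Rightarrow> ennreal. \<integral>\<^sup>+ \<omega>. (\<integral>\<^sup>+ r. e (\<omega>, r) \<partial>lborel) \<partial>M"
  define \<xi> where "\<xi> n i = H (p n i)" for n i
  define S where "S n p = simple_value n (\<lambda>i. s + (t - s) * (real i / real n)) (\<xi> n) (snd p) (fst p)" for n and p :: "'w \<times> real"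
  have pmem: "p n i \<in> {s..t}" if "i \<le> n" "0 < n" for n i
    unfolding p_def using that st by (intro grid_point_mem) auto
  have Hm: "H r \<in> borel_measurable (F r)" if "0 \<le> r" "r \<le> t" for r
    using I that by (auto simp: has_ito_integral_def)
  have simple: "simple_process M F t n (p n) (\<xi> n)" if "0 < n" for n
    unfolding simple_process_def
  proof (intro conjI allI impI)
    show "0 \<le> p n 0" "p n n \<le> t" using pmem[of 0 n] pmem[of n n] that st by auto
    fix i assume "i < n"
    show "p n i \<le> p n (Suc i)" using that st by (simp add: p_def divide_right_mono)
    show "\<xi> n i \<in> borel_measurable (F (p n i))"
      unfolding \<xi>_def using pmem[of i n] \<open>i < n\<close> st by (intro Hm) auto
    show "bounded (\<xi> n i ` space M)"
      using bd pmem[of i n] \<open>i < n\<close> st by (auto simp: bounded_iff \<xi>_def intro!: exI[of _ K])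
  qed
  define cl where "cl r = max 0 (min r t)" for r
  have [measurable]: "(\<lambda>p. H (cl (snd p)) (fst p)) \<in> borel_measurable (M \<Otimes>\<^sub>M lborel)"
    unfolding cl_def using st by (intro ito_integrand_measurable[OF I]) auto
  have S [measurable]: "S (Suc n) \<in> borel_measurable (M \<Otimes>\<^sub>M lborel)" for n
    unfolding S_def[abs_def] using simple_value_measurable[OF simple[of "Suc n"]] by (simp add: p_def del: of_nat_Suc)
  \<comment> \<open>Indexed by \<open>Suc n\<close> because the grid needs at least one
    cell.\<close>
  define g where "g n p = ennreal ((norm (H (cl (snd p)) (fst p) - S (Suc n) p))\<^sup>2) * indicator {s<..t} (snd p)" for n p
  have g [measurable]: "g n \<in> borel_measurable (M \<Otimes>\<^sub>M lborel)" for n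
    unfolding g_def[abs_def] by measurable
  have K: "0 \<le> K" using not_empty bd[of 0] by (meson all_not_in_conv norm_ge_zero order_refl order_trans)
  have gb: "g n (\<omega>, r) \<le> ennreal (4 * K\<^sup>2) * indicator {s<..t} r" if \<omega>: "\<omega> \<in> space M" for n \<omega> r
  proof (cases "r \<in> {s<..t}")
    case True
    obtain i where i: "i < Suc n" and eq: "S (Suc n) (\<omega>, r) = \<xi> (Suc n) i \<omega>"
      using simple_value_grid[of s t r "Suc n", where 'b='b] st True unfolding S_def
      by (metis fst_conv snd_conv greaterThanAtMost_iff zero_less_Suc)
    have "norm (\<xi> (Suc n) i \<omega>) \<le> K" "norm (H (cl r) \<omega>) \<le> K"
      unfolding \<xi>_def using pmem[of i "Suc n"] i st \<omega> by (auto intro!: bd simp: cl_def)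
    then have "(norm (H (cl r) \<omega>))\<^sup>2 \<le> K\<^sup>2" "(norm (\<xi> (Suc n) i \<omega>))\<^sup>2 \<le> K\<^sup>2"
      by (auto intro!: power_mono)
    then have "(norm (H (cl r) \<omega> - \<xi> (Suc n) i \<omega>))\<^sup>2 \<le> 4 * K\<^sup>2"
      using norm_diff_squared_le[of "H (cl r) \<omega>" "\<xi> (Suc n) i \<omega>"] by linarith
    then show ?thesis using True by (simp add: g_def eq ennreal_leI)
  qed (simp add: g_def)
  have glim: "(\<lambda>n. g n (\<omega>, r)) \<longlonglongrightarrow> 0" if \<omega>: "\<omega> \<in> space M" for \<omega> r
  proof (cases "r \<in> {s<..t}")
    case True
    have "continuous_on {s..t} (\<lambda>r. H r \<omega>)"
      by (rule continuous_on_subset[OF cont[OF \<omega>]]) (use st in auto)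
    then have "(\<lambda>n. S n (\<omega>, r)) \<longlonglongrightarrow> H r \<omega>"
      using grid_simple_value_tendsto[of s t "\<lambda>r. H r \<omega>" r \<omega>] st True
      by (simp add: S_def simple_value_def \<xi>_def p_def)
    then have "(\<lambda>n. S (Suc n) (\<omega>, r)) \<longlonglongrightarrow> H r \<omega>" by (rule LIMSEQ_Suc)
    moreover have "cl r = r" using True st by (auto simp: cl_def)
    ultimately have "(\<lambda>n. ennreal ((norm (H (cl r) \<omega> - S (Suc n) (\<omega>, r)))\<^sup>2)) \<longlonglongrightarrow> ennreal ((norm (H r \<omega> - H r \<omega>))\<^sup>2)"
      by (intro tendsto_intros) auto
    then show ?thesis using True by (simp add: g_def)
  qed (simp add: g_def)
  have inner: "(\<lambda>n. \<integral>\<^sup>+ r. g n (\<omega>, r) \<partial>lborel) \<longlonglongrightarrow> 0" if \<omega>: "\<omega> \<in> space M" for \<omega>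
  proof -
    have "(\<lambda>n. \<integral>\<^sup>+ r. g n (\<omega>, r) \<partial>lborel) \<longlonglongrightarrow> (\<integral>\<^sup>+ (r::real). 0 \<partial>lborel)"
    proof (rule nn_integral_dominated_convergence[where w="\<lambda>r. ennreal (4 * K\<^sup>2) * indicator {s<..t} r"])
      show "(\<lambda>r. g n (\<omega>, r)) \<in> borel_measurable lborel" for n
        by (rule measurable_Pair2[OF g \<omega>])
      show "(\<integral>\<^sup>+ r. ennreal (4 * K\<^sup>2) * indicator {s<..t} r \<partial>lborel) < \<infinity>"
        using st by (simp add: nn_integral_cmult ennreal_mult_less_top)
    qed (use gb glim \<omega> in auto)
    then show ?thesis by simp
  qed
  have innerb: "(\<integral>\<^sup>+ r. g n (\<omega>, r) \<partial>lborel) \<le> ennreal (4 * K\<^sup>2) * ennreal (t - s)" if \<omega>: "\<omega> \<in> space M" for n \<omega>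
  proof -
    have "(\<integral>\<^sup>+ r. g n (\<omega>, r) \<partial>lborel) \<le> (\<integral>\<^sup>+ r. ennreal (4 * K\<^sup>2) * indicator {s<..t} r \<partial>lborel)"
      by (intro nn_integral_mono gb \<omega>)
    also have "\<dots> = ennreal (4 * K\<^sup>2) * ennreal (t - s)"
      using st by (subst nn_integral_cmult) auto
    finally show ?thesis .
  qed
  have G: "(\<lambda>n. ?E (g n)) \<longlonglongrightarrow> (\<integral>\<^sup>+ \<omega>. 0 \<partial>M)"
  proof (rule nn_integral_dominated_convergence[where w="\<lambda>\<omega>. ennreal (4 * K\<^sup>2) * ennreal (t - s)"])
    show "(\<lambda>\<omega>. \<integral>\<^sup>+ r. g n (\<omega>, r) \<partial>lborel) \<in> borel_measurable M" for n
      by (rule lborel.borel_measurable_nn_integral_fst[OF g])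
    show "(\<integral>\<^sup>+ \<omega>. ennreal (4 * K\<^sup>2) * ennreal (t - s) \<partial>M) < \<infinity>"
      by (simp add: emeasure_space_1 ennreal_mult_less_top)
  qed (use inner innerb in auto)
  have bound: "L2sq M (\<lambda>\<omega>. (\<Sum>i<Suc n. (B k (p (Suc n) (Suc i)) \<omega> - B k (p (Suc n) i) \<omega>) *\<^sub>R H (p (Suc n) i) \<omega>) - (I \<omega> - J \<omega>))
      \<le> 6 * ?E (g n)" for n
  proof -
    have "s \<le> p (Suc n) 0" using pmem[of 0 "Suc n"] by simp
    then have "L2sq M (\<lambda>\<omega>. I \<omega> - J \<omega> - simple_integral (B k) (Suc n) (p (Suc n)) (\<xi> (Suc n)) \<omega>)
      \<le> 6 * (\<integral>\<^sup>+ \<omega>. (\<integral>\<^sup>+ r\<in>{s<..t}. ennreal ((norm (H r \<omega> - simple_value (Suc n) (p (Suc n)) (\<xi> (Suc n)) r \<omega>))\<^sup>2) \<partial>lborel) \<partial>M)"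
      by (intro ito_increment_simple_error[OF I J st simple]) simp
    also have "(\<integral>\<^sup>+ \<omega>. (\<integral>\<^sup>+ r\<in>{s<..t}. ennreal ((norm (H r \<omega> - simple_value (Suc n) (p (Suc n)) (\<xi> (Suc n)) r \<omega>))\<^sup>2) \<partial>lborel) \<partial>M)
      = ?E (g n)"
      unfolding g_def S_def p_def using st by (intro nn_integral_cong) (auto simp: indicator_def cl_def)
    finally show ?thesis
      by (simp only: simple_integral_def \<xi>_def norm_minus_commute)
  qed
  have "(\<lambda>n. 6 * ?E (g n)) \<longlonglongrightarrow> 6 * 0"
    by (rule ennreal_tendsto_cmult) (use G in auto)
  then have "(\<lambda>n. 6 * ?E (g n)) \<longlonglongrightarrow> 0"
    by simp
  from tendsto_sandwich[OF always_eventually[OF allI[OF zero_le]] always_eventually[OF allI[OF bound]] tendsto_const this]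
  have "(\<lambda>n. L2sq M (\<lambda>\<omega>. (\<Sum>i<Suc n. (B k (p (Suc n) (Suc i)) \<omega> - B k (p (Suc n) i) \<omega>) *\<^sub>R H (p (Suc n) i) \<omega>) - (I \<omega> - J \<omega>))) \<longlonglongrightarrow> 0" .
  then show ?thesis by (rule LIMSEQ_imp_Suc)
qed

end

section \<open>Moments of the solution\<close>

lemma power_div_fact_le_exp:
  fixes z :: real
  assumes "0 \<le> z"
  shows "z ^ n \<le> fact n * exp z"
proof -
  have "(\<Sum>i\<in>{n}. z ^ i /\<^sub>R fact i) \<le> (\<Sum>i. z ^ i /\<^sub>R fact i)"
    by (rule sum_le_suminf) (use assms summable_exp_generic[of z] in auto)
  then have "z ^ n / fact n \<le> exp z" by (simp add: exp_def field_simps)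
  then show ?thesis by (simp add: field_simps)
qed

text \<open>Turns exponential moments of both signs into even moments.\<close>

lemma even_power_le_exp:
  fixes y :: real
  shows "y ^ (2 * m) \<le> fact (2 * m) * (exp y + exp (- y))"
proof -
  have "y ^ (2 * m) = \<bar>y\<bar> ^ (2 * m)" by (simp add: power_even_abs)
  also have "\<dots> \<le> fact (2 * m) * exp \<bar>y\<bar>" by (rule power_div_fact_le_exp) simp
  also have "\<dots> \<le> fact (2 * m) * (exp y + exp (- y))"
    by (intro mult_left_mono) (auto simp: abs_if)
  finally show ?thesis .
qed

lemma norm_power_le_sum_components:
  fixes v :: "real ^ 'n"
  shows "norm v ^ p \<le> real CARD('n) ^ p * (\<Sum>j\<in>UNIV. \<bar>v $ j\<bar> ^ p)"
proof -
  define A where "A = Max (range (\<lambda>j. \<bar>v $ j\<bar>))"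
  have le: "\<bar>v $ j\<bar> \<le> A" for j by (simp add: A_def)
  have "A \<in> range (\<lambda>j. \<bar>v $ j\<bar>)" unfolding A_def by (rule Max_in) auto
  then obtain j where j: "A = \<bar>v $ j\<bar>" by auto
  have "norm v \<le> (\<Sum>j\<in>UNIV. \<bar>v $ j\<bar>)" by (rule norm_le_l1_cart)
  also have "\<dots> \<le> real CARD('n) * A" using sum_bounded_above[of UNIV "\<lambda>j. \<bar>v $ j\<bar>" A] le by simp
  finally have "norm v ^ p \<le> (real CARD('n) * A) ^ p" by (intro power_mono) auto
  also have "\<dots> = real CARD('n) ^ p * \<bar>v $ j\<bar> ^ p" by (simp add: power_mult_distrib j)
  also have "\<dots> \<le> real CARD('n) ^ p * (\<Sum>j\<in>UNIV. \<bar>v $ j\<bar> ^ p)"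
    by (intro mult_left_mono member_le_sum) auto
  finally show ?thesis .
qed

text \<open>The consequences of conditions (A) and (B) on which the estimates rest. The factor 3 in
  \<open>monotone\<close> is what one implicit step consumes: it becomes 6 in the recursion, set
  against a noise term with factor 4 that \<open>1 + 2 * \<mu> * \<delta>\<close> enlarges to at
  most 6.\<close>

locale dissipative_sde = brownian M F B
  for M :: "'w measure" and F :: "real \<Rightarrow> 'w measure" and B :: "'d::finite \<Rightarrow> real \<Rightarrow> 'w \<Rightarrow> real" +
  fixes U0 :: "real ^ 'n \<Rightarrow> real ^ 'n" and V :: "'d \<Rightarrow> real ^ 'n \<Rightarrow> real ^ 'n"
    and \<mu> c1 c2 q K :: real
  assumes cont_U0: "continuous_on UNIV U0" and cont_V: "\<And>k. continuous_on UNIV (V k)"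
    and \<mu>: "\<mu> > 0" and c1: "c1 > 0" and c2: "c2 > 0" and q: "q > 0" and K: "K > 0"
    and monotone: "\<And>a b. (U0 a - U0 b) \<bullet> (a - b) + 3 * (\<Sum>k\<in>UNIV. (norm (V k a - V k b))\<^sup>2) \<le> - \<mu> * (norm (a - b))\<^sup>2"
    and V_lipschitz: "\<And>a b. (\<Sum>k\<in>UNIV. norm (V k a - V k b)) \<le> c1 * norm (a - b)"
    and V_bounded: "\<And>a. (\<Sum>k\<in>UNIV. (norm (V k a))\<^sup>2) \<le> K"
    and U0_growth: "\<And>a b. (norm (U0 a - U0 b))\<^sup>2 \<le> c2 * (1 + norm a powr (2 * q) + norm b powr (2 * q)) * (norm (a - b))\<^sup>2"
begin

abbreviation solves :: "real ^ 'n \<Rightarrow> (real \<Rightarrow> 'w \<Rightarrow> real ^ 'n) \<Rightarrow> bool"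
  where "solves \<equiv> sde_solution M F B U0 V"

lemma dissipative: "(U0 a - U0 b) \<bullet> (a - b) \<le> - \<mu> * (norm (a - b))\<^sup>2"
  using monotone[of a b] sum_nonneg[of UNIV "\<lambda>k. (norm (V k a - V k b))\<^sup>2"] by simp

lemma V_lipschitz_squares: "(\<Sum>k\<in>UNIV. (norm (V k a - V k b))\<^sup>2) \<le> c1\<^sup>2 * (norm (a - b))\<^sup>2"
proof -
  have "(\<Sum>k\<in>UNIV. (norm (V k a - V k b))\<^sup>2) \<le> (\<Sum>k\<in>UNIV. norm (V k a - V k b))\<^sup>2"
    using power_mono[OF L2_set_le_sum[of UNIV "\<lambda>k. norm (V k a - V k b)"], of 2]
    by (simp add: L2_set_def sum_nonneg)
  also have "\<dots> \<le> (c1 * norm (a - b))\<^sup>2"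
    by (intro power_mono V_lipschitz sum_nonneg) auto
  finally show ?thesis by (simp add: power_mult_distrib)
qed

lemma norm_V_le: "norm (V k a) \<le> sqrt K"
proof -
  have "(norm (V k a))\<^sup>2 \<le> (\<Sum>k\<in>UNIV. (norm (V k a))\<^sup>2)" by (intro member_le_sum) auto
  then show ?thesis using V_bounded[of a] by (intro real_le_rsqrt) linarith
qed

lemma measurable_U0: "U0 \<in> borel_measurable borel" and measurable_V: "V k \<in> borel_measurable borel"
  using cont_U0 cont_V by (auto intro: borel_measurable_continuous_onI)

text \<open>Almost surely this is \<open>sqrt 2\<close> times the sum of the stochastic integrals
  over \<open>[s, t]\<close>. Read off from the path of \<open>X\<close>, it is defined everywhere
  and has continuous paths, whereas each stochastic integral is given at a fixed time and up to null
  sets.\<close>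

definition noise :: "(real \<Rightarrow> 'w \<Rightarrow> real ^ 'n) \<Rightarrow> real \<Rightarrow> real \<Rightarrow> 'w \<Rightarrow> real ^ 'n"
  where "noise X s t \<omega> = X t \<omega> - X s \<omega> - integral {s..t} (\<lambda>r. U0 (X r \<omega>))"

definition grid :: "real \<Rightarrow> real \<Rightarrow> nat \<Rightarrow> nat \<Rightarrow> real"
  where "grid s t n i = s + (t - s) * (real i / real n)"

definition riemann_noise :: "(real \<Rightarrow> 'w \<Rightarrow> real ^ 'n) \<Rightarrow> real \<Rightarrow> real \<Rightarrow> nat \<Rightarrow> 'w \<Rightarrow> real ^ 'n"
  where "riemann_noise X s t n \<omega> = (\<Sum>i<n. \<Sum>k\<in>UNIV. dB (grid s t n i) (grid s t n (Suc i)) \<omega> $ k *\<^sub>R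
      (sqrt 2 *\<^sub>R V k (X (grid s t n i) \<omega>)))"

lemma grid_mem: "s \<le> t \<Longrightarrow> i \<le> n \<Longrightarrow> 0 < n \<Longrightarrow> grid s t n i \<in> {s..t}"
  unfolding grid_def by (rule grid_point_mem)

lemma grid_Suc: "0 < n \<Longrightarrow> grid s t n (Suc i) - grid s t n i = (t - s) / real n"
  by (simp add: grid_def field_simps)

lemma grid_mono: "s \<le> t \<Longrightarrow> i \<le> j \<Longrightarrow> grid s t n i \<le> grid s t n j"
  by (simp add: grid_def divide_right_mono mult_left_mono)

section \<open>The noise of a fixed solution\<close>

context
  fixes x X
  assumes sol: "solves x X"
begin

lemma measurable_X: "0 \<le> s \<Longrightarrow> s \<le> t \<Longrightarrow> X s \<in> borel_measurable (F t)"
  using sol measurable_F_mono[of "X s" s borel t] by (auto simp: sde_solution_def adapted_def)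

lemma measurable_X_M: "0 \<le> s \<Longrightarrow> X s \<in> borel_measurable M"
  using measurable_X[of s s] measurable_F_M by blast

lemma cont_X: "\<omega> \<in> space M \<Longrightarrow> 0 \<le> a \<Longrightarrow> continuous_on {a..b} (\<lambda>t. X t \<omega>)"
  using sol by (auto simp: sde_solution_def intro: continuous_on_subset)

lemma cont_U0_X: "\<omega> \<in> space M \<Longrightarrow> 0 \<le> a \<Longrightarrow> continuous_on {a..b} (\<lambda>t. U0 (X t \<omega>))"
  using continuous_on_compose2[OF cont_U0 cont_X] by blast

lemma measurable_noise:
  assumes "0 \<le> s" "s \<le> t"
  shows "noise X s t \<in> borel_measurable (F t)"
  unfolding noise_def using assms
  by (intro borel_measurable_diff measurable_X measurable_integral_paths
      measurable_compose[OF measurable_X measurable_U0] cont_U0_X) auto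

lemma measurable_noise_M: "0 \<le> s \<Longrightarrow> s \<le> t \<Longrightarrow> noise X s t \<in> borel_measurable M"
  by (rule measurable_F_M[OF measurable_noise])

lemma measurable_riemann_noise_M:
  assumes "0 \<le> s" "s \<le> t"
  shows "riemann_noise X s t n \<in> borel_measurable M"
  unfolding riemann_noise_def[abs_def]
proof (rule borel_measurable_sum)
  fix i assume "i \<in> {..<n}"
  then have "0 \<le> grid s t n i" "0 \<le> grid s t n (Suc i)"
    using grid_mem[of s t i n] grid_mem[of s t "Suc i" n] assms by auto
  then show "(\<lambda>\<omega>. \<Sum>k\<in>UNIV. dB (grid s t n i) (grid s t n (Suc i)) \<omega> $ k *\<^sub>R
      (sqrt 2 *\<^sub>R V k (X (grid s t n i) \<omega>))) \<in> borel_measurable M"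
    unfolding dB_nth
    by (intro borel_measurable_sum borel_measurable_scaleR borel_measurable_diff measurable_B_M
        borel_measurable_const measurable_compose[OF measurable_X_M measurable_V])
qed

text \<open>Subtracting the equations at \<open>t\<close> and at \<open>s\<close> identifies the
  noise almost surely with increments of the stochastic integrals, to which
  \<open>ito_increment_riemann\<close> applies for each \<open>k\<close>.\<close>

lemma riemann_noise_tendsto:
  assumes st: "0 \<le> s" "s < t"
  shows "(\<lambda>n. L2sq M (\<lambda>\<omega>. riemann_noise X s t n \<omega> - noise X s t \<omega>)) \<longlonglongrightarrow> 0"
proof -
  obtain I where I: "\<And>k. has_ito_integral M F (B k) t (\<lambda>s \<omega>. V k (X s \<omega>)) (I k)"
    and XI: "AE \<omega> in M. X t \<omega> = x + integral {0..t} (\<lambda>s. U0 (X s \<omega>)) + sqrt 2 *\<^sub>R (\<Sum>k\<in>UNIV. I k \<omega>)"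
    using sol st unfolding sde_solution_def by (meson less_imp_le order_trans)
  obtain J where J: "\<And>k. has_ito_integral M F (B k) s (\<lambda>s \<omega>. V k (X s \<omega>)) (J k)"
    and XJ: "AE \<omega> in M. X s \<omega> = x + integral {0..s} (\<lambda>s. U0 (X s \<omega>)) + sqrt 2 *\<^sub>R (\<Sum>k\<in>UNIV. J k \<omega>)"
    using sol st unfolding sde_solution_def by meson
  have [measurable]: "I k \<in> borel_measurable M" "J k \<in> borel_measurable M" for k
    using I[of k] J[of k] by (auto simp: has_ito_integral_def)
  define R where "R k n \<omega> = (\<Sum>i<n. (B k (grid s t n (Suc i)) \<omega> - B k (grid s t n i) \<omega>) *\<^sub>R V k (X (grid s t n i) \<omega>))" for k n \<omega>
  have R: "(\<lambda>n. L2sq M (\<lambda>\<omega>. R k n \<omega> - (I k \<omega> - J k \<omega>))) \<longlonglongrightarrow> 0" for k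
    unfolding R_def grid_def
  proof (rule ito_increment_riemann[OF I J st])
    show "continuous_on {0..} (\<lambda>r. V k (X r \<omega>))" if "\<omega> \<in> space M" for \<omega>
      using sol that by (intro continuous_on_compose2[OF cont_V]) (auto simp: sde_solution_def)
    show "norm (V k (X r \<omega>)) \<le> sqrt K" for r \<omega> by (rule norm_V_le)
  qed
  have [measurable]: "R k n \<in> borel_measurable M" for k n
    unfolding R_def[abs_def]
  proof (rule borel_measurable_sum)
    fix i assume "i \<in> {..<n}"
    then have "0 \<le> grid s t n i" "0 \<le> grid s t n (Suc i)"
      using grid_mem[of s t i n] grid_mem[of s t "Suc i" n] st by auto
    then show "(\<lambda>\<omega>. (B k (grid s t n (Suc i)) \<omega> - B k (grid s t n i) \<omega>) *\<^sub>R V k (X (grid s t n i) \<omega>)) \<in> borel_measurable M"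
      by (intro borel_measurable_scaleR borel_measurable_diff measurable_B_M
        measurable_compose[OF measurable_X_M measurable_V])
  qed
  have ae: "AE \<omega> in M. noise X s t \<omega> = sqrt 2 *\<^sub>R (\<Sum>k\<in>UNIV. I k \<omega> - J k \<omega>)"
    using XI XJ AE_space
  proof eventually_elim
    case (elim \<omega>)
    have "integral {0..t} (\<lambda>s. U0 (X s \<omega>)) = integral {0..s} (\<lambda>s. U0 (X s \<omega>)) + integral {s..t} (\<lambda>s. U0 (X s \<omega>))"
      using st elim(3) by (intro Henstock_Kurzweil_Integration.integral_combine[symmetric] integrable_continuous_real cont_U0_X) auto
    then have "noise X s t \<omega> = X t \<omega> - X s \<omega> - (integral {0..t} (\<lambda>s. U0 (X s \<omega>)) - integral {0..s} (\<lambda>s. U0 (X s \<omega>)))"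
      by (simp add: noise_def)
    also have "\<dots> = sqrt 2 *\<^sub>R (\<Sum>k\<in>UNIV. I k \<omega>) - sqrt 2 *\<^sub>R (\<Sum>k\<in>UNIV. J k \<omega>)"
      by (subst elim(1), subst elim(2)) (simp add: algebra_simps)
    finally show ?case
      by (simp add: sum_subtractf scaleR_diff_right)
  qed
  have riem: "riemann_noise X s t n \<omega> = sqrt 2 *\<^sub>R (\<Sum>k\<in>UNIV. R k n \<omega>)" for n \<omega>
    unfolding riemann_noise_def R_def
    by (subst sum.swap) (simp add: scaleR_sum_right scaleR_left_commute mult.commute)
  \<comment> \<open>The constant collects the squared \<open>sqrt 2\<close> and Cauchy-Schwarz over
    the driving motions.\<close>
  have bound: "L2sq M (\<lambda>\<omega>. riemann_noise X s t n \<omega> - noise X s t \<omega>)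
      \<le> ennreal (2 * CARD('d)) * (\<Sum>k\<in>UNIV. L2sq M (\<lambda>\<omega>. R k n \<omega> - (I k \<omega> - J k \<omega>)))" for n
  proof -
    have "L2sq M (\<lambda>\<omega>. riemann_noise X s t n \<omega> - noise X s t \<omega>)
      \<le> (\<integral>\<^sup>+ \<omega>. ennreal (2 * CARD('d)) * (\<Sum>k\<in>UNIV. ennreal ((norm (R k n \<omega> - (I k \<omega> - J k \<omega>)))\<^sup>2)) \<partial>M)"
    proof (rule nn_integral_mono_AE)
      show "AE \<omega> in M. ennreal ((norm (riemann_noise X s t n \<omega> - noise X s t \<omega>))\<^sup>2)
        \<le> ennreal (2 * CARD('d)) * (\<Sum>k\<in>UNIV. ennreal ((norm (R k n \<omega> - (I k \<omega> - J k \<omega>)))\<^sup>2))"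
        using ae
      proof eventually_elim
        case (elim \<omega>)
        have "riemann_noise X s t n \<omega> - noise X s t \<omega> = sqrt 2 *\<^sub>R (\<Sum>k\<in>UNIV. R k n \<omega> - (I k \<omega> - J k \<omega>))"
          by (simp add: riem elim scaleR_diff_right sum_subtractf)
        then have "(norm (riemann_noise X s t n \<omega> - noise X s t \<omega>))\<^sup>2 = 2 * (norm (\<Sum>k\<in>UNIV. R k n \<omega> - (I k \<omega> - J k \<omega>)))\<^sup>2"
          by (simp add: power_mult_distrib)
        also have "\<dots> \<le> 2 * (CARD('d) * (\<Sum>k\<in>UNIV. (norm (R k n \<omega> - (I k \<omega> - J k \<omega>)))\<^sup>2))"
          by (intro mult_left_mono norm_sum_squared_le) simp
        finally show ?case
          by (simp add: ennreal_mult[symmetric] sum_nonneg ennreal_leI mult.assoc)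
      qed
    qed
    also have "\<dots> = ennreal (2 * CARD('d)) * (\<Sum>k\<in>UNIV. L2sq M (\<lambda>\<omega>. R k n \<omega> - (I k \<omega> - J k \<omega>)))"
      by (simp add: nn_integral_cmult nn_integral_sum del: sum_ennreal)
    finally show ?thesis .
  qed
  have "(\<lambda>n. ennreal (2 * CARD('d)) * (\<Sum>k\<in>UNIV. L2sq M (\<lambda>\<omega>. R k n \<omega> - (I k \<omega> - J k \<omega>))))
      \<longlonglongrightarrow> ennreal (2 * CARD('d)) * (\<Sum>k\<in>(UNIV::'d set). 0)"
    by (intro ennreal_tendsto_cmult tendsto_sum R) simp
  then have "(\<lambda>n. ennreal (2 * CARD('d)) * (\<Sum>k\<in>UNIV. L2sq M (\<lambda>\<omega>. R k n \<omega> - (I k \<omega> - J k \<omega>))))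
      \<longlonglongrightarrow> 0" by simp
  from tendsto_sandwich[OF always_eventually[OF allI[OF zero_le]] always_eventually[OF allI[OF bound]] tendsto_const this]
  show ?thesis .
qed

text \<open>Integrating out the last increment costs the factor
  \<open>exp (h / 2 * (\<Sum>k\<in>UNIV. (c m k \<omega>)\<^sup>2))\<close>, which boundedness of
  \<open>V\<close> makes at most the deterministic \<open>exp (h * (l\<^sup>2 * K))\<close>; the
  squared \<open>sqrt 2\<close> cancels the Gaussian one half. Induction over the cells multiplies
  these factors.\<close>

lemma riemann_noise_exp_moment:
  assumes st: "0 \<le> s" "s < t" and n: "0 < n" and e: "norm e = 1"
  shows "(\<integral>\<^sup>+ \<omega>. ennreal (exp (l * (riemann_noise X s t n \<omega> \<bullet> e))) \<partial>M) \<le> ennreal (exp (l\<^sup>2 * K * (t - s)))"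
proof -
  let ?p = "grid s t n"
  define h where "h = (t - s) / real n"
  have h: "h > 0" using st n by (simp add: h_def)
  define c where "c i k \<omega> = l * (sqrt 2 *\<^sub>R V k (X (?p i) \<omega>) \<bullet> e)" for i k \<omega>
  define P where "P m \<omega> = (\<Sum>i<m. \<Sum>k\<in>UNIV. dB (?p i) (?p (Suc i)) \<omega> $ k * c i k \<omega>)" for m \<omega>
  have p0: "0 \<le> ?p i" if "i \<le> n" for i
    using grid_mem[of s t i n] that n st by auto
  have pS: "?p i < ?p (Suc i)" "?p (Suc i) - ?p i = h" for i
    using grid_Suc[OF n, of s t i] h by (auto simp: h_def)
  have cm: "c i k \<in> borel_measurable (F r)" if "i \<le> n" "?p i \<le> r" for i k r
    unfolding c_def[abs_def] using that p0
    by (intro borel_measurable_times borel_measurable_inner borel_measurable_scaleR borel_measurable_const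
        measurable_compose[OF measurable_X measurable_V]) auto
  have Pm: "P m \<in> borel_measurable (F (?p m))" if "m \<le> n" for m
    unfolding P_def[abs_def]
  proof (rule borel_measurable_sum)
    fix i assume i: "i \<in> {..<m}"
    then have "?p i \<le> ?p m" "?p (Suc i) \<le> ?p m" using st by (auto intro!: grid_mono)
    then show "(\<lambda>\<omega>. \<Sum>k\<in>UNIV. dB (?p i) (?p (Suc i)) \<omega> $ k * c i k \<omega>) \<in> borel_measurable (F (?p m))"
      unfolding dB_nth using i that p0
      by (intro borel_measurable_sum borel_measurable_times borel_measurable_diff measurable_B cm) auto
  qed
  have cs: "h / 2 * (\<Sum>k\<in>UNIV. (c i k \<omega>)\<^sup>2) \<le> h * (l\<^sup>2 * K)" for i \<omega>
  proof -
    have "(\<Sum>k\<in>UNIV. (c i k \<omega>)\<^sup>2) \<le> (\<Sum>k\<in>UNIV. 2 * l\<^sup>2 * (norm (V k (X (?p i) \<omega>)))\<^sup>2)"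
    proof (rule sum_mono)
      fix k
      have "(V k (X (?p i) \<omega>) \<bullet> e)\<^sup>2 \<le> (norm (V k (X (?p i) \<omega>)))\<^sup>2"
        using power_mono[OF Cauchy_Schwarz_ineq2[of "V k (X (?p i) \<omega>)" e], of 2] e by simp
      then show "(c i k \<omega>)\<^sup>2 \<le> 2 * l\<^sup>2 * (norm (V k (X (?p i) \<omega>)))\<^sup>2"
        by (simp add: c_def power_mult_distrib mult_left_mono)
    qed
    also have "\<dots> \<le> 2 * l\<^sup>2 * K"
      unfolding sum_distrib_left[symmetric] by (intro mult_left_mono V_bounded) simp
    finally have "h / 2 * (\<Sum>k\<in>UNIV. (c i k \<omega>)\<^sup>2) \<le> h / 2 * (2 * l\<^sup>2 * K)"
      using h by (intro mult_left_mono) auto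
    then show ?thesis by simp
  qed
  have "(\<integral>\<^sup>+ \<omega>. ennreal (exp (P m \<omega>)) \<partial>M) \<le> ennreal (exp (real m * h * (l\<^sup>2 * K)))" if "m \<le> n" for m
    using that
  proof (induction m)
    case 0
    then show ?case by (simp add: P_def emeasure_space_1)
  next
    case (Suc m)
    have "(\<integral>\<^sup>+ \<omega>. ennreal (exp (P (Suc m) \<omega>)) \<partial>M)
        = (\<integral>\<^sup>+ \<omega>. ennreal (exp (P m \<omega> + (\<Sum>k\<in>UNIV. dB (?p m) (?p (Suc m)) \<omega> $ k * c m k \<omega>))) \<partial>M)"
      by (simp add: P_def)
    also have "\<dots> = (\<integral>\<^sup>+ \<omega>. ennreal (exp (P m \<omega> + h / 2 * (\<Sum>k\<in>UNIV. (c m k \<omega>)\<^sup>2))) \<partial>M)"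
      using Suc.prems pS p0 by (subst nn_integral_increment_exp) (auto intro!: Pm cm)
    also have "\<dots> \<le> (\<integral>\<^sup>+ \<omega>. ennreal (exp (h * (l\<^sup>2 * K))) * ennreal (exp (P m \<omega>)) \<partial>M)"
      using cs[of m] by (intro nn_integral_mono) (simp add: ennreal_mult[symmetric] exp_add[symmetric] ennreal_leI)
    also have "\<dots> = ennreal (exp (h * (l\<^sup>2 * K))) * (\<integral>\<^sup>+ \<omega>. ennreal (exp (P m \<omega>)) \<partial>M)"
      using measurable_F_M[OF Pm[of m]] Suc.prems by (intro nn_integral_cmult) auto
    also have "\<dots> \<le> ennreal (exp (h * (l\<^sup>2 * K))) * ennreal (exp (real m * h * (l\<^sup>2 * K)))"
      using Suc by (intro mult_left_mono) auto
    also have "\<dots> = ennreal (exp (real (Suc m) * h * (l\<^sup>2 * K)))"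
      by (simp add: ennreal_mult[symmetric] exp_add[symmetric] algebra_simps)
    finally show ?case .
  qed
  from this[of n] have "(\<integral>\<^sup>+ \<omega>. ennreal (exp (P n \<omega>)) \<partial>M) \<le> ennreal (exp (l\<^sup>2 * K * (t - s)))"
    using n by (simp add: h_def mult_ac)
  moreover have "P n \<omega> = l * (riemann_noise X s t n \<omega> \<bullet> e)" for \<omega>
    by (simp add: P_def c_def riemann_noise_def inner_sum_left sum_distrib_left mult_ac)
  ultimately show ?thesis by simp
qed

lemma noise_exp_moment:
  assumes st: "0 \<le> s" "s < t" and e: "norm e = 1"
  shows "mean_le M (\<lambda>\<omega>. exp (l * (noise X s t \<omega> \<bullet> e))) (exp (l\<^sup>2 * K * (t - s)))"
proof (rule mean_le_L2_limit[where D="riemann_noise X s t" and \<Phi>="\<lambda>\<omega> y. exp (l * (y \<bullet> e))" and C="\<lambda>_. exp (l\<^sup>2 * K * (t - s))"])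
  have [measurable]: "riemann_noise X s t n \<in> borel_measurable M" "noise X s t \<in> borel_measurable M" for n
    using st by (auto intro: measurable_riemann_noise_M measurable_noise_M)
  show "riemann_noise X s t n \<in> borel_measurable M" "noise X s t \<in> borel_measurable M" for n
    by measurable
  show "(\<lambda>\<omega>. exp (l * (riemann_noise X s t n \<omega> \<bullet> e))) \<in> borel_measurable M" "(\<lambda>\<omega>. exp (l * (noise X s t \<omega> \<bullet> e))) \<in> borel_measurable M" for n
    by measurable
  then show "mean_le M (\<lambda>\<omega>. exp (l * (riemann_noise X s t n \<omega> \<bullet> e))) (exp (l\<^sup>2 * K * (t - s)))" if "1 \<le> n" for n
    using riemann_noise_exp_moment[OF st _ e, of n l] that by (intro mean_le_nn_integralI) auto
qed (use riemann_noise_tendsto[OF st] in \<open>auto intro!: continuous_intros\<close>)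

text \<open>Exponential moments take the role of the Burkholder inequality. Scaling by
  \<open>l\<close> makes the exponential moment at most \<open>exp K\<close> whatever the length of
  the interval, and undoing the scaling in a power \<open>2 * m\<close> brings out
  \<open>(t - s) ^ m\<close>.\<close>

lemma noise_moment:
  assumes st: "0 \<le> s" "s \<le> t" and m: "1 \<le> m"
  shows "mean_le M (\<lambda>\<omega>. norm (noise X s t \<omega>) ^ (2 * m))
    (real CARD('n) ^ (2 * m) * (real CARD('n) * (fact (2 * m) * (2 * exp K))) * (t - s) ^ m)"
proof (cases "s = t")
  case True
  then have "noise X s t \<omega> = 0" for \<omega> by (simp add: noise_def)
  moreover obtain m' where "m = Suc m'" using m by (cases m) auto
  ultimately show ?thesis using True by (simp add: mean_le_const)
next
  case False
  then have st': "s < t" using st by simp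
  have [measurable]: "noise X s t \<in> borel_measurable M"
    using st by (auto intro: measurable_noise_M)
  define l where "l = 1 / sqrt (t - s)"
  have l: "l\<^sup>2 * (t - s) = 1" "l > 0" using st' by (simp_all add: l_def power_divide)
  have comp: "mean_le M (\<lambda>\<omega>. \<bar>noise X s t \<omega> $ j\<bar> ^ (2 * m)) (fact (2 * m) * (2 * exp K) * (t - s) ^ m)" for j
  proof -
    have eq: "noise X s t \<omega> $ j = noise X s t \<omega> \<bullet> axis j 1" for \<omega> by (simp add: inner_axis)
    have ax: "norm (axis j 1 :: real ^ 'n) = 1" by simp
    have "mean_le M (\<lambda>\<omega>. exp (l * (noise X s t \<omega> \<bullet> axis j 1)) + exp (- l * (noise X s t \<omega> \<bullet> axis j 1))) (exp K + exp K)"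
      using noise_exp_moment[OF st(1) st' ax, of l] noise_exp_moment[OF st(1) st' ax, of "- l"] l
      by (intro mean_le_add) (simp_all add: mult.assoc mult.left_commute[of _ K])
    then have "mean_le M (\<lambda>\<omega>. fact (2 * m) * (t - s) ^ m * (exp (l * (noise X s t \<omega> \<bullet> axis j 1)) + exp (- l * (noise X s t \<omega> \<bullet> axis j 1))))
        (fact (2 * m) * (t - s) ^ m * (exp K + exp K))"
      using st' by (intro mean_le_cmult) auto
    then show ?thesis
    proof (rule mean_le_mono)
      show "AE \<omega> in M. \<bar>noise X s t \<omega> $ j\<bar> ^ (2 * m)
          \<le> fact (2 * m) * (t - s) ^ m * (exp (l * (noise X s t \<omega> \<bullet> axis j 1)) + exp (- l * (noise X s t \<omega> \<bullet> axis j 1)))" (is "AE \<omega> in M. ?P \<omega>")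
      proof (rule AE_I2)
        fix \<omega>
        have "\<bar>noise X s t \<omega> $ j\<bar> ^ (2 * m) = (t - s) ^ m * (l * (noise X s t \<omega> \<bullet> axis j 1)) ^ (2 * m)"
        proof -
          have "(t - s) ^ m * l ^ (2 * m) = (l\<^sup>2 * (t - s)) ^ m"
            by (simp add: power_mult_distrib mult.commute flip: power_mult)
          then have "(t - s) ^ m * l ^ (2 * m) = 1" using l by simp
          then show ?thesis by (simp add: power_mult_distrib power_even_abs eq mult.assoc[symmetric])
        qed
        also have "\<dots> \<le> (t - s) ^ m * (fact (2 * m) * (exp (l * (noise X s t \<omega> \<bullet> axis j 1)) + exp (- (l * (noise X s t \<omega> \<bullet> axis j 1)))))"
          using st' by (intro mult_left_mono even_power_le_exp) auto
        finally show "?P \<omega>"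
          by (simp add: mult_ac)
      qed
      show "(\<lambda>\<omega>. \<bar>noise X s t \<omega> $ j\<bar> ^ (2 * m)) \<in> borel_measurable M"
        unfolding eq by measurable
    qed (auto simp: mult_ac)
  qed
  have "mean_le M (\<lambda>\<omega>. real CARD('n) ^ (2 * m) * (\<Sum>j\<in>UNIV. \<bar>noise X s t \<omega> $ j\<bar> ^ (2 * m)))
      (real CARD('n) ^ (2 * m) * (\<Sum>j\<in>(UNIV :: 'n set). fact (2 * m) * (2 * exp K) * (t - s) ^ m))"
    by (intro mean_le_cmult mean_le_sum comp) simp
  then show ?thesis
    by (rule mean_le_mono) (use norm_power_le_sum_components in \<open>auto simp: mult_ac\<close>)
qed

end

end

lemma mean_le_measurable: "mean_le M g C \<Longrightarrow> g \<in> borel_measurable M"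
  by (auto simp: mean_le_def)

text \<open>Decouples powers of the solution at two different times, in place of Hoelder's
  inequality: the larger base takes both exponents.\<close>

lemma powr_mult_le_add:
  fixes a b :: real
  assumes "1 \<le> a" "1 \<le> b" "0 \<le> r" "0 \<le> s"
  shows "a powr r * b powr s \<le> a powr (r + s) + b powr (r + s)"
proof (cases "a \<le> b")
  case True
  then have "a powr r * b powr s \<le> b powr r * b powr s"
    using assms by (intro mult_right_mono powr_mono2) auto
  also have "\<dots> = b powr (r + s)" by (simp add: powr_add)
  finally show ?thesis by (simp add: add_increasing)
next
  case False
  then have "a powr r * b powr s \<le> a powr r * a powr s"
    using assms by (intro mult_left_mono powr_mono2) auto
  also have "\<dots> = a powr (r + s)" by (simp add: powr_add)
  finally show ?thesis by (simp add: add_increasing2)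
qed

lemma one_plus_power_le:
  fixes z :: real
  assumes "0 \<le> z"
  shows "(1 + z) ^ m \<le> 2 ^ m * (1 + z ^ m)"
proof -
  have "(1 + z) ^ m \<le> (2 * max 1 z) ^ m"
    using assms by (intro power_mono) auto
  also have "\<dots> = 2 ^ m * (max 1 z) ^ m" by (simp add: power_mult_distrib)
  also have "\<dots> \<le> 2 ^ m * (1 + z ^ m)"
    using assms by (intro mult_left_mono) (auto simp: max_def)
  finally show ?thesis .
qed

section \<open>Moments of the solution, uniform in time\<close>

context dissipative_sde
begin

text \<open>The base \<open>1 + norm z\<close> is at least 1, so its exponents may be raised
  freely.\<close>

lemma U0_polynomial_growth:
  obtains C where "C > 0" "\<And>z. norm (U0 z) \<le> C * (1 + norm z) powr (q + 1)"
    "\<And>z. (norm (U0 z))\<^sup>2 \<le> C\<^sup>2 * (1 + norm z) powr (2 * q + 2)"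
proof
  let ?C = "norm (U0 0) + sqrt (2 * c2)"
  show "?C > 0" using c2 by (simp add: add_nonneg_pos)
  have bound: "norm (U0 z) \<le> ?C * (1 + norm z) powr (q + 1)" for z
  proof -
    have "norm z powr (2 * q) \<le> (1 + norm z) powr (2 * q)" "1 \<le> (1 + norm z) powr (2 * q)"
      using q by (auto intro!: powr_mono2 ge_one_powr_ge_zero)
    then have "(norm (U0 z - U0 0))\<^sup>2 \<le> c2 * (2 * (1 + norm z) powr (2 * q)) * (1 + norm z)\<^sup>2"
      using c2 q by (intro order_trans[OF U0_growth[of z 0]] mult_mono power_mono) auto
    also have "\<dots> = (sqrt (2 * c2) * (1 + norm z) powr (q + 1))\<^sup>2"
    proof -
      have "((1 + norm z) powr (q + 1))\<^sup>2 = (1 + norm z) powr (2 * q) * (1 + norm z)\<^sup>2"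
      proof -
        have "0 < 1 + norm z" by (simp add: add_pos_nonneg)
        then show ?thesis
          by (simp add: power2_eq_square powr_add[symmetric] powr_mult_base powr_add)
      qed
      then show ?thesis using c2 by (simp add: power_mult_distrib)
    qed
    finally have "norm (U0 z - U0 0) \<le> sqrt (2 * c2) * (1 + norm z) powr (q + 1)"
      by (rule power2_le_imp_le) (use c2 in simp)
    moreover have "norm (U0 z) \<le> norm (U0 0) + norm (U0 z - U0 0)"
      using norm_triangle_ineq[of "U0 0" "U0 z - U0 0"] by simp
    moreover have "norm (U0 0) \<le> norm (U0 0) * (1 + norm z) powr (q + 1)"
      using mult_left_mono[OF ge_one_powr_ge_zero[of "1 + norm z" "q + 1"] norm_ge_zero[of "U0 0"]] q by simp
    ultimately show ?thesis by (simp add: algebra_simps)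
  qed
  show "norm (U0 z) \<le> ?C * (1 + norm z) powr (q + 1)" for z by (rule bound)
  show "(norm (U0 z))\<^sup>2 \<le> ?C\<^sup>2 * (1 + norm z) powr (2 * q + 2)" for z
  proof -
    have "(norm (U0 z))\<^sup>2 \<le> (?C * (1 + norm z) powr (q + 1))\<^sup>2" by (intro power_mono bound) auto
    also have "\<dots> = ?C\<^sup>2 * (1 + norm z) powr (2 * q + 2)"
      unfolding power_mult_distrib by (simp add: power2_eq_square powr_add[symmetric] algebra_simps)
    finally show ?thesis .
  qed
qed

text \<open>Since \<open>V\<close> is bounded, the noise over an interval of length at most 1 has
  moments bounded independently of the starting point, and so has the drift evaluated at the noise.
  For this reason the forcing in the path estimate does not see \<open>x\<close>.\<close>

lemma drift_of_noise_moment: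
  obtains C where "C \<ge> 0" "\<And>x X s u. solves x X \<Longrightarrow> 0 \<le> s \<Longrightarrow> s \<le> u \<Longrightarrow> u \<le> s + 1
    \<Longrightarrow> mean_le M (\<lambda>\<omega>. norm (U0 (noise X s u \<omega>)) ^ (2 * p)) C"
proof -
  obtain A where A: "A > 0" "\<And>z. norm (U0 z) \<le> A * (1 + norm z) powr (q + 1)"
    by (rule U0_polynomial_growth) (rule that)
  \<comment> \<open>Chosen so that the even integer power \<open>2 * m\<close> dominates the real
    exponent \<open>(q + 1) * (2 * p)\<close>; noise moments are available for even
    integers.\<close>
  obtain m0 :: nat where m0: "(q + 1) * (2 * p) \<le> m0" using real_arch_simple by blast
  define m where "m = max 1 m0"
  have m: "(q + 1) * (2 * p) \<le> 2 * m" "1 \<le> m" using m0 by (auto simp: m_def)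
  define D where "D = real CARD('n) ^ (2 * m) * (real CARD('n) * (fact (2 * m) * (2 * exp K)))"
  have D: "D \<ge> 0" by (simp add: D_def)
  have pw: "norm (U0 z) ^ (2 * p) \<le> A ^ (2 * p) * 2 ^ (2 * m) * (1 + norm z ^ (2 * m))" for z
  proof -
    have "norm (U0 z) ^ (2 * p) \<le> (A * (1 + norm z) powr (q + 1)) ^ (2 * p)"
      by (intro power_mono A) auto
    also have "\<dots> = A ^ (2 * p) * (1 + norm z) powr ((q + 1) * (2 * p))"
    proof -
      have "((1 + norm z) powr (q + 1)) ^ (2 * p) = ((1 + norm z) powr (q + 1)) powr (2 * p)"
        by (subst powr_realpow[symmetric]) (auto simp: add_pos_nonneg add_nonneg_eq_0_iff)
      also have "\<dots> = (1 + norm z) powr ((q + 1) * (2 * p))" by (rule powr_powr)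
      finally show ?thesis by (simp add: power_mult_distrib)
    qed
    also have "\<dots> \<le> A ^ (2 * p) * (1 + norm z) powr (2 * m)"
      using A m by (intro mult_left_mono powr_mono) auto
    also have "(1 + norm z) powr (2 * m) = (1 + norm z) ^ (2 * m)"
      using powr_realpow[of "1 + norm z" "2 * m"] by (simp add: add_pos_nonneg)
    also have "A ^ (2 * p) * (1 + norm z) ^ (2 * m) \<le> A ^ (2 * p) * (2 ^ (2 * m) * (1 + norm z ^ (2 * m)))"
      using A by (intro mult_left_mono one_plus_power_le) auto
    finally show ?thesis by (simp add: mult.assoc)
  qed
  show thesis
  proof (rule that)
    show "A ^ (2 * p) * 2 ^ (2 * m) * (1 + D) \<ge> 0" using A D by simp
    fix x X and s u :: real assume sol: "solves x X" and su: "0 \<le> s" "s \<le> u" "u \<le> s + 1"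
    have "mean_le M (\<lambda>\<omega>. norm (noise X s u \<omega>) ^ (2 * m)) D"
    proof (rule mean_le_weaken)
      show "mean_le M (\<lambda>\<omega>. norm (noise X s u \<omega>) ^ (2 * m)) (D * (u - s) ^ m)"
        unfolding D_def by (rule noise_moment[OF sol su(1,2) m(2)])
      have "(u - s) ^ m \<le> 1" using su by (intro power_le_one) auto
      then show "D * (u - s) ^ m \<le> D" using D by (simp add: mult_left_le)
    qed
    then have "mean_le M (\<lambda>\<omega>. A ^ (2 * p) * 2 ^ (2 * m) * (1 + norm (noise X s u \<omega>) ^ (2 * m))) (A ^ (2 * p) * 2 ^ (2 * m) * (1 + D))"
      using A by (intro mean_le_cmult mean_le_add mean_le_const) auto
    then show "mean_le M (\<lambda>\<omega>. norm (U0 (noise X s u \<omega>)) ^ (2 * p)) (A ^ (2 * p) * 2 ^ (2 * m) * (1 + D))"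
    proof (rule mean_le_mono)
      show "(\<lambda>\<omega>. norm (U0 (noise X s u \<omega>)) ^ (2 * p)) \<in> borel_measurable M"
        by (rule borel_measurable_power, rule measurable_compose[OF _ borel_measurable_norm],
            rule measurable_compose[OF measurable_noise_M[OF sol su(1,2)] measurable_U0])
    qed (use pw in auto)
  qed
qed

text \<open>The path bound controls \<open>X\<close> minus its noise, and
  \<open>power_sum_epsilon_bound\<close> adds the noise back. The constant \<open>C\<close> is the
  same for all solutions and all \<open>s\<close>, which permits iteration in time.\<close>

lemma moment_step:
  assumes p: "1 \<le> p"
  obtains C where "C \<ge> 0" "\<And>x X s t y. solves x X \<Longrightarrow> 0 \<le> s \<Longrightarrow> s \<le> t \<Longrightarrow> t \<le> s + 1
    \<Longrightarrow> mean_le M (\<lambda>\<omega>. norm (X s \<omega>) ^ (2 * p)) y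
    \<Longrightarrow> mean_le M (\<lambda>\<omega>. norm (X t \<omega>) ^ (2 * p)) (exp (\<mu> / 4) * exp (- (\<mu> / 2) * (t - s)) * y + C)"
proof -
  obtain E where E: "E \<ge> 0" "\<And>x X s u. solves x X \<Longrightarrow> 0 \<le> s \<Longrightarrow> s \<le> u \<Longrightarrow> u \<le> s + 1
    \<Longrightarrow> mean_le M (\<lambda>\<omega>. norm (U0 (noise X s u \<omega>)) ^ (2 * p)) E"
    using drift_of_noise_moment[of p] by blast
  define A where "A = p * (2 / \<mu>) ^ (p - 1) / \<mu> ^ p"
  have A: "A \<ge> 0" using \<mu> by (simp add: A_def)
  define D where "D = real CARD('n) ^ (2 * p) * (real CARD('n) * (fact (2 * p) * (2 * exp K)))"
  have D: "D \<ge> 0" by (simp add: D_def)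
  \<comment> \<open>The factor \<open>exp (\<mu> / 4)\<close> leaves a contraction by \<open>exp (- \<mu> / 4)\<close> over a unit time step.\<close>
  have "exp (\<mu> / 4) - 1 > 0" "1 \<le> 2 * p" using \<mu> p by auto
  then obtain G where G: "G \<ge> 0"
    "\<And>a b. a \<ge> 0 \<Longrightarrow> b \<ge> 0 \<Longrightarrow> (a + b) ^ (2 * p) \<le> (1 + (exp (\<mu> / 4) - 1)) * a ^ (2 * p) + G * b ^ (2 * p)"
    using power_sum_epsilon_bound[of "exp (\<mu> / 4) - 1" "2 * p"] by blast
  show thesis
  proof (rule that)
    show "exp (\<mu> / 4) * (A * E) + G * D \<ge> 0" using A D E(1) G(1) by simp
    fix x X s t y assume sol: "solves x X" and st: "0 \<le> s" "s \<le> t" "t \<le> s + 1"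
      and y: "mean_le M (\<lambda>\<omega>. norm (X s \<omega>) ^ (2 * p)) y"
    let ?J = "\<lambda>\<omega>. integral {s..t} (\<lambda>u. norm (U0 (noise X s u \<omega>)) ^ (2 * p))"
      and ?N = "noise X s t" and ?c = "exp (- (\<mu> / 2) * (t - s))"
    have contN: "continuous_on {s..t} (\<lambda>u. noise X s u \<omega>)" if "\<omega> \<in> space M" for \<omega>
      unfolding noise_def using st that
      by (intro continuous_intros cont_X[OF sol] indefinite_integral_continuous_1 integrable_continuous_real cont_U0_X[OF sol])
    have noise: "mean_le M (\<lambda>\<omega>. norm (?N \<omega>) ^ (2 * p)) D"
    proof (rule mean_le_weaken)
      show "mean_le M (\<lambda>\<omega>. norm (?N \<omega>) ^ (2 * p)) (D * (t - s) ^ p)"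
        unfolding D_def by (rule noise_moment[OF sol st(1,2) p])
      have "(t - s) ^ p \<le> 1" using st by (intro power_le_one) auto
      then show "D * (t - s) ^ p \<le> D" using D by (simp add: mult_left_le)
    qed
    have "mean_le M (\<lambda>\<omega>. ?J \<omega>) ((t - s) * E)"
    proof (rule mean_le_integral_paths)
      show "continuous_on {s..t} (\<lambda>u. norm (U0 (noise X s u \<omega>)) ^ (2 * p))" if "\<omega> \<in> space M" for \<omega>
        by (intro continuous_intros continuous_on_compose2[OF cont_U0 contN[OF that]]) auto
      show "mean_le M (\<lambda>\<omega>. norm (U0 (noise X s r \<omega>)) ^ (2 * p)) E" if "r \<in> {s..t}" for r
        using E(2)[OF sol] that st by auto
      then show "(\<lambda>\<omega>. norm (U0 (noise X s r \<omega>)) ^ (2 * p)) \<in> borel_measurable M" if "r \<in> {s..t}" for r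
        using that mean_le_measurable by blast
    qed (use st in auto)
    moreover have "(t - s) * E \<le> E" using st E(1) by (simp add: mult_left_le_one_le)
    ultimately have int: "mean_le M (\<lambda>\<omega>. ?J \<omega>) E"
      by (rule mean_le_weaken)
    have "mean_le M (\<lambda>\<omega>. exp (\<mu> / 4) * (?c * norm (X s \<omega>) ^ (2 * p)
          + A * ?J \<omega>) + G * norm (?N \<omega>) ^ (2 * p))
        (exp (\<mu> / 4) * (?c * y + A * E) + G * D)"
      by (intro mean_le_add mean_le_cmult y int noise A G) auto
    then show "mean_le M (\<lambda>\<omega>. norm (X t \<omega>) ^ (2 * p)) (exp (\<mu> / 4) * ?c * y + (exp (\<mu> / 4) * (A * E) + G * D))"
    proof (rule mean_le_mono)
      show "(\<lambda>\<omega>. norm (X t \<omega>) ^ (2 * p)) \<in> borel_measurable M"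
        using measurable_X_M[OF sol, of t] st by (intro borel_measurable_power) auto
      show "AE \<omega> in M. norm (X t \<omega>) ^ (2 * p) \<le> exp (\<mu> / 4) * (?c * norm (X s \<omega>) ^ (2 * p)
          + A * ?J \<omega>) + G * norm (?N \<omega>) ^ (2 * p)" (is "AE \<omega> in M. ?P \<omega>")
      proof (rule AE_I2)
        fix \<omega> assume \<omega>: "\<omega> \<in> space M"
        have "norm (X t \<omega> - ?N \<omega>) ^ (2 * p) \<le> ?c * norm (X s \<omega>) ^ (2 * p)
          + A * ?J \<omega>"
          unfolding noise_def A_def
          by (rule dissipative_path_bound[OF st(2) cont_X[OF sol \<omega> st(1)] cont_U0 \<mu> p dissipative])
        then have 1: "exp (\<mu> / 4) * norm (X t \<omega> - ?N \<omega>) ^ (2 * p) \<le> exp (\<mu> / 4) * (?c * norm (X s \<omega>) ^ (2 * p)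
          + A * ?J \<omega>)"
          by (intro mult_left_mono) auto
        have "norm (X t \<omega>) \<le> norm (X t \<omega> - ?N \<omega>) + norm (?N \<omega>)"
          using norm_triangle_ineq[of "X t \<omega> - ?N \<omega>" "?N \<omega>"] by simp
        then have "norm (X t \<omega>) ^ (2 * p) \<le> (norm (X t \<omega> - ?N \<omega>) + norm (?N \<omega>)) ^ (2 * p)"
          by (intro power_mono) auto
        also have "\<dots> \<le> exp (\<mu> / 4) * norm (X t \<omega> - ?N \<omega>) ^ (2 * p) + G * norm (?N \<omega>) ^ (2 * p)"
          using G(2)[of "norm (X t \<omega> - ?N \<omega>)" "norm (?N \<omega>)"] by simp
        finally show "?P \<omega>"
          using 1 by linarith
      qed
    qed (auto simp: algebra_simps)
  qed
qed

text \<open>Unit steps contract by \<open>\<theta>\<close> and add \<open>C0\<close>, so the bound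
  propagates along the integers; one incomplete step then reaches an arbitrary
  \<open>t\<close>.\<close>

lemma moment_bound:
  assumes p: "1 \<le> p"
  obtains C where "C \<ge> 0" "\<And>x X t. solves x X \<Longrightarrow> 0 \<le> t
    \<Longrightarrow> mean_le M (\<lambda>\<omega>. norm (X t \<omega>) ^ (2 * p)) (C * (1 + norm x ^ (2 * p)))"
proof -
  obtain C0 where C0: "C0 \<ge> 0" and step: "\<And>x X s t y. solves x X \<Longrightarrow> 0 \<le> s \<Longrightarrow> s \<le> t \<Longrightarrow> t \<le> s + 1
    \<Longrightarrow> mean_le M (\<lambda>\<omega>. norm (X s \<omega>) ^ (2 * p)) y
    \<Longrightarrow> mean_le M (\<lambda>\<omega>. norm (X t \<omega>) ^ (2 * p)) (exp (\<mu> / 4) * exp (- (\<mu> / 2) * (t - s)) * y + C0)"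
    using moment_step[OF p] by blast
  define \<theta> where "\<theta> = exp (- \<mu> / 4)"
  have \<theta>: "0 < \<theta>" "\<theta> < 1" using \<mu> by (auto simp: \<theta>_def)
  \<comment> \<open>Fixed point of \<open>y \<mapsto> \<theta> * y + C0\<close>, hence a level that
    every unit step preserves.\<close>
  define L where "L = C0 / (1 - \<theta>)"
  have L: "L \<ge> 0" "\<theta> * L + C0 = L" using C0 \<theta> by (auto simp: L_def field_simps)
  show thesis
  proof (rule that)
    show "exp (\<mu> / 4) * (1 + L) + C0 \<ge> 0" using L C0 by simp
    fix x X and t :: real assume sol: "solves x X" and t: "0 \<le> t"
    have n: "mean_le M (\<lambda>\<omega>. norm (X (real n) \<omega>) ^ (2 * p)) (norm x ^ (2 * p) + L)" for n
    proof (induction n)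
      case 0
      have "mean_le M (\<lambda>_. norm x ^ (2 * p)) (norm x ^ (2 * p) + L)"
        using L by (intro mean_le_const) simp
      then show ?case
      proof (rule mean_le_mono)
        show "(\<lambda>\<omega>. norm (X (real 0) \<omega>) ^ (2 * p)) \<in> borel_measurable M"
          using measurable_X_M[OF sol, of 0] by (intro borel_measurable_power) auto
        have "AE \<omega> in M. X 0 \<omega> = x" using sol by (simp add: sde_solution_def)
        then show "AE \<omega> in M. norm (X (real 0) \<omega>) ^ (2 * p) \<le> norm x ^ (2 * p)" by auto
      qed auto
    next
      case (Suc n)
      have "mean_le M (\<lambda>\<omega>. norm (X (real (Suc n)) \<omega>) ^ (2 * p))
          (exp (\<mu> / 4) * exp (- (\<mu> / 2) * (real (Suc n) - real n)) * (norm x ^ (2 * p) + L) + C0)"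
        by (rule step[OF sol _ _ _ Suc]) auto
      moreover have "exp (\<mu> / 4) * exp (- (\<mu> / 2) * (real (Suc n) - real n)) = \<theta>"
        by (simp add: \<theta>_def exp_add[symmetric])
      moreover have "\<theta> * (norm x ^ (2 * p) + L) + C0 \<le> norm x ^ (2 * p) + L"
        using \<theta> L mult_left_le_one_le[of "norm x ^ (2 * p)" \<theta>] by (simp add: algebra_simps)
      ultimately show ?case by (auto intro: mean_le_weaken)
    qed
    define n where "n = nat \<lfloor>t\<rfloor>"
    have nt: "real n \<le> t" "t \<le> real n + 1" using t by (auto simp: n_def of_nat_nat)
    have "mean_le M (\<lambda>\<omega>. norm (X t \<omega>) ^ (2 * p)) (exp (\<mu> / 4) * exp (- (\<mu> / 2) * (t - real n)) * (norm x ^ (2 * p) + L) + C0)"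
      by (rule step[OF sol _ nt n]) simp
    then show "mean_le M (\<lambda>\<omega>. norm (X t \<omega>) ^ (2 * p)) ((exp (\<mu> / 4) * (1 + L) + C0) * (1 + norm x ^ (2 * p)))"
    proof (rule mean_le_weaken)
      have "exp (\<mu> / 4) * exp (- (\<mu> / 2) * (t - real n)) * (norm x ^ (2 * p) + L) \<le> exp (\<mu> / 4) * 1 * (norm x ^ (2 * p) + L)"
        using \<mu> nt L by (intro mult_right_mono mult_left_mono) auto
      also have "\<dots> \<le> exp (\<mu> / 4) * ((1 + L) * (1 + norm x ^ (2 * p)))"
        using L by (simp add: algebra_simps)
      finally have *: "exp (\<mu> / 4) * exp (- (\<mu> / 2) * (t - real n)) * (norm x ^ (2 * p) + L)
          \<le> exp (\<mu> / 4) * ((1 + L) * (1 + norm x ^ (2 * p)))" .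
      show "exp (\<mu> / 4) * exp (- (\<mu> / 2) * (t - real n)) * (norm x ^ (2 * p) + L) + C0
          \<le> (exp (\<mu> / 4) * (1 + L) + C0) * (1 + norm x ^ (2 * p))"
      proof -
        have "(exp (\<mu> / 4) * (1 + L) + C0) * (1 + norm x ^ (2 * p))
            = exp (\<mu> / 4) * ((1 + L) * (1 + norm x ^ (2 * p))) + C0 + C0 * norm x ^ (2 * p)" by algebra
        moreover have "0 \<le> C0 * norm x ^ (2 * p)" using C0 by simp
        ultimately show ?thesis using * by linarith
      qed
    qed
  qed
qed

text \<open>Real exponents are reached from an even one by scaling: dividing by
  \<open>L = 1 + norm x\<close> first and using \<open>z powr r \<le> 1 + z ^ (2 * p)\<close> for
  the ratio makes the bound grow in \<open>x\<close> with exponent \<open>r\<close> and not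
  \<open>2 * p\<close>.\<close>

lemma moment_powr:
  assumes r: "0 \<le> r"
  obtains C where "C \<ge> 0" "\<And>x X t. solves x X \<Longrightarrow> 0 \<le> t
    \<Longrightarrow> mean_le M (\<lambda>\<omega>. (1 + norm (X t \<omega>)) powr r) (C * (1 + norm x) powr r)"
proof -
  obtain p0 :: nat where p0: "r \<le> p0" using real_arch_simple by blast
  define p where "p = max 1 p0"
  have p: "r \<le> 2 * p" "1 \<le> p" using p0 by (auto simp: p_def)
  obtain C0 where C0: "C0 \<ge> 0" and bd: "\<And>x X t. solves x X \<Longrightarrow> 0 \<le> t
    \<Longrightarrow> mean_le M (\<lambda>\<omega>. norm (X t \<omega>) ^ (2 * p)) (C0 * (1 + norm x ^ (2 * p)))"
    using moment_bound[OF p(2)] by blast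
  define C where "C = 1 + 2 ^ (2 * p) * (1 + 2 * C0)"
  show thesis
  proof (rule that)
    show "C \<ge> 0" using C0 by (simp add: C_def)
    fix x X and t :: real assume sol: "solves x X" and t: "0 \<le> t"
    define L where "L = 1 + norm x"
    have L: "1 \<le> L" by (simp add: L_def)
    have "mean_le M (\<lambda>\<omega>. L powr r * (1 + (1 / L ^ (2 * p)) * (2 ^ (2 * p) * (1 + norm (X t \<omega>) ^ (2 * p)))))
        (L powr r * (1 + (1 / L ^ (2 * p)) * (2 ^ (2 * p) * (1 + C0 * (1 + norm x ^ (2 * p))))))"
      using L by (intro mean_le_cmult mean_le_add mean_le_const bd[OF sol t]) auto
    then show "mean_le M (\<lambda>\<omega>. (1 + norm (X t \<omega>)) powr r) (C * (1 + norm x) powr r)"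
    proof (rule mean_le_mono)
      have [measurable]: "X t \<in> borel_measurable M" by (rule measurable_X_M[OF sol t])
      show "(\<lambda>\<omega>. (1 + norm (X t \<omega>)) powr r) \<in> borel_measurable M" by measurable
      show "AE \<omega> in M. (1 + norm (X t \<omega>)) powr r \<le> L powr r * (1 + (1 / L ^ (2 * p)) * (2 ^ (2 * p) * (1 + norm (X t \<omega>) ^ (2 * p))))" (is "AE \<omega> in M. ?P \<omega>")
      proof (rule AE_I2)
        fix \<omega>
        define z where "z = (1 + norm (X t \<omega>)) / L"
        have z: "0 < z" using L by (simp add: z_def add_pos_nonneg)
        have "z powr r \<le> 1 + z ^ (2 * p)"
        proof (cases "z \<le> 1")
          case True
          then have "z powr r \<le> 1" using z r by (simp add: powr_le1)
          then show ?thesis using z by (simp add: add_increasing2)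
        next
          case False
          then have "z powr r \<le> z powr (2 * p)" using p by (intro powr_mono) auto
          also have "\<dots> = z ^ (2 * p)" using powr_realpow[OF z, of "2 * p"] by simp
          finally show ?thesis by simp
        qed
        also have "z ^ (2 * p) \<le> (1 / L ^ (2 * p)) * (2 ^ (2 * p) * (1 + norm (X t \<omega>) ^ (2 * p)))"
          unfolding z_def power_divide using L one_plus_power_le[of "norm (X t \<omega>)" "2 * p"]
          by (simp add: divide_right_mono)
        finally have "L powr r * z powr r \<le> L powr r * (1 + (1 / L ^ (2 * p)) * (2 ^ (2 * p) * (1 + norm (X t \<omega>) ^ (2 * p))))"
          by (intro mult_left_mono) auto
        moreover have "1 + norm (X t \<omega>) = L * z" using L by (simp add: z_def)
        then have "(1 + norm (X t \<omega>)) powr r = L powr r * z powr r"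
          using L z by (simp add: powr_mult)
        ultimately show "?P \<omega>"
          by simp
      qed
      have "1 + norm x ^ (2 * p) \<le> 2 * L ^ (2 * p)"
      proof -
        have "norm x ^ (2 * p) \<le> L ^ (2 * p)" by (intro power_mono) (auto simp: L_def)
        then show ?thesis using one_le_power[OF L, of "2 * p"] by linarith
      qed
      then have "1 + C0 * (1 + norm x ^ (2 * p)) \<le> 1 * L ^ (2 * p) + C0 * (2 * L ^ (2 * p))"
        using C0 one_le_power[OF L, of "2 * p"] by (intro add_mono mult_left_mono) auto
      then have "(1 + C0 * (1 + norm x ^ (2 * p))) / L ^ (2 * p) \<le> 1 + 2 * C0"
        using L by (simp add: field_simps)
      then have "2 ^ (2 * p) * ((1 + C0 * (1 + norm x ^ (2 * p))) / L ^ (2 * p)) \<le> 2 ^ (2 * p) * (1 + 2 * C0)"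
        by (intro mult_left_mono) auto
      then have "L powr r * (1 + (1 / L ^ (2 * p)) * (2 ^ (2 * p) * (1 + C0 * (1 + norm x ^ (2 * p))))) \<le> L powr r * C"
        by (intro mult_left_mono) (auto simp: C_def)
      then show "L powr r * (1 + (1 / L ^ (2 * p)) * (2 ^ (2 * p) * (1 + C0 * (1 + norm x ^ (2 * p))))) \<le> C * (1 + norm x) powr r"
        by (simp add: L_def mult.commute)
    qed auto
  qed
qed

section \<open>Regularity of the solution over one time step\<close>

lemma U0_growth_powr:
  "(norm (U0 a - U0 b))\<^sup>2 \<le> 2 * c2 * ((1 + norm a) powr (2 * q) + (1 + norm b) powr (2 * q)) * (norm (a - b))\<^sup>2"
proof -
  have z: "norm z powr (2 * q) \<le> (1 + norm z) powr (2 * q)" "1 \<le> (1 + norm z) powr (2 * q)" for z :: "real ^ 'n"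
    using q by (auto intro!: powr_mono2 ge_one_powr_ge_zero)
  have lin: "1 + u + v \<le> 2 * (u' + v')" if "u \<le> u'" "v \<le> v'" "1 \<le> u'" "0 \<le> v'" for u v u' v' :: real
    using add_mono[OF add_mono[OF that(3,1)] that(2)] that(4) by simp
  have "1 + norm a powr (2 * q) + norm b powr (2 * q) \<le> 2 * ((1 + norm a) powr (2 * q) + (1 + norm b) powr (2 * q))"
    by (rule lin[OF z(1) z(1) z(2) powr_ge_zero])
  then have "c2 * (1 + norm a powr (2 * q) + norm b powr (2 * q)) * (norm (a - b))\<^sup>2
      \<le> c2 * (2 * ((1 + norm a) powr (2 * q) + (1 + norm b) powr (2 * q))) * (norm (a - b))\<^sup>2"
    using c2 by (intro mult_right_mono mult_left_mono) auto
  with U0_growth[of a b] show ?thesis by (simp add: mult_ac)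
qed

lemma noise_second_moment:
  obtains C where "C \<ge> 0" "\<And>x X s t. solves x X \<Longrightarrow> 0 \<le> s \<Longrightarrow> s \<le> t
    \<Longrightarrow> mean_le M (\<lambda>\<omega>. (norm (noise X s t \<omega>))\<^sup>2) (C * (t - s))"
proof (rule that)
  show "real CARD('n) ^ (2 * 1) * (real CARD('n) * (fact (2 * 1) * (2 * exp K))) \<ge> 0" by simp
  show "mean_le M (\<lambda>\<omega>. (norm (noise X s t \<omega>))\<^sup>2) (real CARD('n) ^ (2 * 1) * (real CARD('n) * (fact (2 * 1) * (2 * exp K))) * (t - s))"
    if "solves x X" "0 \<le> s" "s \<le> t" for x X s t
    using noise_moment[OF that, of 1] by simp
qed

lemma noise_fourth_moment:
  obtains C where "C \<ge> 0" "\<And>x X s t. solves x X \<Longrightarrow> 0 \<le> s \<Longrightarrow> s \<le> t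
    \<Longrightarrow> mean_le M (\<lambda>\<omega>. norm (noise X s t \<omega>) ^ 4) (C * (t - s)\<^sup>2)"
proof (rule that)
  show "real CARD('n) ^ (2 * 2) * (real CARD('n) * (fact (2 * 2) * (2 * exp K))) \<ge> 0" by simp
  show "mean_le M (\<lambda>\<omega>. norm (noise X s t \<omega>) ^ 4) (real CARD('n) ^ (2 * 2) * (real CARD('n) * (fact (2 * 2) * (2 * exp K))) * (t - s)\<^sup>2)"
    if "solves x X" "0 \<le> s" "s \<le> t" for x X s t
    using noise_moment[OF that, of 2] by simp
qed

text \<open>The noise has mean square of order \<open>t - s\<close>. The drift integral has order
  \<open>(t - s)\<^sup>2\<close>, which is no larger on an interval of length at most 1, but it
  brings in the growth in \<open>x\<close>.\<close>

lemma X_increment: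
  obtains C where "C \<ge> 0" "\<And>x X s t. solves x X \<Longrightarrow> 0 \<le> s \<Longrightarrow> s \<le> t \<Longrightarrow> t \<le> s + 1
    \<Longrightarrow> mean_le M (\<lambda>\<omega>. (norm (X t \<omega> - X s \<omega>))\<^sup>2) (C * (t - s) * (1 + norm x) powr (2 * q + 2))"
proof -
  obtain A where A: "A > 0" and UA: "\<And>z. (norm (U0 z))\<^sup>2 \<le> A\<^sup>2 * (1 + norm z) powr (2 * q + 2)"
    by (rule U0_polynomial_growth) (rule that)
  obtain Cm where Cm: "Cm \<ge> 0" "\<And>x X t. solves x X \<Longrightarrow> 0 \<le> t
    \<Longrightarrow> mean_le M (\<lambda>\<omega>. (1 + norm (X t \<omega>)) powr (2 * q + 2)) (Cm * (1 + norm x) powr (2 * q + 2))"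
    using moment_powr[of "2 * q + 2"] q by auto
  obtain C1 where C1: "C1 \<ge> 0" "\<And>x X s t. solves x X \<Longrightarrow> 0 \<le> s \<Longrightarrow> s \<le> t
    \<Longrightarrow> mean_le M (\<lambda>\<omega>. (norm (noise X s t \<omega>))\<^sup>2) (C1 * (t - s))"
    using noise_second_moment by blast
  show thesis
  proof (rule that)
    show "2 * (A\<^sup>2 * Cm) + 2 * C1 \<ge> 0" using A Cm C1 by simp
    fix x X and s t :: real assume sol: "solves x X" and st: "0 \<le> s" "s \<le> t" "t \<le> s + 1"
    let ?L = "(1 + norm x) powr (2 * q + 2)"
    have L: "1 \<le> ?L" using q by (intro ge_one_powr_ge_zero) auto
    have m: "(\<lambda>\<omega>. U0 (X r \<omega>)) \<in> borel_measurable M" if "r \<in> {s..t}" for r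
      using st that by (intro measurable_compose[OF measurable_X_M[OF sol] measurable_U0]) auto
    have "mean_le M (\<lambda>\<omega>. (norm (integral {s..t} (\<lambda>r. U0 (X r \<omega>))))\<^sup>2) ((t - s)\<^sup>2 * (A\<^sup>2 * (Cm * ?L)))"
    proof (rule mean_le_norm2_integral_paths)
      fix r assume r: "r \<in> {s..t}"
      have "mean_le M (\<lambda>\<omega>. A\<^sup>2 * (1 + norm (X r \<omega>)) powr (2 * q + 2)) (A\<^sup>2 * (Cm * ?L))"
        using r st by (intro mean_le_cmult Cm(2)[OF sol]) auto
      then show "mean_le M (\<lambda>\<omega>. (norm (U0 (X r \<omega>)))\<^sup>2) (A\<^sup>2 * (Cm * ?L))"
        by (rule mean_le_mono) (use UA m[OF r] in auto)
    qed (use st cont_U0_X[OF sol] m in auto)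
    then have "mean_le M (\<lambda>\<omega>. 2 * (norm (integral {s..t} (\<lambda>r. U0 (X r \<omega>))))\<^sup>2 + 2 * (norm (noise X s t \<omega>))\<^sup>2)
        (2 * ((t - s)\<^sup>2 * (A\<^sup>2 * (Cm * ?L))) + 2 * (C1 * (t - s)))"
      using C1(2)[OF sol st(1,2)] by (intro mean_le_add mean_le_cmult) auto
    then show "mean_le M (\<lambda>\<omega>. (norm (X t \<omega> - X s \<omega>))\<^sup>2) ((2 * (A\<^sup>2 * Cm) + 2 * C1) * (t - s) * ?L)"
    proof (rule mean_le_mono)
      show "(\<lambda>\<omega>. (norm (X t \<omega> - X s \<omega>))\<^sup>2) \<in> borel_measurable M"
      proof -
        have [measurable]: "X s \<in> borel_measurable M" "X t \<in> borel_measurable M"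
          using st by (auto intro: measurable_X_M[OF sol])
        show ?thesis by measurable
      qed
      show "AE \<omega> in M. (norm (X t \<omega> - X s \<omega>))\<^sup>2 \<le> 2 * (norm (integral {s..t} (\<lambda>r. U0 (X r \<omega>))))\<^sup>2 + 2 * (norm (noise X s t \<omega>))\<^sup>2" (is "AE \<omega> in M. ?P \<omega>")
      proof (rule AE_I2)
        fix \<omega>
        have "X t \<omega> - X s \<omega> = integral {s..t} (\<lambda>r. U0 (X r \<omega>)) - (- noise X s t \<omega>)"
          by (simp add: noise_def)
        then show "?P \<omega>"
          using norm_diff_squared_le[of "integral {s..t} (\<lambda>r. U0 (X r \<omega>))" "- noise X s t \<omega>"] by simp
      qed
      have "(t - s)\<^sup>2 \<le> (t - s)" using st by (simp add: power2_eq_square mult_left_le)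
      then have "(t - s)\<^sup>2 * (A\<^sup>2 * (Cm * ?L)) \<le> (t - s) * (A\<^sup>2 * (Cm * ?L))"
        using Cm L by (intro mult_right_mono mult_nonneg_nonneg) auto
      moreover have "C1 * (t - s) * 1 \<le> C1 * (t - s) * ?L"
        using C1 st L by (intro mult_left_mono) auto
      ultimately show "2 * ((t - s)\<^sup>2 * (A\<^sup>2 * (Cm * ?L))) + 2 * (C1 * (t - s)) \<le> (2 * (A\<^sup>2 * Cm) + 2 * C1) * (t - s) * ?L"
        by (simp add: algebra_simps)
    qed auto
  qed
qed

text \<open>The local Lipschitz factor \<open>G\<close> of the drift is random and correlated with
  the increment of \<open>X\<close>. In the drift part \<open>sqrt (G \<omega>)\<close> is pulled
  inside the time integral, where the exponents \<open>2 * q\<close> and \<open>2 * q + 2\<close>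
  add up; in the noise part Young's inequality separates \<open>G\<close> from the noise.\<close>

lemma drift_increment:
  obtains C where "C \<ge> 0" "\<And>x X s t. solves x X \<Longrightarrow> 0 \<le> s \<Longrightarrow> s \<le> t \<Longrightarrow> t \<le> s + 1
    \<Longrightarrow> mean_le M (\<lambda>\<omega>. (norm (U0 (X s \<omega>) - U0 (X t \<omega>)))\<^sup>2) (C * (t - s) * (1 + norm x) powr (4 * q + 2))"
proof -
  obtain A where A: "A > 0" and UA: "\<And>z. (norm (U0 z))\<^sup>2 \<le> A\<^sup>2 * (1 + norm z) powr (2 * q + 2)"
    by (rule U0_polynomial_growth) (rule that)
  obtain Cm where Cm: "Cm \<ge> 0" "\<And>x X t. solves x X \<Longrightarrow> 0 \<le> t
    \<Longrightarrow> mean_le M (\<lambda>\<omega>. (1 + norm (X t \<omega>)) powr (4 * q + 2)) (Cm * (1 + norm x) powr (4 * q + 2))"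
    using moment_powr[of "4 * q + 2"] q by auto
  obtain Cn where Cn: "Cn \<ge> 0" "\<And>x X t. solves x X \<Longrightarrow> 0 \<le> t
    \<Longrightarrow> mean_le M (\<lambda>\<omega>. (1 + norm (X t \<omega>)) powr (4 * q)) (Cn * (1 + norm x) powr (4 * q))"
    using moment_powr[of "4 * q"] q by auto
  obtain C4 where C4: "C4 \<ge> 0" "\<And>x X s t. solves x X \<Longrightarrow> 0 \<le> s \<Longrightarrow> s \<le> t
    \<Longrightarrow> mean_le M (\<lambda>\<omega>. norm (noise X s t \<omega>) ^ 4) (C4 * (t - s)\<^sup>2)"
    using noise_fourth_moment by blast
  show thesis
  proof (rule that)
    show "2 * c2 * (2 * (A\<^sup>2 * (4 * Cm)) + (4 * Cn + C4)) \<ge> 0" using c2 Cm Cn C4 by simp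
    fix x X and s t :: real assume sol: "solves x X" and st: "0 \<le> s" "s \<le> t" "t \<le> s + 1"
    let ?L = "(1 + norm x) powr (4 * q + 2)"
    have L: "1 \<le> ?L" using q by (intro ge_one_powr_ge_zero) auto
    have L': "(1 + norm x) powr (4 * q) \<le> ?L" by (intro powr_mono) auto
    show "mean_le M (\<lambda>\<omega>. (norm (U0 (X s \<omega>) - U0 (X t \<omega>)))\<^sup>2) (2 * c2 * (2 * (A\<^sup>2 * (4 * Cm)) + (4 * Cn + C4)) * (t - s) * ?L)"
    proof (cases "s = t")
      case True
      then show ?thesis by (simp add: mean_le_const)
    next
      case False
      define h where "h = t - s"
      have h: "0 < h" "h \<le> 1" using False st by (auto simp: h_def)
      have Xm [measurable]: "X r \<in> borel_measurable M" if "r \<in> {s..t}" for r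
        using st that by (intro measurable_X_M[OF sol]) auto
      have [measurable]: "X s \<in> borel_measurable M" "X t \<in> borel_measurable M" using st by (auto intro: Xm)
      have [measurable]: "noise X s t \<in> borel_measurable M" by (rule measurable_noise_M[OF sol st(1,2)])
      have Um [measurable]: "(\<lambda>\<omega>. U0 (X r \<omega>)) \<in> borel_measurable M" if "r \<in> {s..t}" for r
        using that by (intro measurable_compose[OF Xm measurable_U0])
      have [measurable]: "(\<lambda>\<omega>. U0 (X s \<omega>)) \<in> borel_measurable M" "(\<lambda>\<omega>. U0 (X t \<omega>)) \<in> borel_measurable M" using st by (auto intro: Um)
      define G where "G \<omega> = (1 + norm (X s \<omega>)) powr (2 * q) + (1 + norm (X t \<omega>)) powr (2 * q)" for \<omega>
      let ?J = "\<lambda>\<omega>. integral {s..t} (\<lambda>r. sqrt (G \<omega>) *\<^sub>R U0 (X r \<omega>))"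
        and ?N = "noise X s t" and ?m = "\<lambda>r \<omega>. (1 + norm (X r \<omega>)) powr (4 * q + 2)"
      have G0: "0 \<le> G \<omega>" for \<omega> by (simp add: G_def)
      have [measurable]: "G \<in> borel_measurable M" unfolding G_def[abs_def] by measurable
      have T1: "mean_le M (\<lambda>\<omega>. (norm (?J \<omega>))\<^sup>2) ((t - s)\<^sup>2 * (A\<^sup>2 * (4 * (Cm * ?L))))"
      proof (rule mean_le_norm2_integral_paths)
        fix r assume r: "r \<in> {s..t}"
        have [measurable]: "(\<lambda>\<omega>. U0 (X r \<omega>)) \<in> borel_measurable M" by (rule Um[OF r])
        show mr: "(\<lambda>\<omega>. sqrt (G \<omega>) *\<^sub>R U0 (X r \<omega>)) \<in> borel_measurable M" by measurable
        have "mean_le M (\<lambda>\<omega>. A\<^sup>2 * ((?m s \<omega> + ?m r \<omega>)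
              + (?m t \<omega> + ?m r \<omega>)))
            (A\<^sup>2 * ((Cm * ?L + Cm * ?L) + (Cm * ?L + Cm * ?L)))"
          using r st by (intro mean_le_cmult mean_le_add Cm(2)[OF sol]) auto
        then show "mean_le M (\<lambda>\<omega>. (norm (sqrt (G \<omega>) *\<^sub>R U0 (X r \<omega>)))\<^sup>2) (A\<^sup>2 * (4 * (Cm * ?L)))"
        proof (rule mean_le_mono)
          show "AE \<omega> in M. (norm (sqrt (G \<omega>) *\<^sub>R U0 (X r \<omega>)))\<^sup>2
            \<le> A\<^sup>2 * ((?m s \<omega> + ?m r \<omega>)
              + (?m t \<omega> + ?m r \<omega>))" (is "AE \<omega> in M. ?P \<omega>")
          proof (rule AE_I2)
            fix \<omega>
            have y: "(1 + norm a) powr (2 * q) * (1 + norm b) powr (2 * q + 2)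
                \<le> (1 + norm a) powr (4 * q + 2) + (1 + norm b) powr (4 * q + 2)" for a b :: "real ^ 'n"
              using powr_mult_le_add[of "1 + norm a" "1 + norm b" "2 * q" "2 * q + 2"] q by simp
            have "(norm (sqrt (G \<omega>) *\<^sub>R U0 (X r \<omega>)))\<^sup>2 = G \<omega> * (norm (U0 (X r \<omega>)))\<^sup>2"
              using G0[of \<omega>] by (simp add: power_mult_distrib)
            also have "\<dots> \<le> G \<omega> * (A\<^sup>2 * (1 + norm (X r \<omega>)) powr (2 * q + 2))"
              by (intro mult_left_mono UA G0)
            also have "\<dots> = A\<^sup>2 * ((1 + norm (X s \<omega>)) powr (2 * q) * (1 + norm (X r \<omega>)) powr (2 * q + 2)
                + (1 + norm (X t \<omega>)) powr (2 * q) * (1 + norm (X r \<omega>)) powr (2 * q + 2))"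
              by (simp add: G_def algebra_simps)
            also have "\<dots> \<le> A\<^sup>2 * ((?m s \<omega> + ?m r \<omega>)
              + (?m t \<omega> + ?m r \<omega>))"
              by (intro mult_left_mono add_mono y) auto
            finally show "?P \<omega>" .
          qed
        qed (use mr in auto)
      qed (use st cont_U0_X[OF sol] in \<open>auto intro!: continuous_intros\<close>)
      have "mean_le M (\<lambda>\<omega>. h * (2 * (1 + norm (X s \<omega>)) powr (4 * q) + 2 * (1 + norm (X t \<omega>)) powr (4 * q))
            + (1 / h) * norm (?N \<omega>) ^ 4)
          (h * (2 * (Cn * (1 + norm x) powr (4 * q)) + 2 * (Cn * (1 + norm x) powr (4 * q))) + (1 / h) * (C4 * (t - s)\<^sup>2))"
        using st h by (intro mean_le_add mean_le_cmult Cn(2)[OF sol] C4(2)[OF sol]) auto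
      then have T2: "mean_le M (\<lambda>\<omega>. 2 * (G \<omega> * (norm (?N \<omega>))\<^sup>2)) (h * ((4 * Cn + C4) * ?L))"
      proof (rule mean_le_mono)
        show "AE \<omega> in M. 2 * (G \<omega> * (norm (?N \<omega>))\<^sup>2) \<le> h * (2 * (1 + norm (X s \<omega>)) powr (4 * q) + 2 * (1 + norm (X t \<omega>)) powr (4 * q))
            + (1 / h) * norm (?N \<omega>) ^ 4"
        proof (rule AE_I2)
          fix \<omega>
          let ?n = "(norm (?N \<omega>))\<^sup>2"
          have sq: "((1 + norm z) powr (2 * q))\<^sup>2 = (1 + norm z) powr (4 * q)" for z :: "real ^ 'n"
            by (simp add: power2_eq_square powr_add[symmetric])
          \<comment> \<open>The weight \<open>h\<close> balances the two terms: the fourth moment of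
            the noise is of order \<open>h\<^sup>2\<close>, so dividing it by \<open>h\<close>
            leaves order \<open>h\<close>, as for \<open>h * (G \<omega>)\<^sup>2\<close>.\<close>
          have "2 * (G \<omega> * ?n) \<le> h * (G \<omega>)\<^sup>2 + (1 / h) * ?n\<^sup>2"
            using sum_squares_bound[of "sqrt h * G \<omega>" "?n / sqrt h"] h
            by (simp add: power_mult_distrib power_divide)
          also have "?n\<^sup>2 = norm (?N \<omega>) ^ 4" by simp
          also have "(G \<omega>)\<^sup>2 \<le> 2 * (1 + norm (X s \<omega>)) powr (4 * q) + 2 * (1 + norm (X t \<omega>)) powr (4 * q)"
            using sum_squares_bound[of "(1 + norm (X s \<omega>)) powr (2 * q)" "(1 + norm (X t \<omega>)) powr (2 * q)"]
            unfolding G_def power2_sum sq by linarith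
          finally show "2 * (G \<omega> * ?n) \<le> h * (2 * (1 + norm (X s \<omega>)) powr (4 * q) + 2 * (1 + norm (X t \<omega>)) powr (4 * q))
            + (1 / h) * norm (?N \<omega>) ^ 4"
            using h by (simp add: mult_left_mono)
        qed
        have "Cn * (1 + norm x) powr (4 * q) \<le> Cn * ?L" using Cn L' by (intro mult_left_mono) auto
        moreover have "C4 * 1 \<le> C4 * ?L" using C4(1) L by (intro mult_left_mono) auto
        ultimately have "4 * (Cn * (1 + norm x) powr (4 * q)) + C4 * 1 \<le> 4 * (Cn * ?L) + C4 * ?L"
          by simp
        then have "h * (4 * (Cn * (1 + norm x) powr (4 * q)) + C4 * 1) \<le> h * (4 * (Cn * ?L) + C4 * ?L)"
          using h by (intro mult_left_mono) auto
        then show "h * (2 * (Cn * (1 + norm x) powr (4 * q)) + 2 * (Cn * (1 + norm x) powr (4 * q))) + (1 / h) * (C4 * (t - s)\<^sup>2)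
            \<le> h * ((4 * Cn + C4) * ?L)"
          unfolding h_def[symmetric] using h by (simp add: power2_eq_square algebra_simps)
      qed (use G0 in auto)
      have "mean_le M (\<lambda>\<omega>. 2 * c2 * (2 * (norm (?J \<omega>))\<^sup>2
            + 2 * (G \<omega> * (norm (?N \<omega>))\<^sup>2)))
          (2 * c2 * (2 * ((t - s)\<^sup>2 * (A\<^sup>2 * (4 * (Cm * ?L)))) + h * ((4 * Cn + C4) * ?L)))"
        using c2 by (intro mean_le_cmult mean_le_add T1 T2) auto
      then show ?thesis
      proof (rule mean_le_mono)
        show "AE \<omega> in M. (norm (U0 (X s \<omega>) - U0 (X t \<omega>)))\<^sup>2
          \<le> 2 * c2 * (2 * (norm (?J \<omega>))\<^sup>2
            + 2 * (G \<omega> * (norm (?N \<omega>))\<^sup>2))" (is "AE \<omega> in M. ?P \<omega>")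
        proof (rule AE_I2)
          fix \<omega>
          let ?I = "integral {s..t} (\<lambda>r. U0 (X r \<omega>))"
          have "X s \<omega> - X t \<omega> = - ?N \<omega> - ?I" by (simp add: noise_def)
          then have "(norm (X s \<omega> - X t \<omega>))\<^sup>2 \<le> 2 * (norm ?I)\<^sup>2 + 2 * (norm (?N \<omega>))\<^sup>2"
            using norm_diff_squared_le[of "- ?N \<omega>" ?I] by simp
          then have "2 * c2 * G \<omega> * (norm (X s \<omega> - X t \<omega>))\<^sup>2 \<le> 2 * c2 * G \<omega> * (2 * (norm ?I)\<^sup>2 + 2 * (norm (?N \<omega>))\<^sup>2)"
            using c2 G0 by (intro mult_left_mono) auto
          moreover have "(norm (U0 (X s \<omega>) - U0 (X t \<omega>)))\<^sup>2 \<le> 2 * c2 * G \<omega> * (norm (X s \<omega> - X t \<omega>))\<^sup>2"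
            unfolding G_def by (rule U0_growth_powr)
          moreover have eq: "(norm (?J \<omega>))\<^sup>2 = G \<omega> * (norm ?I)\<^sup>2"
            using G0[of \<omega>] by (simp add: power_mult_distrib)
          ultimately show "?P \<omega>"
            unfolding eq by (simp add: algebra_simps)
        qed
        have "h\<^sup>2 \<le> h" using h by (simp add: power2_eq_square mult_left_le)
        then have "h\<^sup>2 * (A\<^sup>2 * (4 * (Cm * ?L))) \<le> h * (A\<^sup>2 * (4 * (Cm * ?L)))"
          using Cm L by (intro mult_right_mono mult_nonneg_nonneg) auto
        then have "2 * c2 * (2 * (h\<^sup>2 * (A\<^sup>2 * (4 * (Cm * ?L)))) + h * ((4 * Cn + C4) * ?L))
            \<le> 2 * c2 * (2 * (h * (A\<^sup>2 * (4 * (Cm * ?L)))) + h * ((4 * Cn + C4) * ?L))"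
          by (rule mult_left_mono[OF add_right_mono[OF mult_left_mono]]) (use c2 in auto)
        also have "\<dots> = 2 * c2 * (2 * (A\<^sup>2 * (4 * Cm)) + (4 * Cn + C4)) * h * ?L" by algebra
        finally show "2 * c2 * (2 * ((t - s)\<^sup>2 * (A\<^sup>2 * (4 * (Cm * ?L)))) + h * ((4 * Cn + C4) * ?L))
            \<le> 2 * c2 * (2 * (A\<^sup>2 * (4 * Cm)) + (4 * Cn + C4)) * (t - s) * ?L"
          unfolding h_def .
      qed auto
    qed
  qed
qed

text \<open>On a grid refining \<open>[s, t]\<close>, the noise and the Euler noise are left-point
  sums over the same increments, so second moments add up cell by cell without mixed terms. The
  factor 4 is the squared \<open>sqrt 2\<close> times 2 from passing through
  \<open>V k (X s \<omega>)\<close>; the second half of that splitting costs the Lipschitz constant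
  and the one-step bound \<open>c\<close>.\<close>

lemma martingale_step:
  assumes sol: "solves x X" and st: "0 \<le> s" "s < t"
    and \<phi>: "\<phi> \<in> borel_measurable (F s)" and Y: "Y \<in> borel_measurable (F s)"
    and a: "mean_le M (\<lambda>\<omega>. (norm (\<phi> \<omega>))\<^sup>2) a"
    and b: "mean_le M (\<lambda>\<omega>. \<Sum>k\<in>UNIV. (norm (V k (X s \<omega>) - V k (Y \<omega>)))\<^sup>2) b"
    and c: "\<And>r. r \<in> {s..t} \<Longrightarrow> mean_le M (\<lambda>\<omega>. (norm (X r \<omega> - X s \<omega>))\<^sup>2) c"
  shows "mean_le M (\<lambda>\<omega>. (norm (\<phi> \<omega> + (noise X s t \<omega> - (\<Sum>k\<in>UNIV. dB s t \<omega> $ k *\<^sub>R (sqrt 2 *\<^sub>R V k (Y \<omega>))))))\<^sup>2)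
    (a + (t - s) * (4 * b + 4 * (c1\<^sup>2 * c)))"
proof -
  have Ym: "Y \<in> borel_measurable M" and \<phi>m: "\<phi> \<in> borel_measurable M"
    using Y \<phi> by (auto intro: measurable_F_M)
  define E where "E \<omega> = (\<Sum>k\<in>UNIV. dB s t \<omega> $ k *\<^sub>R (sqrt 2 *\<^sub>R V k (Y \<omega>)))" for \<omega>
  have Em: "E \<in> borel_measurable M"
    unfolding E_def[abs_def] dB_nth using st
    by (intro borel_measurable_sum borel_measurable_scaleR borel_measurable_diff measurable_B_M
        borel_measurable_const measurable_compose[OF Ym measurable_V]) auto
  have Rm: "riemann_noise X s t n \<in> borel_measurable M" for n
    using st by (intro measurable_riemann_noise_M[OF sol]) auto
  have Nm: "noise X s t \<in> borel_measurable M"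
    using st by (intro measurable_noise_M[OF sol]) auto
  have b0: "0 \<le> b" by (rule mean_le_nonneg[OF b]) (simp add: sum_nonneg)
  have a0: "0 \<le> a" by (rule mean_le_nonneg[OF a]) simp
  have c0: "0 \<le> c" by (rule mean_le_nonneg[OF c[of s]]) (use st in auto)
  let ?\<Lambda> = "4 * b + 4 * (c1\<^sup>2 * c)"
  have discrete: "mean_le M (\<lambda>\<omega>. (norm (\<phi> \<omega> + (riemann_noise X s t n \<omega> - E \<omega>)))\<^sup>2) (a + (t - s) * ?\<Lambda>)" if n: "1 \<le> n" for n
  proof -
    let ?p = "grid s t n"
    define h where "h = (t - s) / real n"
    have h: "h > 0" using st n by (simp add: h_def)
    define v where "v i k \<omega> = sqrt 2 *\<^sub>R (V k (X (?p i) \<omega>) - V k (Y \<omega>))" for i k \<omega>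
    define P where "P m \<omega> = \<phi> \<omega> + (\<Sum>i<m. \<Sum>k\<in>UNIV. dB (?p i) (?p (Suc i)) \<omega> $ k *\<^sub>R v i k \<omega>)" for m \<omega>
    have pm: "?p i \<in> {s..t}" if "i \<le> n" for i
      using grid_mem[of s t i n] that n st by auto
    have pS: "?p i < ?p (Suc i)" "?p (Suc i) - ?p i = h" for i
      using grid_Suc[of n s t i] h n by (auto simp: h_def)
    have vm: "v i k \<in> borel_measurable (F r)" if "i \<le> n" "?p i \<le> r" for i k r
      unfolding v_def[abs_def] using that pm[OF that(1)] st
      by (intro borel_measurable_scaleR borel_measurable_const borel_measurable_diff
          measurable_compose[OF measurable_X[OF sol] measurable_V] measurable_compose[OF _ measurable_V] measurable_F_mono[OF Y]) auto
    have Pm: "P m \<in> borel_measurable (F (?p m))" if "m \<le> n" for m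
      unfolding P_def[abs_def]
    proof (rule borel_measurable_add[OF _ borel_measurable_sum])
      show "\<phi> \<in> borel_measurable (F (?p m))"
        using pm[OF that] by (intro measurable_F_mono[OF \<phi>]) auto
      fix i assume i: "i \<in> {..<m}"
      then have "?p i \<le> ?p m" "?p (Suc i) \<le> ?p m" using st by (auto intro!: grid_mono)
      then show "(\<lambda>\<omega>. \<Sum>k\<in>UNIV. dB (?p i) (?p (Suc i)) \<omega> $ k *\<^sub>R v i k \<omega>) \<in> borel_measurable (F (?p m))"
        unfolding dB_nth using i that pm[of i] pm[of "Suc i"] st
        by (intro borel_measurable_sum borel_measurable_scaleR borel_measurable_diff measurable_B vm) auto
    qed
    have vs: "mean_le M (\<lambda>\<omega>. \<Sum>k\<in>UNIV. (norm (v i k \<omega>))\<^sup>2) ?\<Lambda>" if i: "i \<le> n" for i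
    proof -
      have "mean_le M (\<lambda>\<omega>. 4 * (\<Sum>k\<in>UNIV. (norm (V k (X s \<omega>) - V k (Y \<omega>)))\<^sup>2)
          + 4 * (c1\<^sup>2 * (norm (X (?p i) \<omega> - X s \<omega>))\<^sup>2)) ?\<Lambda>"
        by (intro mean_le_add mean_le_cmult b c pm i) auto
      then show ?thesis
      proof (rule mean_le_mono)
        show "(\<lambda>\<omega>. \<Sum>k\<in>UNIV. (norm (v i k \<omega>))\<^sup>2) \<in> borel_measurable M"
          using measurable_F_M[OF vm[OF i order_refl]] by measurable
        show "AE \<omega> in M. (\<Sum>k\<in>UNIV. (norm (v i k \<omega>))\<^sup>2) \<le> 4 * (\<Sum>k\<in>UNIV. (norm (V k (X s \<omega>) - V k (Y \<omega>)))\<^sup>2)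
          + 4 * (c1\<^sup>2 * (norm (X (?p i) \<omega> - X s \<omega>))\<^sup>2)" (is "AE \<omega> in M. ?P \<omega>")
        proof (rule AE_I2)
          fix \<omega>
          have "(norm (v i k \<omega>))\<^sup>2 \<le> 4 * (norm (V k (X s \<omega>) - V k (Y \<omega>)))\<^sup>2 + 4 * (norm (V k (X (?p i) \<omega>) - V k (X s \<omega>)))\<^sup>2" for k
            using norm_diff_squared_le[of "V k (X (?p i) \<omega>) - V k (X s \<omega>)" "V k (Y \<omega>) - V k (X s \<omega>)"]
            by (simp add: v_def power_mult_distrib norm_minus_commute[of "V k (Y \<omega>)"])
          then have "(\<Sum>k\<in>UNIV. (norm (v i k \<omega>))\<^sup>2) \<le> (\<Sum>k\<in>UNIV. 4 * (norm (V k (X s \<omega>) - V k (Y \<omega>)))\<^sup>2 + 4 * (norm (V k (X (?p i) \<omega>) - V k (X s \<omega>)))\<^sup>2)"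
            by (intro sum_mono) auto
          also have "\<dots> = 4 * (\<Sum>k\<in>UNIV. (norm (V k (X s \<omega>) - V k (Y \<omega>)))\<^sup>2) + 4 * (\<Sum>k\<in>UNIV. (norm (V k (X (?p i) \<omega>) - V k (X s \<omega>)))\<^sup>2)"
            by (simp add: sum.distrib sum_distrib_left)
          also have "\<dots> \<le> 4 * (\<Sum>k\<in>UNIV. (norm (V k (X s \<omega>) - V k (Y \<omega>)))\<^sup>2) + 4 * (c1\<^sup>2 * (norm (X (?p i) \<omega> - X s \<omega>))\<^sup>2)"
            using V_lipschitz_squares[of "X (?p i) \<omega>" "X s \<omega>"] by simp
          finally show "?P \<omega>" .
        qed
      qed (auto simp: sum_nonneg)
    qed
    have Pstep: "mean_le M (\<lambda>\<omega>. (norm (P m \<omega>))\<^sup>2) (a + real m * h * ?\<Lambda>)" if "m \<le> n" for m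
      using that
    proof (induction m)
      case 0
      then show ?case using a by (simp add: P_def)
    next
      case (Suc m)
      have PM: "P (Suc m) \<in> borel_measurable M" using Pm[OF Suc.prems] by (rule measurable_F_M)
      have "mean_le M (\<lambda>\<omega>. (norm (P m \<omega>))\<^sup>2 + h * (\<Sum>k\<in>UNIV. (norm (v m k \<omega>))\<^sup>2)) (a + real m * h * ?\<Lambda> + h * ?\<Lambda>)"
        using Suc h by (intro mean_le_add mean_le_cmult vs) auto
      then have "(\<integral>\<^sup>+ \<omega>. ennreal ((norm (P m \<omega>))\<^sup>2 + h * (\<Sum>k\<in>UNIV. (norm (v m k \<omega>))\<^sup>2)) \<partial>M)
          \<le> ennreal (a + real m * h * ?\<Lambda> + h * ?\<Lambda>)"
        by (rule mean_le_nn_integralD) (use h in \<open>auto intro!: AE_I2 add_nonneg_nonneg mult_nonneg_nonneg sum_nonneg\<close>)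
      also have "(\<integral>\<^sup>+ \<omega>. ennreal ((norm (P m \<omega>))\<^sup>2 + h * (\<Sum>k\<in>UNIV. (norm (v m k \<omega>))\<^sup>2)) \<partial>M)
          = L2sq M (\<lambda>\<omega>. P m \<omega> + (\<Sum>k\<in>UNIV. dB (?p m) (?p (Suc m)) \<omega> $ k *\<^sub>R v m k \<omega>))"
        unfolding pS(2)[of m, symmetric]
        by (rule nn_integral_increment_norm2[symmetric]) (use Suc.prems pm[of m] pS(1)[of m] st in \<open>auto intro!: Pm vm\<close>)
      finally have "L2sq M (\<lambda>\<omega>. P (Suc m) \<omega>) \<le> ennreal (a + real (Suc m) * h * ?\<Lambda>)"
        by (simp add: P_def algebra_simps)
      then show ?case
        using PM a0 b0 c0 h by (intro mean_le_nn_integralI) auto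
    qed
    have "mean_le M (\<lambda>\<omega>. (norm (P n \<omega>))\<^sup>2) (a + (t - s) * ?\<Lambda>)"
      using Pstep[of n] n by (simp add: h_def)
    moreover have "P n \<omega> = \<phi> \<omega> + (riemann_noise X s t n \<omega> - E \<omega>)" for \<omega>
    proof -
      \<comment> \<open>\<open>Y\<close> is frozen on the step, so the refinement leaves its noise
        unchanged: the increments telescope.\<close>
      have tele: "(\<Sum>i<n. dB (?p i) (?p (Suc i)) \<omega> $ k) = dB s t \<omega> $ k" for k
        using sum_lessThan_telescope[of "\<lambda>i. B k (?p i) \<omega>" n] n by (simp add: grid_def del: of_nat_Suc)
      have "(\<Sum>i<n. \<Sum>k\<in>UNIV. dB (?p i) (?p (Suc i)) \<omega> $ k *\<^sub>R (sqrt 2 *\<^sub>R V k (Y \<omega>)))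
          = (\<Sum>k\<in>UNIV. (\<Sum>i<n. dB (?p i) (?p (Suc i)) \<omega> $ k) *\<^sub>R (sqrt 2 *\<^sub>R V k (Y \<omega>)))"
        by (subst sum.swap) (simp only: scaleR_sum_left)
      also have "\<dots> = E \<omega>" unfolding tele E_def ..
      finally show ?thesis
        by (simp only: P_def v_def riemann_noise_def scaleR_diff_right sum_subtractf)
    qed
    ultimately show ?thesis by simp
  qed
  have "mean_le M (\<lambda>\<omega>. (norm (\<phi> \<omega> + (noise X s t \<omega> - E \<omega>)))\<^sup>2) (a + (t - s) * ?\<Lambda>)"
  proof (rule mean_le_L2_limit[where D="riemann_noise X s t" and \<Phi>="\<lambda>\<omega> y. (norm (\<phi> \<omega> + (y - E \<omega>)))\<^sup>2" and C="\<lambda>_. a + (t - s) * ?\<Lambda>"])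
    show "(\<lambda>\<omega>. (norm (\<phi> \<omega> + (riemann_noise X s t n \<omega> - E \<omega>)))\<^sup>2) \<in> borel_measurable M" for n
      using \<phi>m Em Rm by measurable
    show "(\<lambda>\<omega>. (norm (\<phi> \<omega> + (noise X s t \<omega> - E \<omega>)))\<^sup>2) \<in> borel_measurable M"
      using \<phi>m Em Nm by measurable
  qed (use Rm Nm riemann_noise_tendsto[OF sol st] discrete in \<open>auto intro!: continuous_intros\<close>)
  then show ?thesis by (simp only: E_def)
qed

end

section \<open>Strong error of the implicit Euler scheme\<close>

lemma norm_diff_scaleR_squared:
  fixes x y :: "'a::real_inner"
  shows "(norm (x - d *\<^sub>R y))\<^sup>2 = (norm x)\<^sup>2 - 2 * d * (y \<bullet> x) + d\<^sup>2 * (norm y)\<^sup>2"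
  unfolding power2_norm_eq_inner
  by (simp add: inner_diff_left inner_diff_right inner_commute power2_eq_square algebra_simps)

text \<open>The relations that define the scheme say nothing about measurability; it comes from a
  Borel inverse of the implicit map. Expansion makes \<open>G\<close> injective with closed range
  and a nonexpansive inverse. Off the range the inverse is set to 0, a value at points the scheme
  never meets.\<close>

lemma expanding_measurable_inverse:
  fixes G :: "'a::euclidean_space \<Rightarrow> 'a"
  assumes cont: "continuous_on UNIV G" and exp: "\<And>a b. norm (a - b) \<le> norm (G a - G b)"
  obtains g where "g \<in> borel_measurable borel" "\<And>y. g (G y) = y"
proof -
  have inj: "inj G"
    using exp by (intro injI) (metis diff_self norm_le_zero_iff norm_zero right_minus_eq)
  \<comment> \<open>By expansion, preimages of a convergent sequence in the range form a Cauchy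
    sequence.\<close>
  have closed: "closed (range G)"
    unfolding closed_sequential_limits
  proof (intro allI impI, elim conjE)
    fix w l assume w: "\<forall>n. w n \<in> range G" and l: "w \<longlonglongrightarrow> l"
    then have "\<forall>n. \<exists>y. w n = G y" by blast
    then obtain y where y: "\<And>n. w n = G (y n)" by metis
    have "Cauchy y"
      unfolding Cauchy_def
    proof (intro allI impI)
      fix e :: real assume "e > 0"
      then obtain N where N: "\<And>m n. m \<ge> N \<Longrightarrow> n \<ge> N \<Longrightarrow> dist (w m) (w n) < e"
        using LIMSEQ_imp_Cauchy[OF l] unfolding Cauchy_def by blast
      have "dist (y m) (y n) < e" if "m \<ge> N" "n \<ge> N" for m n
        using exp[of "y m" "y n"] N[OF that] by (simp add: y dist_norm)
      then show "\<exists>N. \<forall>m\<ge>N. \<forall>n\<ge>N. dist (y m) (y n) < e" by blast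
    qed
    then obtain z where z: "y \<longlonglongrightarrow> z" using Cauchy_convergent convergent_def by blast
    have "(\<lambda>n. G (y n)) \<longlonglongrightarrow> G z"
      using continuous_on_tendsto_compose[OF cont z] by simp
    moreover have "(\<lambda>n. G (y n)) \<longlonglongrightarrow> l" using l by (simp add: y[symmetric])
    ultimately have "l = G z" by (rule LIMSEQ_unique[symmetric])
    then show "l \<in> range G" by simp
  qed
  define g where "g w = (if w \<in> range G then the_inv G w else 0)" for w
  have "continuous_on (range G) (the_inv G)"
    unfolding continuous_on_iff
  proof (intro ballI allI impI)
    fix w and e :: real assume "w \<in> range G" "e > 0"
    then show "\<exists>d>0. \<forall>w'\<in>range G. dist w' w < d \<longrightarrow> dist (the_inv G w') (the_inv G w) < e"
      using exp by (intro exI[of _ e]) (auto simp: the_inv_f_f[OF inj] dist_norm intro: le_less_trans[OF exp])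
  qed
  then have "g \<in> borel_measurable borel"
    unfolding g_def[abs_def] using closed
    by (intro borel_measurable_continuous_on_if) auto
  moreover have "g (G y) = y" for y by (simp add: g_def the_inv_f_f[OF inj])
  ultimately show thesis by (rule that)
qed

text \<open>Jensen's inequality through the arithmetic-geometric mean inequality, balanced at
  \<open>sqrt a\<close>.\<close>

lemma (in prob_space) mean_le_norm_of_square:
  assumes "mean_le M (\<lambda>\<omega>. (norm (e \<omega>))\<^sup>2) a" "0 < a" "e \<in> borel_measurable M"
  shows "mean_le M (\<lambda>\<omega>. norm (e \<omega>)) (sqrt a)"
proof -
  have "mean_le M (\<lambda>\<omega>. 1 / (2 * sqrt a) * (norm (e \<omega>))\<^sup>2 + sqrt a / 2) (1 / (2 * sqrt a) * a + sqrt a / 2)"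
    using assms by (intro mean_le_add mean_le_cmult mean_le_const) auto
  then show ?thesis
  proof (rule mean_le_mono)
    show "AE \<omega> in M. norm (e \<omega>) \<le> 1 / (2 * sqrt a) * (norm (e \<omega>))\<^sup>2 + sqrt a / 2" (is "AE \<omega> in M. ?P \<omega>")
    proof (rule AE_I2)
      fix \<omega>
      have "2 * norm (e \<omega>) * sqrt a \<le> (norm (e \<omega>))\<^sup>2 + (sqrt a)\<^sup>2" by (rule sum_squares_bound)
      then show "?P \<omega>"
        using assms(2) by (simp add: field_simps power2_eq_square)
    qed
    have "1 / (2 * sqrt a) * a = sqrt a / 2"
      using assms(2) real_sqrt_mult_self[of a] by (simp add: field_simps)
    then show "1 / (2 * sqrt a) * a + sqrt a / 2 \<le> sqrt a" by simp
  qed (use assms(3) in auto)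
qed

context dissipative_sde
begin

text \<open>Dissipativity makes the map \<open>G\<close> below expanding for every positive
  \<open>\<delta>\<close>, so each step writes the new value as a Borel function of quantities known
  at the new time. This adaptedness is what \<open>martingale_step\<close> asks of
  \<open>Y\<close>.\<close>

lemma implicit_euler_measurable:
  assumes Y: "implicit_euler M B U0 V x \<delta> Y" and \<delta>: "0 < \<delta>"
  shows "Y n \<in> borel_measurable (F (real n * \<delta>))"
proof -
  define G where "G y = y - \<delta> *\<^sub>R U0 y" for y
  have "continuous_on UNIV G" unfolding G_def by (intro continuous_intros cont_U0)
  moreover have "norm (a - b) \<le> norm (G a - G b)" for a b
  proof -
    have "(G a - G b) \<bullet> (a - b) = (norm (a - b))\<^sup>2 - \<delta> * ((U0 a - U0 b) \<bullet> (a - b))"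
      by (simp add: G_def power2_norm_eq_inner algebra_simps)
    moreover have "\<delta> * ((U0 a - U0 b) \<bullet> (a - b)) \<le> \<delta> * (- \<mu> * (norm (a - b))\<^sup>2)"
      using \<delta> by (intro mult_left_mono dissipative) auto
    moreover have "\<delta> * (- \<mu> * (norm (a - b))\<^sup>2) \<le> 0"
      using \<delta> \<mu> by (simp add: mult_nonneg_nonneg)
    ultimately have "norm (a - b) * norm (a - b) \<le> norm (G a - G b) * norm (a - b)"
      using norm_cauchy_schwarz[of "G a - G b" "a - b"] by (simp add: power2_eq_square)
    then show ?thesis by (cases "a = b") auto
  qed
  ultimately obtain g where g: "g \<in> borel_measurable borel" "\<And>y. g (G y) = y"
    using expanding_measurable_inverse by blast
  show ?thesis
  proof (induction n)
    case 0
    have "Y 0 \<in> borel_measurable (F (real 0 * \<delta>)) \<longleftrightarrow> (\<lambda>_. x) \<in> borel_measurable (F (real 0 * \<delta>))"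
      using Y by (intro measurable_cong) (simp add: implicit_euler_def)
    then show ?case by simp
  next
    case (Suc n)
    define W where "W \<omega> = Y n \<omega> + sqrt 2 *\<^sub>R (\<Sum>k\<in>UNIV. (B k (real (Suc n) * \<delta>) \<omega> - B k (real n * \<delta>) \<omega>) *\<^sub>R V k (Y n \<omega>))" for \<omega>
    have le: "real n * \<delta> \<le> real (Suc n) * \<delta>" "0 \<le> real n * \<delta>" "0 \<le> real (Suc n) * \<delta>" using \<delta> by auto
    have Yn: "Y n \<in> borel_measurable (F (real (Suc n) * \<delta>))" by (rule measurable_F_mono[OF Suc le(1)])
    have "W \<in> borel_measurable (F (real (Suc n) * \<delta>))"
      unfolding W_def[abs_def] using le
      by (intro borel_measurable_add borel_measurable_scaleR borel_measurable_const borel_measurable_sum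
          borel_measurable_diff measurable_B measurable_compose[OF Yn measurable_V] Yn) auto
    then have "(\<lambda>\<omega>. g (W \<omega>)) \<in> borel_measurable (F (real (Suc n) * \<delta>))"
      by (rule measurable_compose[OF _ g(1)])
    moreover have "Y (Suc n) \<omega> = g (W \<omega>)" if "\<omega> \<in> space (F (real (Suc n) * \<delta>))" for \<omega>
    proof -
      have "Y (Suc n) \<omega> = Y n \<omega> + \<delta> *\<^sub>R U0 (Y (Suc n) \<omega>) +
        sqrt 2 *\<^sub>R (\<Sum>k\<in>UNIV. (B k (real (Suc n) * \<delta>) \<omega> - B k (real n * \<delta>) \<omega>) *\<^sub>R V k (Y n \<omega>))"
        using Y that unfolding implicit_euler_def space_F by blast
      then have "G (Y (Suc n) \<omega>) = W \<omega>" by (simp add: G_def W_def algebra_simps)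
      then show ?thesis using g(2) by metis
    qed
    ultimately show ?case by (subst measurable_cong) auto
  qed
qed

text \<open>The squared error alone is not propagated. An implicit step gains
  \<open>6 * \<delta> * v\<close> at its new time, while the noise of the next step costs a multiple
  \<open>4 * \<delta>\<close> of the same \<open>v\<close>. Keeping both terms in one quantity
  \<open>Z\<close> lets the gain of one step pay for the loss in the next.\<close>

lemma strong_error:
  obtains C where "C > 0" "\<And>x X Y \<delta> n. solves x X \<Longrightarrow> 0 < \<delta> \<Longrightarrow> \<delta> \<le> 1 \<Longrightarrow> 4 * \<mu> * \<delta> \<le> 1
    \<Longrightarrow> implicit_euler M B U0 V x \<delta> Y
    \<Longrightarrow> mean_le M (\<lambda>\<omega>. (norm (X (real n * \<delta>) \<omega> - Y n \<omega>))\<^sup>2) (C * \<delta> * (1 + norm x) powr (4 * q + 2))"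
proof -
  obtain C1 where C1: "C1 \<ge> 0" "\<And>x X s t. solves x X \<Longrightarrow> 0 \<le> s \<Longrightarrow> s \<le> t \<Longrightarrow> t \<le> s + 1
    \<Longrightarrow> mean_le M (\<lambda>\<omega>. (norm (X t \<omega> - X s \<omega>))\<^sup>2) (C1 * (t - s) * (1 + norm x) powr (2 * q + 2))"
    using X_increment by blast
  obtain C2 where C2: "C2 \<ge> 0" "\<And>x X s t. solves x X \<Longrightarrow> 0 \<le> s \<Longrightarrow> s \<le> t \<Longrightarrow> t \<le> s + 1
    \<Longrightarrow> mean_le M (\<lambda>\<omega>. (norm (U0 (X s \<omega>) - U0 (X t \<omega>)))\<^sup>2) (C2 * (t - s) * (1 + norm x) powr (4 * q + 2))"
    using drift_increment by blast
  \<comment> \<open>The first summand bounds the consistency error of the noise per step, with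
    \<open>1 + \<mu> * \<delta>\<close> estimated by 2; the second that of the drift, with
    \<open>\<delta>\<close> estimated by 1; the last makes \<open>A\<close> positive.\<close>
  define A where "A = 2 * (4 * (c1\<^sup>2 * C1)) + (1 + 1 / \<mu>) * C2 + 1"
  have A: "A > 0" using C1 C2 \<mu> by (simp add: A_def add_nonneg_pos)
  show thesis
  proof (rule that)
    show "2 * A / \<mu> > 0" using A \<mu> by simp
    fix x X Y and \<delta> :: real and n
    assume sol: "solves x X" and \<delta>: "0 < \<delta>" "\<delta> \<le> 1" "4 * \<mu> * \<delta> \<le> 1"
      and Y: "implicit_euler M B U0 V x \<delta> Y"
    define P where "P = (1 + norm x) powr (4 * q + 2)"
    have P: "1 \<le> P" unfolding P_def using q by (intro ge_one_powr_ge_zero) auto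
    have P': "(1 + norm x) powr (2 * q + 2) \<le> P" unfolding P_def using q by (intro powr_mono) auto
    define T where "T n = real n * \<delta>" for n
    have T: "0 \<le> T n" "T n < T (Suc n)" "T (Suc n) - T n = \<delta>" for n
      using \<delta> by (auto simp: T_def algebra_simps)
    define e where "e n \<omega> = X (T n) \<omega> - Y n \<omega>" for n \<omega>
    define v where "v n \<omega> = (\<Sum>k\<in>UNIV. (norm (V k (X (T n) \<omega>) - V k (Y n \<omega>)))\<^sup>2)" for n \<omega>
    define Z where "Z n \<omega> = (1 + 2 * \<mu> * \<delta>) * (norm (e n \<omega>))\<^sup>2 + 6 * \<delta> * v n \<omega>" for n \<omega>
    \<comment> \<open>Stationary level of the recursion: a source
      \<open>A * (\<delta>\<^sup>2 * P)\<close> per step against a contraction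
      \<open>1 - \<theta>\<close> of at least \<open>\<mu> * \<delta> / 2\<close>, with the
      \<open>\<theta>\<close> introduced below.\<close>
    define \<alpha> where "\<alpha> = 2 * A / \<mu> * \<delta> * P"
    have \<alpha>: "\<alpha> \<ge> 0" using A \<mu> \<delta> P by (simp add: \<alpha>_def)
    have YF: "Y n \<in> borel_measurable (F (T n))" for n
      unfolding T_def by (rule implicit_euler_measurable[OF Y \<delta>(1)])
    have XF: "X (T n) \<in> borel_measurable (F (T n))" for n
      by (rule measurable_X[OF sol T(1) order_refl])
    have eF: "e n \<in> borel_measurable (F (T n))" for n
      unfolding e_def[abs_def] by (intro borel_measurable_diff XF YF)
    have vF: "v n \<in> borel_measurable (F (T n))" for n
      unfolding v_def[abs_def]
      by (intro borel_measurable_sum borel_measurable_power measurable_compose[OF _ borel_measurable_norm]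
          borel_measurable_diff measurable_compose[OF XF measurable_V] measurable_compose[OF YF measurable_V])
    have [measurable]: "e n \<in> borel_measurable M" "v n \<in> borel_measurable M" for n
      by (rule measurable_F_M[OF eF], rule measurable_F_M[OF vF])
    have [measurable]: "Z n \<in> borel_measurable M" for n unfolding Z_def[abs_def] by measurable
    have v0: "0 \<le> v n \<omega>" for n \<omega> by (simp add: v_def sum_nonneg)
    have ZZ: "0 \<le> Z n \<omega>" "(norm (e n \<omega>))\<^sup>2 \<le> Z n \<omega>" "6 * \<delta> * v n \<omega> \<le> Z n \<omega>" for n \<omega>
      using \<mu> \<delta> v0[of n \<omega>] by (simp_all add: Z_def algebra_simps)
    have main: "mean_le M (Z n) \<alpha>" for n
    proof (induction n)
      case 0
      have ae: "AE \<omega> in M. X 0 \<omega> = x" using sol by (simp add: sde_solution_def)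
      have "AE \<omega> in M. Z 0 \<omega> \<le> 0"
        using ae AE_space
      proof eventually_elim
        case (elim \<omega>)
        then have "X (T 0) \<omega> = Y 0 \<omega>" using Y by (simp add: T_def implicit_euler_def)
        then show ?case by (simp add: Z_def e_def v_def)
      qed
      then show ?case
        by (intro mean_le_mono[OF mean_le_const[OF \<alpha>]]) (use ZZ in auto)
    next
      case (Suc n)
      let ?s = "T n" and ?t = "T (Suc n)"
      \<comment> \<open>These are the exact means and not bounds for them: the induction hypothesis
        controls their weighted sum, and bounding the two separately would lose the
        coupling.\<close>
      define a b where "a = expectation (\<lambda>\<omega>. (norm (e n \<omega>))\<^sup>2)" and "b = expectation (v n)"
      have "mean_le M (\<lambda>\<omega>. (norm (e n \<omega>))\<^sup>2) \<alpha>"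
        by (rule mean_le_mono[OF Suc]) (use ZZ in auto)
      then have int_e: "integrable M (\<lambda>\<omega>. (norm (e n \<omega>))\<^sup>2)" by (simp add: mean_le_def)
      then have ma: "mean_le M (\<lambda>\<omega>. (norm (e n \<omega>))\<^sup>2) a" by (simp add: mean_le_def a_def)
      have "mean_le M (\<lambda>\<omega>. 6 * \<delta> * v n \<omega>) \<alpha>"
        by (rule mean_le_mono[OF Suc]) (use ZZ v0 \<delta> in auto)
      then have int_v: "integrable M (v n)" using \<delta> by (simp add: mean_le_def)
      then have mb: "mean_le M (v n) b" by (simp add: mean_le_def b_def)
      have EZ: "(1 + 2 * \<mu> * \<delta>) * a + 6 * \<delta> * b \<le> \<alpha>"
      proof -
        have "expectation (Z n) = (1 + 2 * \<mu> * \<delta>) * a + 6 * \<delta> * b"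
          unfolding Z_def[abs_def] a_def b_def using int_e int_v by simp
        then show ?thesis using Suc by (simp add: mean_le_def)
      qed
      have a0: "0 \<le> a" "0 \<le> b" by (auto simp: a_def b_def intro!: Bochner_Integration.integral_nonneg v0)
      define W where "W \<omega> = e n \<omega> + (noise X ?s ?t \<omega> - (\<Sum>k\<in>UNIV. dB ?s ?t \<omega> $ k *\<^sub>R (sqrt 2 *\<^sub>R V k (Y n \<omega>))))" for \<omega>
      have cX: "mean_le M (\<lambda>\<omega>. (norm (X r \<omega> - X ?s \<omega>))\<^sup>2) (C1 * \<delta> * P)" if r: "r \<in> {?s..?t}" for r
      proof (rule mean_le_weaken)
        show "mean_le M (\<lambda>\<omega>. (norm (X r \<omega> - X ?s \<omega>))\<^sup>2) (C1 * (r - ?s) * (1 + norm x) powr (2 * q + 2))"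
          using r T[of n] \<delta> by (intro C1(2)[OF sol]) auto
        show "C1 * (r - ?s) * (1 + norm x) powr (2 * q + 2) \<le> C1 * \<delta> * P"
          using r T[of n] \<delta> C1(1) P' by (intro mult_mono mult_left_mono) auto
      qed
      have mW: "mean_le M (\<lambda>\<omega>. (norm (W \<omega>))\<^sup>2) (a + \<delta> * (4 * b + 4 * (c1\<^sup>2 * (C1 * \<delta> * P))))"
        using martingale_step[OF sol T(1)[of n] T(2)[of n] eF YF ma mb[unfolded v_def[abs_def]] cX]
        unfolding W_def T(3) .
      \<comment> \<open>Consistency error of taking the drift at the right end. Its mean square has
        three powers of \<open>\<delta>\<close>: two from the length of the step and one from the
        regularity of the drift along \<open>X\<close>.\<close>
      define R where "R \<omega> = integral {?s..?t} (\<lambda>r. U0 (X r \<omega>) - U0 (X ?t \<omega>))" for \<omega>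
      have mR: "mean_le M (\<lambda>\<omega>. (norm (R \<omega>))\<^sup>2) (\<delta>\<^sup>2 * (C2 * \<delta> * P))"
        unfolding R_def T(3)[of n, symmetric]
      proof (rule mean_le_norm2_integral_paths)
        show "?s \<le> ?t" using T(2)[of n] by simp
        show "continuous_on {?s..?t} (\<lambda>r. U0 (X r \<omega>) - U0 (X ?t \<omega>))" if "\<omega> \<in> space M" for \<omega>
          by (intro continuous_intros cont_U0_X[OF sol that T(1)])
        fix r assume r: "r \<in> {?s..?t}"
        then have r0: "0 \<le> r" using T(1)[of n] by auto
        show "(\<lambda>\<omega>. U0 (X r \<omega>) - U0 (X ?t \<omega>)) \<in> borel_measurable M"
          by (intro borel_measurable_diff measurable_compose[OF measurable_X_M[OF sol] measurable_U0] r0 T(1))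
        show "mean_le M (\<lambda>\<omega>. (norm (U0 (X r \<omega>) - U0 (X ?t \<omega>)))\<^sup>2) (C2 * (?t - ?s) * P)"
        proof (rule mean_le_weaken)
          show "mean_le M (\<lambda>\<omega>. (norm (U0 (X r \<omega>) - U0 (X ?t \<omega>)))\<^sup>2) (C2 * (?t - r) * P)"
            unfolding P_def using r r0 T[of n] \<delta> by (intro C2(2)[OF sol]) auto
          show "C2 * (?t - r) * P \<le> C2 * (?t - ?s) * P"
            using r C2(1) P by (intro mult_right_mono mult_left_mono) auto
        qed
      qed
      \<comment> \<open>Young's inequality with weight \<open>\<mu> * \<delta>\<close>, half of the
        gain \<open>2 * \<mu> * \<delta>\<close> on the left; dividing the third power of
        \<open>\<delta>\<close> by it leaves order \<open>\<delta>\<^sup>2\<close>.\<close>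
      have "mean_le M (\<lambda>\<omega>. (1 + \<mu> * \<delta>) * (norm (W \<omega>))\<^sup>2 + (1 + 1 / (\<mu> * \<delta>)) * (norm (R \<omega>))\<^sup>2)
         ((1 + \<mu> * \<delta>) * (a + \<delta> * (4 * b + 4 * (c1\<^sup>2 * (C1 * \<delta> * P)))) + (1 + 1 / (\<mu> * \<delta>)) * (\<delta>\<^sup>2 * (C2 * \<delta> * P)))"
        using \<mu> \<delta> by (intro mean_le_add mean_le_cmult mW mR) auto
      then show ?case
      proof (rule mean_le_mono)
        show "AE \<omega> in M. Z (Suc n) \<omega> \<le> (1 + \<mu> * \<delta>) * (norm (W \<omega>))\<^sup>2 + (1 + 1 / (\<mu> * \<delta>)) * (norm (R \<omega>))\<^sup>2" (is "AE \<omega> in M. ?P \<omega>")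
        proof (rule AE_I2)
          fix \<omega> assume \<omega>: "\<omega> \<in> space M"
          let ?D = "U0 (X ?t \<omega>) - U0 (Y (Suc n) \<omega>)"
          have "Y (Suc n) \<omega> = Y n \<omega> + \<delta> *\<^sub>R U0 (Y (Suc n) \<omega>) +
            sqrt 2 *\<^sub>R (\<Sum>k\<in>UNIV. (B k ?t \<omega> - B k ?s \<omega>) *\<^sub>R V k (Y n \<omega>))"
            using Y \<omega> unfolding implicit_euler_def T_def by blast
          then have Ye: "Y (Suc n) \<omega> - \<delta> *\<^sub>R U0 (Y (Suc n) \<omega>) = Y n \<omega> + (\<Sum>k\<in>UNIV. dB ?s ?t \<omega> $ k *\<^sub>R (sqrt 2 *\<^sub>R V k (Y n \<omega>)))"
            by (simp add: scaleR_sum_right algebra_simps)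
          have "R \<omega> = integral {?s..?t} (\<lambda>r. U0 (X r \<omega>)) - integral {?s..?t} (\<lambda>r. U0 (X ?t \<omega>))"
            unfolding R_def by (intro Henstock_Kurzweil_Integration.integral_diff integrable_continuous_real
                cont_U0_X[OF sol \<omega> T(1)] continuous_intros)
          also have "integral {?s..?t} (\<lambda>r. U0 (X ?t \<omega>)) = \<delta> *\<^sub>R U0 (X ?t \<omega>)"
            using T(2,3)[of n] by simp
          finally have Re: "R \<omega> = integral {?s..?t} (\<lambda>r. U0 (X r \<omega>)) - \<delta> *\<^sub>R U0 (X ?t \<omega>)" .
          \<comment> \<open>With both implicit drifts on the left, the mixed term of the square is
            the one that \<open>monotone\<close> estimates.\<close>
          have "e (Suc n) \<omega> - \<delta> *\<^sub>R ?D = (X ?t \<omega> - \<delta> *\<^sub>R U0 (X ?t \<omega>)) - (Y (Suc n) \<omega> - \<delta> *\<^sub>R U0 (Y (Suc n) \<omega>))"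
            by (simp add: e_def algebra_simps)
          also have "\<dots> = W \<omega> + R \<omega>"
            unfolding Ye Re W_def e_def noise_def by (simp add: algebra_simps)
          finally have key: "e (Suc n) \<omega> - \<delta> *\<^sub>R ?D = W \<omega> + R \<omega>" .
          have mono: "?D \<bullet> e (Suc n) \<omega> + 3 * v (Suc n) \<omega> \<le> - \<mu> * (norm (e (Suc n) \<omega>))\<^sup>2"
            unfolding e_def v_def by (rule monotone)
          have lin: "(1 + 2 * \<mu> * \<delta>) * E + 6 * \<delta> * w \<le> N"
            if "N = E - 2 * \<delta> * J + S" "0 \<le> S" "2 * \<delta> * (J + 3 * w) \<le> 2 * \<delta> * (- \<mu> * E)" for E w N J S :: real
            using that by (simp add: algebra_simps)
          have Zle: "Z (Suc n) \<omega> \<le> (norm (W \<omega> + R \<omega>))\<^sup>2"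
            unfolding key[symmetric] Z_def
          proof (rule lin[OF norm_diff_scaleR_squared])
            show "2 * \<delta> * (?D \<bullet> e (Suc n) \<omega> + 3 * v (Suc n) \<omega>) \<le> 2 * \<delta> * (- \<mu> * (norm (e (Suc n) \<omega>))\<^sup>2)"
              using \<delta> mono by (intro mult_left_mono) auto
          qed simp
          have "2 * (norm (W \<omega>) * norm (R \<omega>)) \<le> \<mu> * \<delta> * (norm (W \<omega>))\<^sup>2 + 1 / (\<mu> * \<delta>) * (norm (R \<omega>))\<^sup>2"
            using sum_squares_bound[of "sqrt (\<mu> * \<delta>) * norm (W \<omega>)" "norm (R \<omega>) / sqrt (\<mu> * \<delta>)"] \<mu> \<delta>
            by (simp add: power_mult_distrib power_divide)
          moreover have "(norm (W \<omega> + R \<omega>))\<^sup>2 \<le> (norm (W \<omega>) + norm (R \<omega>))\<^sup>2"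
            by (intro power_mono norm_triangle_ineq) auto
          ultimately have "(norm (W \<omega> + R \<omega>))\<^sup>2 \<le> (1 + \<mu> * \<delta>) * (norm (W \<omega>))\<^sup>2 + (1 + 1 / (\<mu> * \<delta>)) * (norm (R \<omega>))\<^sup>2"
            by (simp add: power2_sum distrib_right)
          with Zle show "?P \<omega>"
            by linarith
        qed
        define \<theta> where "\<theta> = (1 + \<mu> * \<delta>) / (1 + 2 * \<mu> * \<delta>)"
        have pos: "0 < 1 + 2 * \<mu> * \<delta>" "0 < \<mu> * \<delta>" using \<mu> \<delta> by (auto simp: add_pos_pos)
        have \<theta>: "0 \<le> \<theta>" "\<theta> * (1 + 2 * \<mu> * \<delta>) = 1 + \<mu> * \<delta>" using pos by (auto simp: \<theta>_def)
        have "(1 + \<mu> * \<delta>) * (a + 4 * \<delta> * b) \<le> \<theta> * \<alpha>"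
        proof -
          \<comment> \<open>Here \<open>4 * \<mu> * \<delta> \<le> 1\<close> enters:
            \<open>1 + 2 * \<mu> * \<delta>\<close> is at most \<open>3 / 2\<close>, and 4 times
            that is the 6 available in \<open>EZ\<close>.\<close>
          have "(1 + 2 * \<mu> * \<delta>) * (4 * (\<delta> * b)) \<le> (3 / 2) * (4 * (\<delta> * b))"
            using \<delta> a0 by (intro mult_right_mono) auto
          then have "(1 + 2 * \<mu> * \<delta>) * (a + 4 * \<delta> * b) \<le> \<alpha>"
            using EZ by (simp add: algebra_simps)
          then have "\<theta> * ((1 + 2 * \<mu> * \<delta>) * (a + 4 * \<delta> * b)) \<le> \<theta> * \<alpha>"
            using \<theta> by (intro mult_left_mono) auto
          then show ?thesis by (simp only: mult.assoc[symmetric] \<theta>(2))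
        qed
        moreover have "(1 + \<mu> * \<delta>) * (\<delta> * (4 * (c1\<^sup>2 * (C1 * \<delta> * P)))) \<le> 2 * (\<delta> * (4 * (c1\<^sup>2 * (C1 * \<delta> * P))))"
          using \<delta> C1(1) P pos by (intro mult_right_mono mult_nonneg_nonneg) auto
        moreover have "(1 + 1 / (\<mu> * \<delta>)) * (\<delta>\<^sup>2 * (C2 * \<delta> * P)) \<le> (1 + 1 / \<mu>) * C2 * (\<delta>\<^sup>2 * P)"
        proof -
          have "(1 + 1 / (\<mu> * \<delta>)) * (\<delta>\<^sup>2 * (C2 * \<delta> * P)) = (\<delta> + 1 / \<mu>) * (C2 * (\<delta>\<^sup>2 * P))"
            using \<mu> \<delta> by (simp add: field_simps power2_eq_square)
          also have "\<dots> \<le> (1 + 1 / \<mu>) * (C2 * (\<delta>\<^sup>2 * P))"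
            using \<delta> C2(1) P by (intro mult_right_mono mult_nonneg_nonneg) auto
          finally show ?thesis by (simp add: mult.assoc)
        qed
        moreover have "\<theta> * \<alpha> + A * (\<delta>\<^sup>2 * P) \<le> \<alpha>"
        proof -
          have "(1 - \<theta>) * (1 + 2 * \<mu> * \<delta>) = \<mu> * \<delta>" using \<theta>(2) by (simp add: algebra_simps)
          then have th: "1 - \<theta> = \<mu> * \<delta> / (1 + 2 * \<mu> * \<delta>)" using pos by (simp add: field_simps)
          have "A * (\<delta>\<^sup>2 * P) * (1 + 2 * \<mu> * \<delta>) \<le> A * (\<delta>\<^sup>2 * P) * 2"
            using A P \<delta> by (intro mult_left_mono) auto
          also have "A * (\<delta>\<^sup>2 * P) * 2 = \<mu> * \<delta> * \<alpha>"
            using \<mu> by (simp add: \<alpha>_def field_simps power2_eq_square)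
          finally have "A * (\<delta>\<^sup>2 * P) \<le> (1 - \<theta>) * \<alpha>"
            unfolding th using pos by (simp add: field_simps)
          then show ?thesis by (simp add: algebra_simps)
        qed
        moreover have "A * (\<delta>\<^sup>2 * P) = 2 * (\<delta> * (4 * (c1\<^sup>2 * (C1 * \<delta> * P)))) + (1 + 1 / \<mu>) * C2 * (\<delta>\<^sup>2 * P) + \<delta>\<^sup>2 * P"
          by (simp add: A_def algebra_simps power2_eq_square)
        moreover have "0 \<le> \<delta>\<^sup>2 * P" using P by simp
        moreover have "(1 + \<mu> * \<delta>) * (a + \<delta> * (4 * b + 4 * (c1\<^sup>2 * (C1 * \<delta> * P))))
            = (1 + \<mu> * \<delta>) * (a + 4 * \<delta> * b) + (1 + \<mu> * \<delta>) * (\<delta> * (4 * (c1\<^sup>2 * (C1 * \<delta> * P))))"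
          by (simp add: algebra_simps)
        ultimately show "(1 + \<mu> * \<delta>) * (a + \<delta> * (4 * b + 4 * (c1\<^sup>2 * (C1 * \<delta> * P)))) + (1 + 1 / (\<mu> * \<delta>)) * (\<delta>\<^sup>2 * (C2 * \<delta> * P)) \<le> \<alpha>"
          by linarith
      qed (use ZZ in auto)
    qed
    have "mean_le M (\<lambda>\<omega>. (norm (e n \<omega>))\<^sup>2) \<alpha>"
      by (rule mean_le_mono[OF main[of n]]) (use ZZ in auto)
    then show "mean_le M (\<lambda>\<omega>. (norm (X (real n * \<delta>) \<omega> - Y n \<omega>))\<^sup>2) (2 * A / \<mu> * \<delta> * (1 + norm x) powr (4 * q + 2))"
      by (simp add: e_def T_def \<alpha>_def P_def)
  qed
qed

end

section \<open>Test functions, verification of the structural conditions, and conclusion\<close>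

lemma Ck_Suc_differentiable: "Ck (Suc k) f \<Longrightarrow> f differentiable (at x)"
  by simp

lemma smooth_differentiable: "smooth f \<Longrightarrow> f differentiable (at x)"
  using Ck_Suc_differentiable[of 0 f x] by (simp add: smooth_def)

lemma frechet_derivative_grad:
  fixes f :: "real ^ 'n \<Rightarrow> real"
  assumes "f differentiable (at x)"
  shows "frechet_derivative f (at x) v = grad f x \<bullet> v"
proof -
  have lin: "linear (frechet_derivative f (at x))"
    using assms by (rule linear_frechet_derivative)
  have "frechet_derivative f (at x) v = frechet_derivative f (at x) (\<Sum>i\<in>UNIV. v $ i *\<^sub>R axis i 1)"
    using basis_expansion[of v] by (simp add: scalar_mult_eq_scaleR)
  also have "\<dots> = (\<Sum>i\<in>UNIV. v $ i * frechet_derivative f (at x) (axis i 1))"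
    by (simp add: linear_sum[OF lin] linear_cmul[OF lin])
  also have "\<dots> = grad f x \<bullet> v"
    by (simp add: grad_def partial_def inner_vec_def mult.commute)
  finally show ?thesis .
qed

text \<open>A real supremum bounds its elements when the range is bounded above, which membership in
  \<open>C2b\<close> supplies; the mean value inequality then turns the seminorm into a Lipschitz
  constant.\<close>

lemma C2b_lipschitz:
  fixes f :: "real ^ 'n \<Rightarrow> real"
  assumes "f \<in> C2b"
  shows "0 \<le> C2b_seminorm f" "\<bar>f a - f b\<bar> \<le> C2b_seminorm f * norm (a - b)" "continuous_on UNIV f"
proof -
  have diff: "f differentiable (at x)" for x
    using assms Ck_Suc_differentiable[of 1 f x] by (simp add: C2b_def numeral_2_eq_2)
  obtain c1 c2 where c: "\<And>x. norm (grad f x) \<le> c1" "\<And>x. norm (hess f x) \<le> c2"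
    using assms by (auto simp: C2b_def bounded_iff)
  have "bdd_above (range (\<lambda>x. norm (grad f x) + norm (hess f x)))"
    using c by (intro bdd_aboveI2[where M="c1 + c2"] add_mono) auto
  then have le: "norm (grad f x) + norm (hess f x) \<le> C2b_seminorm f" for x
    unfolding C2b_seminorm_def by (intro cSUP_upper) auto
  have gle: "norm (grad f x) \<le> C2b_seminorm f" for x
    using le[of x] norm_ge_zero[of "hess f x"] by linarith
  show "0 \<le> C2b_seminorm f" using norm_ge_zero[of "grad f 0"] gle[of 0] by linarith
  have "norm (f a - f b) \<le> C2b_seminorm f * norm (a - b)"
  proof (rule differentiable_bound)
    show "(f has_derivative frechet_derivative f (at x)) (at x within UNIV)" for x
      using diff[of x] frechet_derivative_works by auto
    show "onorm (frechet_derivative f (at x)) \<le> C2b_seminorm f" for x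
    proof (rule onorm_le)
      fix v
      have "norm (frechet_derivative f (at x) v) \<le> norm (grad f x) * norm v"
        unfolding frechet_derivative_grad[OF diff] using Cauchy_Schwarz_ineq2[of "grad f x" v] by simp
      also have "\<dots> \<le> C2b_seminorm f * norm v" by (intro mult_right_mono gle) simp
      finally show "norm (frechet_derivative f (at x) v) \<le> C2b_seminorm f * norm v" .
    qed
  qed auto
  then show "\<bar>f a - f b\<bar> \<le> C2b_seminorm f * norm (a - b)" by simp
  show "continuous_on UNIV f"
    using diff by (intro continuous_at_imp_continuous_on) (auto intro: differentiable_imp_continuous_within)
qed

text \<open>Integrability of \<open>f (Y \<omega>)\<close> is obtained from that of
  \<open>f (X \<omega>)\<close> and of the difference, so the moments of the scheme are read off
  from the solution and the strong error.\<close>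

lemma (in prob_space) lipschitz_expectation_diff:
  fixes f :: "'b::euclidean_space \<Rightarrow> real"
  assumes f: "continuous_on UNIV f" "\<And>a b. \<bar>f a - f b\<bar> \<le> L * norm (a - b)" and L: "0 \<le> L"
    and X: "X \<in> borel_measurable M" "integrable M (\<lambda>\<omega>. norm (X \<omega>))" and Y: "Y \<in> borel_measurable M"
    and XY: "mean_le M (\<lambda>\<omega>. norm (X \<omega> - Y \<omega>)) c"
  shows "\<bar>(\<integral>\<omega>. f (X \<omega>) \<partial>M) - (\<integral>\<omega>. f (Y \<omega>) \<partial>M)\<bar> \<le> L * c"
proof -
  have fm: "f \<in> borel_measurable borel" by (rule borel_measurable_continuous_onI[OF f(1)])
  have Lm: "mean_le M (\<lambda>\<omega>. L * norm (X \<omega> - Y \<omega>)) (L * c)" by (rule mean_le_cmult[OF XY L])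
  have "integrable M (\<lambda>\<omega>. \<bar>f 0\<bar> + L * norm (X \<omega>))" using X(2) by simp
  then have intX: "integrable M (\<lambda>\<omega>. f (X \<omega>))"
  proof (rule Bochner_Integration.integrable_bound)
    show "AE \<omega> in M. norm (f (X \<omega>)) \<le> norm (\<bar>f 0\<bar> + L * norm (X \<omega>))" (is "AE \<omega> in M. ?P \<omega>")
    proof (rule AE_I2)
      fix \<omega>
      show "?P \<omega>"
        using f(2)[of "X \<omega>" 0] L by simp
    qed
  qed (rule measurable_compose[OF X(1) fm])
  have intd: "integrable M (\<lambda>\<omega>. f (X \<omega>) - f (Y \<omega>))"
    by (rule Bochner_Integration.integrable_bound[of _ "\<lambda>\<omega>. L * norm (X \<omega> - Y \<omega>)"])
      (use Lm f(2) L measurable_compose[OF X(1) fm] measurable_compose[OF Y fm] in \<open>auto simp: mean_le_def\<close>)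
  have intY: "integrable M (\<lambda>\<omega>. f (Y \<omega>))"
    using Bochner_Integration.integrable_diff[OF intX intd] by simp
  have "\<bar>(\<integral>\<omega>. f (X \<omega>) \<partial>M) - (\<integral>\<omega>. f (Y \<omega>) \<partial>M)\<bar> = \<bar>\<integral>\<omega>. f (X \<omega>) - f (Y \<omega>) \<partial>M\<bar>"
    using intX intY by simp
  also have "\<dots> \<le> (\<integral>\<omega>. \<bar>f (X \<omega>) - f (Y \<omega>)\<bar> \<partial>M)" by (rule integral_abs_bound)
  also have "\<dots> \<le> (\<integral>\<omega>. L * norm (X \<omega> - Y \<omega>) \<partial>M)"
    using intd Lm f(2) by (intro integral_mono) (auto simp: mean_le_def)
  also have "\<dots> \<le> L * c" using Lm by (simp add: mean_le_def)
  finally show ?thesis .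
qed

lemma one_plus_powr_le:
  fixes z :: real
  assumes "0 \<le> z" "0 \<le> a" "a \<le> b"
  shows "(1 + z) powr a \<le> 2 powr a * (1 + z powr b)"
proof -
  have "(1 + z) powr a \<le> (2 * max 1 z) powr a" using assms by (intro powr_mono2) auto
  also have "\<dots> = 2 powr a * (max 1 z) powr a" by (simp add: powr_mult)
  also have "(max 1 z) powr a \<le> (max 1 z) powr b" using assms by (intro powr_mono) auto
  also have "(max 1 z) powr b \<le> 1 + z powr b" by (auto simp: max_def)
  finally show ?thesis by simp
qed

text \<open>The dimension times \<open>\<beta>\<^sup>2\<close> is at least 1, so the squared
  Jacobians of the diffusion sum to at most \<open>\<rho> * lam x\<close>. Three times that is less
  than \<open>lam x\<close> because \<open>\<rho> < 1 / 5\<close>, and the remaining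
  \<open>1 - 3 * \<rho>\<close> times the positive infimum of \<open>lam\<close> is the
  rate.\<close>

lemma condition_AB_dissipative_sde:
  fixes U0 :: "real ^ 'n \<Rightarrow> real ^ 'n" and V :: "'d::finite \<Rightarrow> real ^ 'n \<Rightarrow> real ^ 'n"
  assumes "filtered_prob_space M F" and "brownian_family M F B"
    and U0: "smooth U0" and V: "\<And>k. smooth (V k)"
    and A: "condition_A U0 V c0 c1 c2 q K b0 b1" and Bc: "condition_B U0 V \<beta> lam \<alpha> \<rho> Khat"
  shows "dissipative_sde M F B U0 V ((1 - 3 * \<rho>) * (INF x. lam x)) c1 c2 q K"
proof -
  have B1: "\<beta> \<ge> 1" "\<And>x. lam x > 0" "(INF x. lam x) > 0" "0 < \<rho>" "\<rho> < 1 / 5"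
    and BU: "\<And>x v. v \<bullet> (jacobian U0 (at x) *v v) \<le> - lam x * (norm v)\<^sup>2"
    and BV: "\<And>x. (\<Sum>k\<in>UNIV. (norm (jacobian (V k) (at x)))\<^sup>2) \<le> \<rho> / (real CARD('n) * \<beta>\<^sup>2) * lam x"
    using Bc by (auto simp: condition_B_def)
  have inf: "(INF x. lam x) \<le> lam x" for x
    by (rule cINF_lower) (use B1(2) in \<open>auto intro!: bdd_belowI2[where m=0] less_imp_le\<close>)
  have V3: "3 * (\<Sum>k\<in>UNIV. (norm (jacobian (V k) (at x)))\<^sup>2) \<le> lam x - (1 - 3 * \<rho>) * (INF x. lam x)" for x
  proof -
    have "1 \<le> real CARD('n) * \<beta>\<^sup>2"
      using mult_mono[of 1 "real CARD('n)" 1 "\<beta>\<^sup>2"] one_le_power[OF B1(1), of 2] by (simp add: Suc_leI)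
    then have "\<rho> / (real CARD('n) * \<beta>\<^sup>2) \<le> \<rho>"
      using B1(4) by (simp add: divide_le_eq mult_left_le)
    then have "\<rho> / (real CARD('n) * \<beta>\<^sup>2) * lam x \<le> \<rho> * lam x"
      using B1(2)[of x] by (intro mult_right_mono) auto
    moreover have "(1 - 3 * \<rho>) * (INF x. lam x) \<le> (1 - 3 * \<rho>) * lam x"
      using B1(5) inf by (intro mult_left_mono) auto
    ultimately show ?thesis using BV[of x] by (simp add: algebra_simps)
  qed
  show ?thesis
  proof (intro dissipative_sde.intro brownian.intro dissipative_sde_axioms.intro)
    show "filtered_prob_space M F" "brownian_family M F B" by fact+
    show "continuous_on UNIV U0" "continuous_on UNIV (V k)" for k
      using smooth_differentiable[OF U0] smooth_differentiable[OF V]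
      by (auto intro!: continuous_at_imp_continuous_on intro: differentiable_imp_continuous_within)
    show "(1 - 3 * \<rho>) * (INF x. lam x) > 0" using B1 by (intro mult_pos_pos) auto
    show "(U0 a - U0 b) \<bullet> (a - b) + 3 * (\<Sum>k\<in>UNIV. (norm (V k a - V k b))\<^sup>2)
        \<le> - ((1 - 3 * \<rho>) * (INF x. lam x)) * (norm (a - b))\<^sup>2" for a b
      by (rule jacobian_bound_mvt[where lam=lam, OF smooth_differentiable[OF U0] smooth_differentiable[OF V] _ BU V3]) simp
  qed (use A in \<open>auto simp: condition_A_def\<close>)
qed

theorem theorem4p11:
  fixes M :: "'w measure" and F :: "real \<Rightarrow> 'w measure"
    and B :: "'d::finite \<Rightarrow> real \<Rightarrow> 'w \<Rightarrow> real"
    and U0 :: "real ^ 'n \<Rightarrow> real ^ 'n" and V :: "'d \<Rightarrow> real ^ 'n \<Rightarrow> real ^ 'n"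
    and c0 c1 c2 q K b0 b1 \<beta> \<alpha> \<rho> Khat :: real and lam :: "real ^ 'n \<Rightarrow> real"
  assumes "filtered_prob_space M F"
    and "brownian_family M F B"
    and "smooth U0" and "\<And>k. smooth (V k)"
    and "condition_A U0 V c0 c1 c2 q K b0 b1"
    and "condition_B U0 V \<beta> lam \<alpha> \<rho> Khat"
  shows "\<exists>C>0. \<exists>\<delta>0>0. \<forall>x. \<forall>f\<in>C2b. \<forall>\<delta>\<in>{0<..<\<delta>0}. \<forall>X Y.
    sde_solution M F B U0 V x X \<longrightarrow> implicit_euler M B U0 V x \<delta> Y \<longrightarrow>
    (SUP n. ereal \<bar>(\<integral>\<omega>. f (X (real n * \<delta>) \<omega>) \<partial>M) - (\<integral>\<omega>. f (Y n \<omega>) \<partial>M)\<bar>)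
      \<le> ereal (C * C2b_seminorm f * sqrt \<delta> * (1 + norm x powr ((2 * q + 1) * (q + 1))))"
proof -
  define \<mu> where "\<mu> = (1 - 3 * \<rho>) * (INF x. lam x)"
  interpret dissipative_sde M F B U0 V \<mu> c1 c2 q K
    unfolding \<mu>_def by (rule condition_AB_dissipative_sde[OF assms])
  obtain C where C: "C > 0" and err: "\<And>x X Y \<delta> n. solves x X \<Longrightarrow> 0 < \<delta> \<Longrightarrow> \<delta> \<le> 1 \<Longrightarrow> 4 * \<mu> * \<delta> \<le> 1
    \<Longrightarrow> implicit_euler M B U0 V x \<delta> Y
    \<Longrightarrow> mean_le M (\<lambda>\<omega>. (norm (X (real n * \<delta>) \<omega> - Y n \<omega>))\<^sup>2) (C * \<delta> * (1 + norm x) powr (4 * q + 2))"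
    using strong_error by blast
  \<comment> \<open>A first moment of \<open>X\<close> makes \<open>f (X \<omega>)\<close>
    integrable, since functions in \<open>C2b\<close> may grow linearly.\<close>
  obtain Cm where Cm: "0 \<le> Cm" "\<And>x X t. solves x X \<Longrightarrow> 0 \<le> t
    \<Longrightarrow> mean_le M (\<lambda>\<omega>. (1 + norm (X t \<omega>)) powr 1) (Cm * (1 + norm x) powr 1)"
    by (rule moment_powr[OF zero_le_one]) (rule that)
  define C' where "C' = sqrt C * 2 powr (2 * q + 1)"
  \<comment> \<open>\<open>\<delta> \<le> 1\<close> serves the one-step estimates on unit intervals
    and \<open>4 * \<mu> * \<delta> \<le> 1\<close> the contraction; neither depends on
    \<open>x\<close> or \<open>f\<close>.\<close>
  define \<delta>0 where "\<delta>0 = min 1 (1 / (4 * \<mu>))"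
  let ?R = "\<lambda>f \<delta> x. C' * C2b_seminorm f * sqrt \<delta> * (1 + norm x powr ((2 * q + 1) * (q + 1)))"
  let ?e = "\<lambda>f \<delta> X Y n. ereal \<bar>(\<integral>\<omega>. f (X (real n * \<delta>) \<omega>) \<partial>M) - (\<integral>\<omega>. f (Y n \<omega>) \<partial>M)\<bar>"
  have "(SUP n. ?e f \<delta> X Y n)
      \<le> ereal (?R f \<delta> x)"
    if f: "f \<in> C2b" and \<delta>: "\<delta> \<in> {0<..<\<delta>0}" and sol: "solves x X"
      and Y: "implicit_euler M B U0 V x \<delta> Y" for x f \<delta> X Y
  proof (rule SUP_least)
    fix n
    have \<delta>': "0 < \<delta>" "\<delta> \<le> 1" "4 * \<mu> * \<delta> \<le> 1"
      using \<delta> \<mu> by (auto simp: \<delta>0_def field_simps)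
    let ?L = "1 + norm x"
    have Xm: "X (real n * \<delta>) \<in> borel_measurable M" using \<delta>' by (intro measurable_X_M[OF sol]) auto
    have Ym: "Y n \<in> borel_measurable M" by (rule measurable_F_M[OF implicit_euler_measurable[OF Y \<delta>'(1)]])
    have "mean_le M (\<lambda>\<omega>. (1 + norm (X (real n * \<delta>) \<omega>)) powr 1) (Cm * ?L powr 1)"
      using \<delta>' by (intro Cm(2)[OF sol]) auto
    then have "integrable M (\<lambda>\<omega>. 1 + norm (X (real n * \<delta>) \<omega>))"
      by (simp add: mean_le_def add_nonneg_nonneg)
    then have intX: "integrable M (\<lambda>\<omega>. norm (X (real n * \<delta>) \<omega>))"
      using Bochner_Integration.integrable_diff[of M "\<lambda>\<omega>. 1 + norm (X (real n * \<delta>) \<omega>)" "\<lambda>_. 1"] by simp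
    have "mean_le M (\<lambda>\<omega>. norm (X (real n * \<delta>) \<omega> - Y n \<omega>)) (sqrt (C * \<delta> * ?L powr (4 * q + 2)))"
    proof (rule mean_le_norm_of_square[OF err[OF sol \<delta>' Y]])
      have "0 < ?L" by (simp add: add_pos_nonneg)
      then show "0 < C * \<delta> * ?L powr (4 * q + 2)" using C \<delta>' by simp
      show "(\<lambda>\<omega>. X (real n * \<delta>) \<omega> - Y n \<omega>) \<in> borel_measurable M" using Xm Ym by simp
    qed
    note diff = lipschitz_expectation_diff[OF C2b_lipschitz(3)[OF f] C2b_lipschitz(2)[OF f] C2b_lipschitz(1)[OF f] Xm intX Ym this]
    \<comment> \<open>The root of the mean square error halves the exponent
      \<open>4 * q + 2\<close>; since \<open>q\<close> is positive, \<open>2 * q + 1\<close> is at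
      most \<open>(2 * q + 1) * (q + 1)\<close>.\<close>
    have "sqrt (?L powr (4 * q + 2)) = ?L powr (2 * q + 1)"
    proof -
      have "?L powr (4 * q + 2) = (?L powr (2 * q + 1))\<^sup>2"
        by (simp add: power2_eq_square powr_add[symmetric])
      then show ?thesis by simp
    qed
    also have "\<dots> \<le> 2 powr (2 * q + 1) * (1 + norm x powr ((2 * q + 1) * (q + 1)))"
      using q by (intro one_plus_powr_le) (auto simp: algebra_simps)
    finally have pow: "sqrt (?L powr (4 * q + 2)) \<le> 2 powr (2 * q + 1) * (1 + norm x powr ((2 * q + 1) * (q + 1)))" .
    have "C2b_seminorm f * sqrt (C * \<delta> * ?L powr (4 * q + 2))
        = C2b_seminorm f * (sqrt C * sqrt \<delta>) * sqrt (?L powr (4 * q + 2))"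
      by (simp add: real_sqrt_mult)
    also have "\<dots> \<le> C2b_seminorm f * (sqrt C * sqrt \<delta>) * (2 powr (2 * q + 1) * (1 + norm x powr ((2 * q + 1) * (q + 1))))"
      using C \<delta>' C2b_lipschitz(1)[OF f] by (intro mult_left_mono pow) auto
    also have "\<dots> = ?R f \<delta> x"
      by (simp add: C'_def mult_ac)
    finally show "?e f \<delta> X Y n
        \<le> ereal (?R f \<delta> x)"
      using diff by simp
  qed
  moreover have "C' > 0" using C by (simp add: C'_def)
  moreover have "\<delta>0 > 0" using \<mu> by (simp add: \<delta>0_def)
  ultimately show ?thesis by blast
qed

end
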